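(* Let $n\ge 2$. The group $\mathrm{Aut}(X_n^{\mathbb Z},\sigma_n)$ is a central extension of $\langle\sigma_n\rangle$ by $\mathcal L_n$. That is, there is a short exact sequence of groups $$1\to\langle \sigma_n\rangle \hookrightarrow \mathrm{Aut}(X_n^{\mathbb Z},\sigma_n)\twoheadrightarrow \mathcal L_n\to 1,$$ where $\langle\sigma_n\rangle\cong\mathbb Z$ embeds as the centre of $\mathrm{Aut}(X_n^{\mathbb Z},\sigma_n)$.
   Context: **Shift.** $X_n=\{0,1,\dots,n-1\}$; $X_n^{\mathbb Z}$ has the product topology; $\sigma_n$ sends $x$ to $y$ with $y_i=x_{i-1}$. $\mathrm{Aut}(X_n^{\mathbb Z},\sigma_n)$ is the group (under composition) of homeomorphisms of $X_n^{\mathbb Z}$ commuting with $\sigma_n$. **Transducers.** $X_n^*$ is the set of finite words ($\varepsilon$ the empty word), $X_n^+=X_n^*\setminus\{\varepsilon\}$, $X_n^{\mathbb N}$ the set of right-infinite words, $|w|$ the length of $w$. A transducer is $T=(X_n,Q_T,\pi_T,\lambda_T)$ with $Q_T$ a finite nonempty set of states, $\pi_T:X_n\times Q_T\to Q_T$, $\lambda_T:X_n\times Q_T\to X_n^*$, extended to words by $\pi_T(\varepsilon,q)=q$, $\lambda_T(\varepsilon,q)=\varepsilon$, $\pi_T(wx,q)=\pi_T(x,\pi_T(w,q))$, $\lambda_T(wx,q)=\lambda_T(w,q)\lambda_T(x,\pi_T(w,q))$, and $\lambda_T$ extended to infinite words. Always assumed: if $w\in X_n^+$ and $\pi_T(w,q)=q$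 then $\lambda_T(w,q)\ne\varepsilon$. Each state $q$ induces a continuous map $h_q:X_n^{\mathbb N}\to X_n^{\mathbb N}$, $w\mapsto\lambda_T(w,q)$. States $p,q$ (possibly of different transducers) are $\omega$-equivalent if $h_p=h_q$; $T$ is weakly minimal if distinct states are never $\omega$-equivalent. $\Lambda(w,q)$ is the greatest common prefix of $\{\lambda_T(wx,q):x\in X_n^{\mathbb N}\}$; $|\Lambda(\varepsilon,q)|\in\mathbb N\cup\{\infty\}$ is the extent of incomplete response of $q$, and $q$ is a state of incomplete response if $\Lambda(\varepsilon,q)\neq\varepsilon$. $T$ is strongly synchronizing if for some $k\ge 0$ (a synchronizing level), for each $w\in X_n^k$ the state $\pi_T(w,q)$ is independent of $q$; it is then called the state forced by $w$. The states forced by words of length $k$ form a subtransducer $\mathrm{core}(T)$; $T$ is core if $T=\mathrm{core}(T)$. For $x\in X_n^+$, $Z_x$ is the one-state transducer with output $x$ on every letter. A transducer is called minimal if either it is weakly minimal, strongly connected and has no states of incomplete response, or it is $Z_x$ with $x$ a prime word (not a proper power of a shorter word) lexicographically least among its rotations. Transducers are considered equal if there is a bijection of state sets matching $\omega$-equivalent states. **Reduction.** For a strongly synchronizing core transducer $C$ define a minimal transducer $[C]$: if some (equivalently every) state has infinite extent of incomplete response, each state of $C$ is $\omega$-equivalent to the state of some $Z_x$ with $x$ prime (unique up to rotation) and $[C]:=Z_{\bar x}$ with $\bar x$ the lexicographically least rotation of $x$; otherwise keep states and transitions, replace the output $\lambda_C(x,q)$ ($x\in X_n$) by the word obtained by deleting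 the prefix $\Lambda(\varepsilon,q)$ from $\Lambda(x,q)$, and then identify $\omega$-equivalent states. **Monoids and groups.** $T*U$ has states $Q_T\times Q_U$, $\pi_{T*U}(x,(p,q))=(\pi_T(x,p),\pi_U(\lambda_T(x,p),q))$, $\lambda_{T*U}(x,(p,q))=\lambda_U(\lambda_T(x,p),q)$. $\mathcal M_n$ is the monoid of minimal, strongly synchronizing, core transducers over $X_n$ with product $TU:=[\mathrm{core}(T*U)]$; its identity is the one-state identity transducer. $\widetilde{\mathcal O}_n\subseteq\mathcal M_n$ is the submonoid of those $T$ all of whose states $q$ have $h_q$ injective with clopen image; $\mathcal O_n$ is its largest inverse-closed subset (group of units); it is known that $\mathcal O_n\cong\mathrm{Out}(G_{n,n-1})$, $G_{n,r}$ the Higman–Thompson group. $\widetilde{\mathcal L}_n\subseteq\mathcal M_n$ is the submonoid of those $T$ such that for all $a\in X_n^*$, $q\in Q_T$ with $\pi_T(a,q)=q$ one has $|\lambda_T(a,q)|=|a|$. $\mathcal L_n:=\mathcal O_n\cap\widetilde{\mathcal L}_n$, a group. *)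

theory Defs
  imports
    "HOL-Analysis.Function_Topology"
    "HOL-Algebra.Bij"
    "HOL-Algebra.Elementary_Groups"
    "HOL-Library.Omega_Words_Fun"
    "HOL-Library.Extended_Nat"
begin

text \<open>
  The alphabet of size \<open>n\<close> is \<open>{..<n}\<close>, finite words over it are elements of \<open>lists {..<n}\<close>,
  and infinite words are functions into it, indexed by \<open>int\<close> (two-sided) or \<open>nat\<close> (right-infinite).
\<close>

definition seqs :: "nat \<Rightarrow> ('i \<Rightarrow> nat) set" where
  "seqs n = UNIV \<rightarrow> {..<n}"

definition seq_topology :: "nat \<Rightarrow> ('i \<Rightarrow> nat) topology" where
  "seq_topology n = product_topology (\<lambda>_. discrete_topology {..<n}) UNIV"

lemma topspace_seq_topology: "topspace (seq_topology n) = seqs n"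
  by (auto simp: seq_topology_def seqs_def)


section \<open>Automorphisms of the full two-sided shift\<close>

definition shift :: "nat \<Rightarrow> (int \<Rightarrow> nat) \<Rightarrow> (int \<Rightarrow> nat)" where
  "shift n = (\<lambda>x\<in>seqs n. \<lambda>i. x (i - 1))"

definition shift_aut :: "nat \<Rightarrow> ((int \<Rightarrow> nat) \<Rightarrow> (int \<Rightarrow> nat)) monoid" where
  "shift_aut n = (BijGroup (seqs n))
     \<lparr>carrier := {f \<in> Bij (seqs n). homeomorphic_map (seq_topology n) (seq_topology n) f \<and>
                                   (\<forall>x\<in>seqs n. f (shift n x) = shift n (f x))}\<rparr>"

definition center :: "('a, 'b) monoid_scheme \<Rightarrow> 'a set" where
  "center G = {z \<in> carrier G. \<forall>g\<in>carrier G. z \<otimes>\<^bsub>G\<^esub> g = g \<otimes>\<^bsub>G\<^esub> z}"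


section \<open>Transducers\<close>

record 'q transducer =
  states :: "'q set"
  trans :: "nat \<Rightarrow> 'q \<Rightarrow> 'q"
  out :: "nat \<Rightarrow> 'q \<Rightarrow> nat list"

definition trans_word :: "('q, 'm) transducer_scheme \<Rightarrow> nat list \<Rightarrow> 'q \<Rightarrow> 'q" where
  "trans_word T w q = fold (trans T) w q"

primrec out_word :: "('q, 'm) transducer_scheme \<Rightarrow> nat list \<Rightarrow> 'q \<Rightarrow> nat list" where
  "out_word T [] q = []"
| "out_word T (x # w) q = out T x q @ out_word T w (trans T x q)"

lemma trans_word_snoc: "trans_word T (w @ [x]) q = trans T x (trans_word T w q)"
  by (simp add: trans_word_def)

lemma out_word_snoc: "out_word T (w @ [x]) q = out_word T w q @ out T x (trans_word T w q)"
  by (induction w arbitrary: q) (simp_all add: trans_word_def)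

definition is_transducer :: "nat \<Rightarrow> 'q transducer \<Rightarrow> bool" where
  "is_transducer n T \<longleftrightarrow>
     finite (states T) \<and> states T \<noteq> {} \<and>
     (\<forall>x<n. \<forall>q\<in>states T. trans T x q \<in> states T \<and> out T x q \<in> lists {..<n}) \<and>
     (\<forall>w\<in>lists {..<n}. \<forall>q\<in>states T.
        w \<noteq> [] \<and> trans_word T w q = q \<longrightarrow> out_word T w q \<noteq> [])"

text \<open>
  The letter at position \<open>i\<close> of the output on an infinite word is read off from the output on a
  sufficiently long finite prefix; such a prefix exists by the last clause of \<^const>\<open>is_transducer\<close>.
\<close>
definition out_inf :: "'q transducer \<Rightarrow> (nat \<Rightarrow> nat) \<Rightarrow> 'q \<Rightarrow> (nat \<Rightarrow> nat)" where
  "out_inf T w q = (\<lambda>i. out_word T (map w [0..<(LEAST m. i < length (out_word T (map w [0..<m]) q))]) q ! i)"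

definition omega_equiv :: "nat \<Rightarrow> 'p transducer \<Rightarrow> 'p \<Rightarrow> 'q transducer \<Rightarrow> 'q \<Rightarrow> bool" where
  "omega_equiv n T p U q \<longleftrightarrow> (\<forall>w\<in>seqs n. out_inf T w p = out_inf U w q)"

definition weakly_minimal :: "nat \<Rightarrow> 'q transducer \<Rightarrow> bool" where
  "weakly_minimal n T \<longleftrightarrow>
     (\<forall>p\<in>states T. \<forall>q\<in>states T. p \<noteq> q \<longrightarrow> \<not> omega_equiv n T p T q)"

definition strongly_connected :: "nat \<Rightarrow> 'q transducer \<Rightarrow> bool" where
  "strongly_connected n T \<longleftrightarrow>
     (\<forall>p\<in>states T. \<forall>q\<in>states T. \<exists>w\<in>lists {..<n}. trans_word T w p = q)"

definition sync_level :: "nat \<Rightarrow> 'q transducer \<Rightarrow> nat \<Rightarrow> bool" where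
  "sync_level n T k \<longleftrightarrow>
     (\<forall>w\<in>lists {..<n}. length w = k \<longrightarrow>
        (\<forall>p\<in>states T. \<forall>q\<in>states T. trans_word T w p = trans_word T w q))"

definition strongly_synchronizing :: "nat \<Rightarrow> 'q transducer \<Rightarrow> bool" where
  "strongly_synchronizing n T \<longleftrightarrow> (\<exists>k. sync_level n T k)"

text \<open>The states forced by words of length \<open>k\<close> are the same for all synchronizing levels \<open>k\<close>.\<close>
definition core_states :: "nat \<Rightarrow> 'q transducer \<Rightarrow> 'q set" where
  "core_states n T =
     {trans_word T w q | w q. w \<in> lists {..<n} \<and> q \<in> states T \<and> sync_level n T (length w)}"

definition core :: "nat \<Rightarrow> 'q transducer \<Rightarrow> 'q transducer" where
  "core n T = T\<lparr>states := core_states n T\<rparr>"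

definition is_core :: "nat \<Rightarrow> 'q transducer \<Rightarrow> bool" where
  "is_core n T \<longleftrightarrow> T = core n T"


section \<open>Incomplete response\<close>

definition common_prefixes :: "(nat \<Rightarrow> nat) set \<Rightarrow> nat list set" where
  "common_prefixes S = {u. \<forall>z\<in>S. map z [0..<length u] = u}"

text \<open>
  The greatest common prefix of a nonempty set of infinite words may itself be infinite, so its
  length is an extended natural number; \<open>gcp S\<close> is meaningful only when that length is finite.
\<close>
definition gcp_length :: "(nat \<Rightarrow> nat) set \<Rightarrow> enat" where
  "gcp_length S = (SUP u\<in>common_prefixes S. enat (length u))"

definition gcp :: "(nat \<Rightarrow> nat) set \<Rightarrow> nat list" where
  "gcp S = arg_max length (\<lambda>u. u \<in> common_prefixes S)"

definition outputs :: "nat \<Rightarrow> 'q transducer \<Rightarrow> nat list \<Rightarrow> 'q \<Rightarrow> (nat \<Rightarrow> nat) set" where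
  "outputs n T w q = {out_inf T (w \<frown> x) q | x. x \<in> seqs n}"

definition Lambda :: "nat \<Rightarrow> 'q transducer \<Rightarrow> nat list \<Rightarrow> 'q \<Rightarrow> nat list" where
  "Lambda n T w q = gcp (outputs n T w q)"

definition response_extent :: "nat \<Rightarrow> 'q transducer \<Rightarrow> 'q \<Rightarrow> enat" where
  "response_extent n T q = gcp_length (outputs n T [] q)"

definition incomplete_response :: "nat \<Rightarrow> 'q transducer \<Rightarrow> 'q \<Rightarrow> bool" where
  "incomplete_response n T q \<longleftrightarrow> response_extent n T q \<noteq> 0"


section \<open>Minimal transducers and reduction\<close>

definition prime_word :: "nat list \<Rightarrow> bool" where
  "prime_word x \<longleftrightarrow>
     x \<noteq> [] \<and> \<not> (\<exists>u k. length u < length x \<and> x = concat (replicate k u))"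

definition least_rotation :: "nat list \<Rightarrow> bool" where
  "least_rotation x \<longleftrightarrow> (\<forall>k. (rotate k x, x) \<notin> lexord less_than)"

text \<open>The single state of \<open>Z\<^sub>x\<close> is a parameter, so that \<open>Z\<^sub>x\<close> is available at every state type.\<close>
definition Z_transducer :: "'q \<Rightarrow> nat list \<Rightarrow> 'q transducer" where
  "Z_transducer s x = \<lparr>states = {s}, trans = (\<lambda>_ _. s), out = (\<lambda>_ _. x)\<rparr>"

text \<open>Functions on states only matter on the state set and on letters below \<open>n\<close>.\<close>
definition is_Z :: "nat \<Rightarrow> 'q transducer \<Rightarrow> nat list \<Rightarrow> bool" where
  "is_Z n T x \<longleftrightarrow> (\<exists>s. states T = {s} \<and> (\<forall>a<n. trans T a s = s \<and> out T a s = x))"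

definition minimal :: "nat \<Rightarrow> 'q transducer \<Rightarrow> bool" where
  "minimal n T \<longleftrightarrow>
     weakly_minimal n T \<and> strongly_connected n T \<and> (\<forall>q\<in>states T. \<not> incomplete_response n T q) \<or>
     (\<exists>x\<in>lists {..<n}. prime_word x \<and> least_rotation x \<and> is_Z n T x)"

definition remove_incomplete :: "nat \<Rightarrow> 'q transducer \<Rightarrow> 'q transducer" where
  "remove_incomplete n C =
     C\<lparr>out := \<lambda>x q. drop (length (Lambda n C [] q)) (Lambda n C [x] q)\<rparr>"

definition omega_rel :: "nat \<Rightarrow> 'q transducer \<Rightarrow> ('q \<times> 'q) set" where
  "omega_rel n C = {(p, q). p \<in> states C \<and> q \<in> states C \<and> omega_equiv n C p C q}"

definition identify_states :: "nat \<Rightarrow> 'q transducer \<Rightarrow> 'q set transducer" where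
  "identify_states n C =
     \<lparr>states = states C // omega_rel n C,
      trans = (\<lambda>x P. omega_rel n C `` {trans C x (SOME p. p \<in> P)}),
      out = (\<lambda>x P. out C x (SOME p. p \<in> P))\<rparr>"

text \<open>
  In the degenerate case \<open>x\<close> is the prime word, lexicographically least among its rotations, such
  that every state of \<open>C\<close> is \<open>\<omega>\<close>-equivalent to the state of \<open>Z\<^sub>y\<close> for some rotation \<open>y\<close> of \<open>x\<close>.
\<close>
definition reduction :: "nat \<Rightarrow> 'q transducer \<Rightarrow> 'q set transducer" where
  "reduction n C =
     (if \<exists>q\<in>states C. response_extent n C q = \<infinity>
      then Z_transducer (states C)
             (THE x. x \<in> lists {..<n} \<and> prime_word x \<and> least_rotation x \<and>
                (\<forall>q\<in>states C. \<exists>k. omega_equiv n C q (Z_transducer () (rotate k x)) ()))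
      else identify_states n (remove_incomplete n C))"


section \<open>The monoid of minimal, strongly synchronizing, core transducers\<close>

definition product :: "'p transducer \<Rightarrow> 'q transducer \<Rightarrow> ('p \<times> 'q) transducer" where
  "product T U =
     \<lparr>states = states T \<times> states U,
      trans = (\<lambda>x (p, q). (trans T x p, trans_word U (out T x p) q)),
      out = (\<lambda>x (p, q). out_word U (out T x p) q)\<rparr>"

definition same_transducer :: "nat \<Rightarrow> 'p transducer \<Rightarrow> 'q transducer \<Rightarrow> bool" where
  "same_transducer n T U \<longleftrightarrow>
     (\<exists>f. bij_betw f (states T) (states U) \<and> (\<forall>q\<in>states T. omega_equiv n T q U (f q)))"

text \<open>
  State sets are finite, so every transducer can be renamed to one with states in \<open>nat\<close>.  Elements
  of the monoid are classes of such transducers modulo \<^const>\<open>same_transducer\<close>; \<open>tclass\<close> yields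
  the class of a transducer with an arbitrary state type.
\<close>
definition min_transducers :: "nat \<Rightarrow> nat transducer set" where
  "min_transducers n =
     {T. is_transducer n T \<and> minimal n T \<and> strongly_synchronizing n T \<and> is_core n T}"

definition tclass :: "nat \<Rightarrow> 'q transducer \<Rightarrow> nat transducer set" where
  "tclass n T = {U \<in> min_transducers n. same_transducer n T U}"

definition id_transducer :: "unit transducer" where
  "id_transducer = \<lparr>states = {()}, trans = (\<lambda>_ _. ()), out = (\<lambda>x _. [x])\<rparr>"

definition M_monoid :: "nat \<Rightarrow> nat transducer set monoid" where
  "M_monoid n =
     \<lparr>carrier = tclass n ` min_transducers n,
      monoid.mult = (\<lambda>A B. \<Union>T\<in>A. \<Union>U\<in>B. tclass n (reduction n (core n (product T U)))),
      one = tclass n id_transducer\<rparr>"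

definition O_tilde :: "nat \<Rightarrow> nat transducer set set" where
  "O_tilde n = tclass n ` {T \<in> min_transducers n. \<forall>q\<in>states T.
     inj_on (\<lambda>w. out_inf T w q) (seqs n) \<and>
     openin (seq_topology n) ((\<lambda>w. out_inf T w q) ` seqs n) \<and>
     closedin (seq_topology n) ((\<lambda>w. out_inf T w q) ` seqs n)}"

definition L_tilde :: "nat \<Rightarrow> nat transducer set set" where
  "L_tilde n = tclass n ` {T \<in> min_transducers n. \<forall>a\<in>lists {..<n}. \<forall>q\<in>states T.
     trans_word T a q = q \<longrightarrow> length (out_word T a q) = length a}"

definition L_group :: "nat \<Rightarrow> nat transducer set monoid" where
  "L_group n =
     (M_monoid n)\<lparr>carrier := Units ((M_monoid n)\<lparr>carrier := O_tilde n\<rparr>) \<inter> L_tilde n\<rparr>"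

end

theory Submission
  imports Defs "HOL-Analysis.T1_Spaces"
begin

text \<open>
  An automorphism \<open>f\<close> of the shift is a sliding block code. Fix the letters \<open>z\<close> at negative positions
  and vary the future \<open>x\<close>: up to some position \<open>delay z\<close> the point \<open>f (z.x)\<close> does not depend on \<open>x\<close>,
  and from there on it defines a map \<open>tail_map z\<close> of right-infinite words. There are finitely many
  such maps; they are the states of a minimal transducer, which determines its class and does not
  change when \<open>f\<close> is composed with a power of the shift. Composing codes multiplies
  transducers. Conversely, in a transducer all of whose loops preserve length the surplus of output
  over input along a path is the difference of a potential on states, so the outputs along a
  two-sided word can be placed consistently, which gives back a code. The kernel is computed
  directly: if all \<open>tail_map z\<close> are the identity then \<open>f\<close> is a translation. That the centre is no
  larger is Ryan's theorem, for which a single marker automorphism suffices: if \<open>f\<close> commutes with it,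
  then \<open>f\<close> maps a marker containing all words of the size of the window of \<open>f\<close> to a translate of itself.
\<close>

text \<open>All statements about transducers are reduced to sets of maps of right-infinite words.
  This works because an output that is a fixed prefix followed by a map with varying first letter
  splits in only one way (\<open>conc_branching_unique\<close>): the map of a state alone fixes the
  letters it writes and the maps of its successors, so chosen representatives never matter. The code
  of a transducer is built before anything is known about its invertibility. The theory is therefore
  developed for codes that are injective only among points with a common past
  (\<open>right_injective\<close>), which is what injective state maps provide. A second obstacle:
  an element of \<open>L_group n\<close> preserves length on loops, but its inverse is only given in
  \<open>O_tilde n\<close>. \<open>loop_length_inverse\<close> closes this gap; then both
  transducers have codes, inverse to each other up to translations. The group axioms of
  \<open>L_group n\<close> are inherited from \<open>shift_aut n\<close>, of which it is a
  homomorphic image.\<close>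

lemma in_seqs_iff: "x \<in> seqs n \<longleftrightarrow> (\<forall>i. x i < n)"
  by (auto simp: seqs_def)

lemma conc_in_seqs_iff: "w \<frown> x \<in> seqs n \<longleftrightarrow> w \<in> lists {..<n} \<and> x \<in> seqs n"
proof -
  have seqs: "y \<in> seqs n \<longleftrightarrow> range y \<subseteq> {..<n}" for y :: "nat \<Rightarrow> nat"
    by (auto simp: seqs_def)
  show ?thesis
    unfolding seqs range_conc by auto
qed

lemma build_in_seqs_iff [simp]: "a ## x \<in> seqs n \<longleftrightarrow> a < n \<and> x \<in> seqs n"
  using conc_in_seqs_iff[of "[a]" x n] by simp

lemma suffix_in_seqs: "x \<in> seqs n \<Longrightarrow> suffix k x \<in> seqs n"
  by (simp add: in_seqs_iff)

lemma map_upt_in_lists: "x \<in> seqs n \<Longrightarrow> map x [i..<j] \<in> lists {..<n}"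
  by (auto simp: in_seqs_iff)

lemma conc_eq_iff_same_length: "length u = length v \<Longrightarrow> u \<frown> x = v \<frown> y \<longleftrightarrow> u = v \<and> x = y"
  by (metis prefix_conc_length suffix_conc_length)

section \<open>Maps with varying first letter and unique removal of prefixes\<close>

text \<open>Over a nonempty alphabet this means that the values have empty greatest common prefix,
  that is, complete response; see \<open>branching_iff_gcp_length\<close>.\<close>

definition branching :: "nat \<Rightarrow> ((nat \<Rightarrow> nat) \<Rightarrow> (nat \<Rightarrow> nat)) \<Rightarrow> bool" where
  "branching n F \<longleftrightarrow> (\<exists>x\<in>seqs n. \<exists>y\<in>seqs n. F x 0 \<noteq> F y 0)"

text \<open>If \<open>v\<close> were longer than \<open>u\<close>, the letter at position
  \<open>length u\<close> would be \<open>F x 0\<close> on one side and the fixed letter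
  \<open>v ! length u\<close> on the other.\<close>

lemma conc_branching_length:
  assumes "\<And>x. x \<in> seqs n \<Longrightarrow> u \<frown> F x = v \<frown> G x" "branching n F"
  shows "length v \<le> length u"
proof (rule ccontr)
  assume "\<not> length v \<le> length u"
  then have "F x 0 = v ! length u" if "x \<in> seqs n" for x
    using fun_cong[OF assms(1)[OF that], of "length u"] by simp
  then show False
    using assms(2) by (auto simp: branching_def)
qed

text \<open>The workhorse of the development. It makes outputs, successors and reductions
  independent of the choices made in describing them.\<close>

lemma conc_branching_unique:
  assumes eq: "\<And>x. x \<in> seqs n \<Longrightarrow> u \<frown> F x = v \<frown> G x"
    and "branching n F" "branching n G"
  shows "u = v" and "\<And>x. x \<in> seqs n \<Longrightarrow> F x = G x"
proof -
  have "length v \<le> length u"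
    by (rule conc_branching_length[OF eq assms(2)])
  moreover have "length u \<le> length v"
    by (rule conc_branching_length[OF eq[symmetric] assms(3)])
  ultimately have len: "length u = length v"
    by simp
  have *: "u = v \<and> F x = G x" if "x \<in> seqs n" for x
    using eq[OF that] unfolding conc_eq_iff_same_length[OF len] .
  then show "\<And>x. x \<in> seqs n \<Longrightarrow> F x = G x"
    by blast
  show "u = v"
    using * assms(2) by (auto simp: branching_def)
qed

text \<open>Uniqueness of decompositions for the identity map; it turns an equality of outputs into
  an equality of lengths.\<close>

lemma conc_injective_length:
  assumes n: "n \<ge> 2" and eq: "\<And>x. x \<in> seqs n \<Longrightarrow> u \<frown> x = v \<frown> x"
  shows "length u = length v"
proof -
  have "branching n (\<lambda>x. x)"
    unfolding branching_def
    by (rule bexI[of _ "\<lambda>_. 0"], rule bexI[of _ "\<lambda>_. 1"]) (use n in \<open>simp_all add: in_seqs_iff\<close>)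
  then show ?thesis
    using conc_branching_unique(1)[of n u "\<lambda>x. x" v "\<lambda>x. x"] eq by blast
qed

lemma gcp_conc_branching:
  assumes F: "branching n F" and S: "S = {u \<frown> F x | x. x \<in> seqs n}"
  shows "gcp S = u" and "gcp_length S = enat (length u)"
proof -
  have u: "u \<in> common_prefixes S"
    by (auto simp: common_prefixes_def S intro!: nth_equalityI)
  have le: "length v \<le> length u" if v: "v \<in> common_prefixes S" for v
  proof (rule ccontr)
    assume *: "\<not> length v \<le> length u"
    have "F x 0 = v ! length u" if "x \<in> seqs n" for x
    proof -
      have "map (u \<frown> F x) [0..<length v] = v"
        using v that by (auto simp: common_prefixes_def S)
      from arg_cong[OF this, of "\<lambda>l. l ! length u"] * show ?thesis
        by simp
    qed
    then show False
      using F by (auto simp: branching_def)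
  qed
  \<comment> \<open>\<open>gcp\<close> is some longest common prefix, so equality of lengths has to
    be upgraded to equality of words.\<close>
  have uniq: "v = u" if v: "v \<in> common_prefixes S" "length v = length u" for v
  proof -
    obtain z where z: "z \<in> S"
      using F by (auto simp: S branching_def)
    then have "map z [0..<length v] = v" "map z [0..<length u] = u"
      using u v by (auto simp: common_prefixes_def)
    then show ?thesis
      using v(2) by metis
  qed
  show "gcp S = u"
    unfolding gcp_def
  proof (rule arg_maxI[where Q = "\<lambda>v. v = u"])
    show "u \<in> common_prefixes S" by (rule u)
  next
    fix v assume "v \<in> common_prefixes S"
    then show "\<not> length u < length v"
      using le by (simp add: not_less)
  next
    fix v assume v: "v \<in> common_prefixes S"
      and "\<forall>w. w \<in> common_prefixes S \<longrightarrow> \<not> length v < length w"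
    then have "length u \<le> length v"
      using u by (meson not_less)
    then show "v = u"
      using le[OF v] uniq[OF v] by simp
  qed
  show "gcp_length S = enat (length u)"
    unfolding gcp_length_def
    by (rule antisym) (auto intro!: SUP_least SUP_upper2[OF u] le)
qed

lemma branching_iff_gcp_length:
  "n \<ge> 1 \<Longrightarrow> branching n F \<longleftrightarrow> gcp_length {F x | x. x \<in> seqs n} = 0"
proof
  assume "branching n F"
  from gcp_conc_branching(2)[OF this, of "{F x | x. x \<in> seqs n}" "[]"]
  show "gcp_length {F x | x. x \<in> seqs n} = 0"
    by (simp add: zero_enat_def)
next
  assume n: "n \<ge> 1" and 0: "gcp_length {F x | x. x \<in> seqs n} = 0"
  show "branching n F"
  proof (rule ccontr)
    assume *: "\<not> branching n F"
    have "(\<lambda>_. 0) \<in> seqs n"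
      using n by (simp add: in_seqs_iff)
    with * have "F x 0 = F (\<lambda>_. 0) 0" if "x \<in> seqs n" for x
      using that unfolding branching_def by blast
    then have "[F (\<lambda>_. 0) 0] \<in> common_prefixes {F x | x. x \<in> seqs n}"
      by (auto simp: common_prefixes_def)
    then have "enat (length [F (\<lambda>_. 0) 0]) \<le> gcp_length {F x | x. x \<in> seqs n}"
      unfolding gcp_length_def by (rule SUP_upper)
    then show False
      using 0 by (simp add: zero_enat_def)
  qed
qed


section \<open>Transducers and the maps of their states\<close>

lemma
  assumes "is_transducer n T"
  shows finite_states: "finite (states T)"
    and states_nonempty: "states T \<noteq> {}"
    and trans_in_states: "q \<in> states T \<Longrightarrow> a < n \<Longrightarrow> trans T a q \<in> states T"
    and out_in_lists: "q \<in> states T \<Longrightarrow> a < n \<Longrightarrow> out T a q \<in> lists {..<n}"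
    and out_word_loop: "q \<in> states T \<Longrightarrow> w \<in> lists {..<n} \<Longrightarrow> w \<noteq> [] \<Longrightarrow> trans_word T w q = q
      \<Longrightarrow> out_word T w q \<noteq> []"
  using assms unfolding is_transducer_def by blast+

lemma trans_word_Nil [simp]: "trans_word T [] q = q"
  and trans_word_Cons [simp]: "trans_word T (a # w) q = trans_word T w (trans T a q)"
  by (simp_all add: trans_word_def)

lemma trans_word_append: "trans_word T (u @ v) q = trans_word T v (trans_word T u q)"
  by (simp add: trans_word_def)

lemma out_word_append:
  "out_word T (u @ v) q = out_word T u q @ out_word T v (trans_word T u q)"
  by (induction u arbitrary: q) auto

lemma trans_word_in_states:
  "is_transducer n T \<Longrightarrow> w \<in> lists {..<n} \<Longrightarrow> q \<in> states T \<Longrightarrow> trans_word T w q \<in> states T"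
  by (induction w arbitrary: q) (auto simp: is_transducer_def)

lemma out_word_in_lists:
  "is_transducer n T \<Longrightarrow> w \<in> lists {..<n} \<Longrightarrow> q \<in> states T \<Longrightarrow> out_word T w q \<in> lists {..<n}"
proof (induction w arbitrary: q)
  case (Cons a w)
  then show ?case
    using trans_word_in_states[of n T "[a]" q] by (auto simp: is_transducer_def)
qed simp

text \<open>A word at least as long as the number of states visits some state twice, and the loop in
  between writes a letter.\<close>

lemma out_word_nonempty:
  assumes T: "is_transducer n T" and q: "q \<in> states T" and w: "w \<in> lists {..<n}"
    and len: "card (states T) \<le> length w"
  shows "out_word T w q \<noteq> []"
proof -
  let ?s = "\<lambda>i. trans_word T (take i w) q"
  have tk: "take i w \<in> lists {..<n}" for i
    using w by (auto dest: in_set_takeD)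
  have "?s ` {..length w} \<subseteq> states T"
    using trans_word_in_states[OF T tk q] by auto
  then have "card (?s ` {..length w}) < card {..length w}"
    using T len by (metis card_atMost card_mono is_transducer_def le_imp_less_Suc le_trans)
  then have "\<not> inj_on ?s {..length w}"
    by (rule pigeonhole)
  then obtain i j where ij: "i < j" "j \<le> length w" "?s i = ?s j"
    unfolding inj_on_def Ball_def atMost_iff by (metis linorder_neqE_nat)
  let ?v = "drop i (take j w)"
  have eq: "w = take i w @ ?v @ drop j w"
    using ij by (metis append.assoc append_take_drop_id less_imp_le_nat min.absorb1 take_take)
  have "?s j = trans_word T ?v (?s i)"
    using ij by (metis append_take_drop_id less_imp_le_nat min.absorb1 take_take trans_word_append)
  moreover have "?v \<in> lists {..<n}" "?v \<noteq> []"
    using w ij by (auto dest!: in_set_dropD in_set_takeD)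
  ultimately have "out_word T ?v (?s i) \<noteq> []"
    using T trans_word_in_states[OF T tk q] ij by (metis is_transducer_def)
  then show ?thesis
    by (subst eq) (simp only: out_word_append, simp)
qed

text \<open>Cut the word into pieces of length \<open>card (states T)\<close>, each of which writes
  a letter. This is why \<open>out_inf\<close> is well defined.\<close>

lemma out_word_unbounded:
  assumes T: "is_transducer n T" and "q \<in> states T" "w \<in> lists {..<n}"
    and "i * card (states T) \<le> length w"
  shows "i \<le> length (out_word T w q)"
  using assms(2-)
proof (induction i arbitrary: w q)
  case (Suc i)
  let ?u = "take (card (states T)) w" and ?v = "drop (card (states T)) w"
  have uv: "?u \<in> lists {..<n}" "?v \<in> lists {..<n}"
    using Suc.prems by (auto dest: in_set_dropD in_set_takeD)
  have "out_word T ?u q \<noteq> []"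
    using Suc.prems uv by (intro out_word_nonempty[OF T]) auto
  moreover have "i \<le> length (out_word T ?v (trans_word T ?u q))"
    using Suc.prems uv trans_word_in_states[OF T uv(1)] by (intro Suc.IH) auto
  ultimately show ?case
    using out_word_append[of T ?u ?v q]
    by (cases "out_word T ?u q") auto
qed simp

lemma out_word_prefix_mono:
  assumes "m \<le> m'"
  obtains v where "out_word T (map x [0..<m']) q = out_word T (map x [0..<m]) q @ v"
proof -
  have "map x [0..<m'] = map x [0..<m] @ map x [m..<m']"
    using assms by (metis le_add_diff_inverse map_append upt_add_eq_append zero_le)
  then show thesis
    using that by (simp only: out_word_append)
qed

lemma out_inf_nth:
  assumes "i < length (out_word T (map x [0..<m]) q)"
  shows "out_inf T x q i = out_word T (map x [0..<m]) q ! i"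
proof -
  let ?l = "LEAST m. i < length (out_word T (map x [0..<m]) q)"
  have *: "i < length (out_word T (map x [0..<?l]) q)" "?l \<le> m"
    using assms by (auto intro: LeastI Least_le)
  obtain v where "out_word T (map x [0..<m]) q = out_word T (map x [0..<?l]) q @ v"
    by (rule out_word_prefix_mono[OF *(2)])
  with *(1) show ?thesis
    by (simp add: out_inf_def nth_append)
qed

lemma out_inf_eqI:
  assumes "\<And>m. \<exists>y. z = out_word T (map x [0..<m]) q \<frown> y"
    and "\<And>i. \<exists>m. i < length (out_word T (map x [0..<m]) q)"
  shows "out_inf T x q = z"
proof
  fix i
  obtain m where m: "i < length (out_word T (map x [0..<m]) q)"
    using assms(2) by blast
  then show "out_inf T x q i = z i"
    using out_inf_nth[OF m] assms(1)[of m] by auto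
qed

lemma map_conc_upt_add: "map (w \<frown> x) [0..<length w + m] = w @ map x [0..<m]"
  by (rule nth_equalityI) (auto simp: nth_append)

lemma out_word_prefix_unbounded:
  assumes "is_transducer n T" "q \<in> states T" "x \<in> seqs n"
  shows "\<exists>m. i < length (out_word T (map x [0..<m]) q)"
  using out_word_unbounded[OF assms(1,2) map_upt_in_lists[OF assms(3)], of "Suc i" 0
      "Suc i * card (states T)"]
  by (auto simp: Suc_le_eq)

lemma out_inf_conc:
  assumes T: "is_transducer n T" and q: "q \<in> states T" and w: "w \<in> lists {..<n}"
    and x: "x \<in> seqs n"
  shows "out_inf T (w \<frown> x) q = out_word T w q \<frown> out_inf T x (trans_word T w q)"
proof
  fix i
  have q': "trans_word T w q \<in> states T"
    by (rule trans_word_in_states[OF T w q])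
  obtain m where m: "i < length (out_word T (map x [0..<m]) (trans_word T w q))"
    using out_word_prefix_unbounded[OF T q' x] by blast
  then have "out_inf T (w \<frown> x) q i
      = (out_word T w q @ out_word T (map x [0..<m]) (trans_word T w q)) ! i"
    by (subst out_inf_nth[where m = "length w + m"]) (simp_all add: map_conc_upt_add out_word_append)
  moreover have "out_inf T x (trans_word T w q) (i - length (out_word T w q))
      = out_word T (map x [0..<m]) (trans_word T w q) ! (i - length (out_word T w q))"
    using m by (intro out_inf_nth) simp
  ultimately show "out_inf T (w \<frown> x) q i = (out_word T w q \<frown> out_inf T x (trans_word T w q)) i"
    by (simp add: nth_append conc_def)
qed

lemma out_inf_in_seqs:
  assumes T: "is_transducer n T" and q: "q \<in> states T" and x: "x \<in> seqs n"
  shows "out_inf T x q \<in> seqs n"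
  unfolding in_seqs_iff
proof
  fix i
  obtain m where m: "i < length (out_word T (map x [0..<m]) q)"
    using out_word_prefix_unbounded[OF assms] by blast
  moreover have "out_word T (map x [0..<m]) q \<in> lists {..<n}"
    by (rule out_word_in_lists[OF T map_upt_in_lists[OF x] q])
  ultimately show "out_inf T x q i < n"
    using out_inf_nth[OF m] nth_mem by fastforce
qed

lemma sync_level_mono:
  assumes "sync_level n T k" "k \<le> l" "is_transducer n T"
  shows "sync_level n T l"
  unfolding sync_level_def
proof (intro ballI impI)
  fix w p q assume w: "w \<in> lists {..<n}" "length w = l" and pq: "p \<in> states T" "q \<in> states T"
  let ?u = "take (l - k) w" and ?v = "drop (l - k) w"
  have uv: "?u \<in> lists {..<n}" "?v \<in> lists {..<n}" "length ?v = k"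
    using w assms(2) by (auto dest: in_set_dropD in_set_takeD)
  have "trans_word T ?u p \<in> states T" "trans_word T ?u q \<in> states T"
    using trans_word_in_states[OF assms(3) uv(1)] pq by auto
  then have "trans_word T ?v (trans_word T ?u p) = trans_word T ?v (trans_word T ?u q)"
    using assms(1) uv unfolding sync_level_def by blast
  then show "trans_word T w p = trans_word T w q"
    by (metis append_take_drop_id trans_word_append)
qed

text \<open>Letters put in front of a synchronizing word do not change the forced state, so the
  forcing word can be taken as long as desired.\<close>

lemma core_states_long_word:
  assumes T: "is_transducer n T" and "s \<in> core_states n T" "n \<ge> 1"
  obtains w q where "w \<in> lists {..<n}" "q \<in> states T" "k \<le> length w" "sync_level n T (length w)"
    "s = trans_word T w q"
proof -
  obtain w q where w: "w \<in> lists {..<n}" "q \<in> states T" "sync_level n T (length w)"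
      and s: "s = trans_word T w q"
    using assms(2) by (auto simp: core_states_def)
  let ?w = "replicate k 0 @ w"
  have r: "replicate k 0 \<in> lists {..<n}"
    using assms(3) by (auto split: if_splits simp: set_replicate_conv_if)
  then have "trans_word T (replicate k 0) q \<in> states T"
    using trans_word_in_states[OF T] w by blast
  then have s': "s = trans_word T ?w q"
    using w s unfolding sync_level_def trans_word_append by blast
  have "sync_level n T (length ?w)"
    by (rule sync_level_mono[OF w(3) _ T]) simp
  then show thesis
    using that[OF _ w(2) _ _ s'] w(1) r by simp
qed

lemma core_states_subset: "is_transducer n T \<Longrightarrow> core_states n T \<subseteq> states T"
  by (auto simp: core_states_def intro!: trans_word_in_states)

lemma core_states_trans:
  assumes "is_transducer n T" "s \<in> core_states n T" "a < n"
  shows "trans T a s \<in> core_states n T"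
proof -
  obtain w q where w: "w \<in> lists {..<n}" "q \<in> states T" "sync_level n T (length w)"
      and s: "s = trans_word T w q"
    using assms(2) by (auto simp: core_states_def)
  have "sync_level n T (length (w @ [a]))"
    by (rule sync_level_mono[OF w(3) _ assms(1)]) simp
  then show ?thesis
    using w s assms(3) unfolding core_states_def
    by (intro CollectI exI[of _ "w @ [a]"] exI[of _ q]) (simp add: trans_word_append)
qed

lemma trans_word_core [simp]: "trans_word (core n T) = trans_word T"
  by (simp add: core_def trans_word_def fun_eq_iff)

lemma out_word_core [simp]: "out_word (core n T) w q = out_word T w q"
  by (induction w arbitrary: q) (simp_all add: core_def)

lemma out_inf_core [simp]: "out_inf (core n T) = out_inf T"
  by (simp add: out_inf_def fun_eq_iff)

lemma states_core [simp]: "states (core n T) = core_states n T"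
  by (simp add: core_def)

lemma is_transducer_core:
  assumes T: "is_transducer n T" and "strongly_synchronizing n T" and "n \<ge> 1"
  shows "is_transducer n (core n T)"
proof -
  obtain k where k: "sync_level n T k"
    using assms(2) by (auto simp: strongly_synchronizing_def)
  obtain q where q: "q \<in> states T"
    using T by (auto simp: is_transducer_def)
  have "replicate k 0 \<in> lists {..<n}"
    using \<open>n \<ge> 1\<close> by (auto split: if_splits simp: set_replicate_conv_if)
  with k q have "trans_word T (replicate k 0) q \<in> core_states n T"
    unfolding core_states_def by (metis (mono_tags, lifting) CollectI length_replicate)
  then have "core_states n T \<noteq> {}"
    by blast
  moreover have "finite (core_states n T)"
    using T core_states_subset[OF T] by (auto simp: is_transducer_def intro: finite_subset)
  moreover have "trans (core n T) = trans T" "out (core n T) = out T"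
    by (simp_all add: core_def)
  moreover have "trans T x q \<in> core_states n T \<and> out T x q \<in> lists {..<n}"
    if "x < n" "q \<in> core_states n T" for x q
    using that core_states_trans[OF T] out_in_lists[OF T] core_states_subset[OF T] by blast
  moreover have "out_word T w q \<noteq> []"
    if "w \<in> lists {..<n}" "q \<in> core_states n T" "w \<noteq> []" "trans_word T w q = q" for w q
    using that out_word_loop[OF T] core_states_subset[OF T] by blast
  ultimately show ?thesis
    unfolding is_transducer_def states_core trans_word_core out_word_core by simp
qed

section \<open>Transducers as sets of maps\<close>

text \<open>Restriction fixes the values outside \<open>seqs n\<close>, so that omega-equivalence of
  states becomes equality of functions.\<close>

definition state_map :: "nat \<Rightarrow> 'q transducer \<Rightarrow> 'q \<Rightarrow> (nat \<Rightarrow> nat) \<Rightarrow> (nat \<Rightarrow> nat)" where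
  "state_map n T q = (\<lambda>x\<in>seqs n. out_inf T x q)"

definition state_maps :: "nat \<Rightarrow> 'q transducer \<Rightarrow> ((nat \<Rightarrow> nat) \<Rightarrow> (nat \<Rightarrow> nat)) set" where
  "state_maps n T = state_map n T ` states T"

definition map_class :: "nat \<Rightarrow> ((nat \<Rightarrow> nat) \<Rightarrow> (nat \<Rightarrow> nat)) set \<Rightarrow> nat transducer set" where
  "map_class n H = {T \<in> min_transducers n. state_maps n T = H}"

lemma omega_equiv_iff: "omega_equiv n T p U q \<longleftrightarrow> state_map n T p = state_map n U q"
  by (auto simp: omega_equiv_def state_map_def fun_eq_iff restrict_def)

lemma weakly_minimal_iff: "weakly_minimal n T \<longleftrightarrow> inj_on (state_map n T) (states T)"
  by (auto simp: weakly_minimal_def omega_equiv_iff inj_on_def)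

lemma min_transducers_weakly_minimal: "T \<in> min_transducers n \<Longrightarrow> weakly_minimal n T"
  by (auto simp: min_transducers_def minimal_def is_Z_def weakly_minimal_def)

text \<open>Weak minimality makes \<open>state_map\<close> injective on states, so the bijection of
  states can be read off from equal sets of maps.\<close>

lemma same_transducer_iff:
  assumes "weakly_minimal n T" "weakly_minimal n U"
  shows "same_transducer n T U \<longleftrightarrow> state_maps n T = state_maps n U"
proof
  assume "same_transducer n T U"
  then obtain f where f: "bij_betw f (states T) (states U)"
    "\<forall>q\<in>states T. state_map n T q = state_map n U (f q)"
    by (auto simp: same_transducer_def omega_equiv_iff)
  then have "state_maps n T = state_map n U ` f ` states T"
    by (auto simp: state_maps_def image_image)
  then show "state_maps n T = state_maps n U"
    using f(1) by (simp add: state_maps_def bij_betw_def)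
next
  assume eq: "state_maps n T = state_maps n U"
  have T: "bij_betw (state_map n T) (states T) (state_maps n U)"
    unfolding eq[symmetric] using assms(1) by (simp add: weakly_minimal_iff bij_betw_def state_maps_def)
  have U: "bij_betw (state_map n U) (states U) (state_maps n U)"
    using assms(2) by (simp add: weakly_minimal_iff bij_betw_def state_maps_def)
  let ?f = "the_inv_into (states U) (state_map n U) \<circ> state_map n T"
  have "bij_betw ?f (states T) (states U)"
    by (rule bij_betw_trans[OF T bij_betw_the_inv_into[OF U]])
  moreover have "state_map n U (?f q) = state_map n T q" if "q \<in> states T" for q
    using T U that by (auto simp: bij_betw_def intro!: f_the_inv_into_f)
  ultimately show "same_transducer n T U"
    by (auto simp: same_transducer_def omega_equiv_iff)
qed

lemma tclass_eq: "weakly_minimal n T \<Longrightarrow> tclass n T = map_class n (state_maps n T)"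
  unfolding tclass_def map_class_def
  using same_transducer_iff[of n T] min_transducers_weakly_minimal[of _ n] by metis


section \<open>Reduction\<close>

lemma conc_eq_prefix:
  assumes "u \<frown> y = v \<frown> z" "length v \<le> length u"
  shows "v @ drop (length v) u = u"
proof -
  have "take (length v) u = v"
  proof (rule nth_equalityI)
    fix i assume "i < length (take (length v) u)"
    then show "take (length v) u ! i = v ! i"
      using fun_cong[OF assms(1), of i] assms(2) by simp
  qed (use assms(2) in simp)
  then show ?thesis
    by (metis append_take_drop_id)
qed

text \<open>The nondegenerate case of the reduction: \<open>v s\<close> is the incomplete response
  of \<open>s\<close>, of finite length, and \<open>h s\<close> is the branching map that
  remains.\<close>

context
  fixes n :: nat and C :: "'q transducer" and v :: "'q \<Rightarrow> nat list"
    and h :: "'q \<Rightarrow> (nat \<Rightarrow> nat) \<Rightarrow> (nat \<Rightarrow> nat)"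
  assumes C: "is_transducer n C"
    and out_C: "\<And>s x. s \<in> states C \<Longrightarrow> x \<in> seqs n \<Longrightarrow> out_inf C x s = v s \<frown> h s x"
    and br: "\<And>s. s \<in> states C \<Longrightarrow> branching n (h s)"
begin

lemma outputs_conc:
  assumes s: "s \<in> states C" and w: "w \<in> lists {..<n}"
  shows "outputs n C w s
    = {(out_word C w s @ v (trans_word C w s)) \<frown> h (trans_word C w s) x | x. x \<in> seqs n}"
proof -
  have "out_inf C (w \<frown> x) s = (out_word C w s @ v (trans_word C w s)) \<frown> h (trans_word C w s) x"
    if "x \<in> seqs n" for x
    using out_inf_conc[OF C s w that] out_C[OF trans_word_in_states[OF C w s] that] by simp
  then show ?thesis
    unfolding outputs_def by (metis (no_types, opaque_lifting))
qed

lemma Lambda_eq: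
  assumes "s \<in> states C" "w \<in> lists {..<n}"
  shows "Lambda n C w s = out_word C w s @ v (trans_word C w s)"
  unfolding Lambda_def
  by (rule gcp_conc_branching(1)[OF br outputs_conc[OF assms]]) (rule trans_word_in_states[OF C assms(2,1)])

lemma response_extent_eq:
  assumes s: "s \<in> states C"
  shows "response_extent n C s = enat (length (v s))"
  using gcp_conc_branching(2)[OF br outputs_conc[OF s, of "[]"]] s by (simp add: response_extent_def)

text \<open>An output on a word beginning with \<open>a\<close> starts with \<open>v s\<close> and
  also with \<open>out C a s @ v (trans C a s)\<close>. After the latter the letters branch, so
  \<open>v s\<close> is a prefix of it, and the \<open>drop\<close> in
  \<open>remove_incomplete\<close> removes exactly \<open>v s\<close>.\<close>

lemma remove_incomplete_step:
  assumes s: "s \<in> states C" and a: "a < n"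
  shows "v s @ out (remove_incomplete n C) a s = out C a s @ v (trans C a s)"
proof -
  let ?s = "trans C a s"
  have s': "?s \<in> states C"
    by (rule trans_in_states[OF C s a])
  have eq: "(out C a s @ v ?s) \<frown> h ?s x = v s \<frown> h s ([a] \<frown> x)" if x: "x \<in> seqs n" for x
  proof -
    have "[a] \<frown> x \<in> seqs n"
      using a x by (simp add: conc_in_seqs_iff)
    then show ?thesis
      using out_C[OF s, of "[a] \<frown> x"] out_inf_conc[OF C s, of "[a]" x] out_C[OF s' x] a x by simp
  qed
  have "length (v s) \<le> length (out C a s @ v ?s)"
    by (rule conc_branching_length[OF eq br[OF s']])
  moreover obtain x :: "nat \<Rightarrow> nat" where x: "x \<in> seqs n"
    using br[OF s] unfolding branching_def by blast
  ultimately have "v s @ drop (length (v s)) (out C a s @ v ?s) = out C a s @ v ?s"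
    using conc_eq_prefix[OF eq[OF x]] by blast
  then show ?thesis
    using Lambda_eq[OF s, of "[]"] Lambda_eq[OF s, of "[a]"] a by (simp add: remove_incomplete_def)
qed

lemma trans_word_remove_incomplete [simp]: "trans_word (remove_incomplete n C) = trans_word C"
  by (simp add: remove_incomplete_def trans_word_def fun_eq_iff)

text \<open>The one-step identities telescope: each state hands its pending prefix over to the next
  one.\<close>

lemma remove_incomplete_word:
  assumes "s \<in> states C" and "w \<in> lists {..<n}"
  shows "v s @ out_word (remove_incomplete n C) w s = out_word C w s @ v (trans_word C w s)"
  using assms
proof (induction w arbitrary: s)
  case (Cons a w)
  have tr: "trans (remove_incomplete n C) = trans C"
    by (simp add: remove_incomplete_def)
  have "v (trans C a s) @ out_word (remove_incomplete n C) w (trans C a s)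
      = out_word C w (trans C a s) @ v (trans_word C w (trans C a s))"
    using Cons.prems trans_in_states[OF C, of s a] by (intro Cons.IH) auto
  moreover have "v s @ out (remove_incomplete n C) a s = out C a s @ v (trans C a s)"
    using Cons.prems by (intro remove_incomplete_step) auto
  ultimately show ?case
    by (metis append_assoc out_word.simps(2) tr trans_word_Cons)
qed simp

lemma h_conc:
  assumes s: "s \<in> states C" and w: "w \<in> lists {..<n}" and x: "x \<in> seqs n"
  shows "h s (w \<frown> x) = out_word (remove_incomplete n C) w s \<frown> h (trans_word C w s) x"
proof -
  have "v s \<frown> h s (w \<frown> x) = (out_word C w s @ v (trans_word C w s)) \<frown> h (trans_word C w s) x"
    using out_C[OF s, of "w \<frown> x"] out_inf_conc[OF C s w x] w x
      out_C[OF trans_word_in_states[OF C w s] x] by (simp add: conc_in_seqs_iff)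
  also have "\<dots> = v s \<frown> out_word (remove_incomplete n C) w s \<frown> h (trans_word C w s) x"
    by (simp del: conc_conc add: conc_conc[symmetric] flip: remove_incomplete_word[OF s w])
  finally show ?thesis
    unfolding same_concat_eq .
qed

lemma out_inf_remove_incomplete:
  assumes s: "s \<in> states C" and x: "x \<in> seqs n"
  shows "out_inf (remove_incomplete n C) x s = h s x"
proof (rule out_inf_eqI)
  fix m
  have "h s (map x [0..<m] \<frown> suffix m x) = out_word (remove_incomplete n C) (map x [0..<m]) s
      \<frown> h (trans_word C (map x [0..<m]) s) (suffix m x)"
    by (intro h_conc s map_upt_in_lists suffix_in_seqs x)
  moreover have "map x [0..<m] \<frown> suffix m x = x"
    using prefix_suffix[of x m] by (simp add: subsequence_def)
  ultimately show "\<exists>y. h s x = out_word (remove_incomplete n C) (map x [0..<m]) s \<frown> y"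
    by auto
next
  fix i
  obtain m where "i + length (v s) < length (out_word C (map x [0..<m]) s)"
    using out_word_prefix_unbounded[OF C s x] by blast
  \<comment> \<open>The new output is shorter by at most \<open>length (v s)\<close>, so it stays
    unbounded.\<close>
  moreover have "length (v s) + length (out_word (remove_incomplete n C) (map x [0..<m]) s)
      \<ge> length (out_word C (map x [0..<m]) s)"
    using arg_cong[OF remove_incomplete_word[OF s map_upt_in_lists[OF x]], of length] by simp
  ultimately show "\<exists>m. i < length (out_word (remove_incomplete n C) (map x [0..<m]) s)"
    by (intro exI[of _ m]) simp
qed

lemma state_map_remove_incomplete:
  "s \<in> states C \<Longrightarrow> state_map n (remove_incomplete n C) s = restrict (h s) (seqs n)"
  by (auto simp: state_map_def restrict_def fun_eq_iff out_inf_remove_incomplete)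

text \<open>A class acts through a representative picked by \<open>SOME\<close>. States with equal
  maps write the same letters and move to states with equal maps, by uniqueness of decompositions,
  so the pick is harmless.\<close>

lemma out_word_identify_states:
  assumes "p \<in> states C" "w \<in> lists {..<n}"
  shows "out_word (identify_states n (remove_incomplete n C)) w (omega_rel n (remove_incomplete n C) `` {p})
    = out_word (remove_incomplete n C) w p"
  using assms
proof (induction w arbitrary: p)
  case (Cons a w)
  let ?R = "remove_incomplete n C"
  let ?r = "omega_rel n ?R"
  have st: "states ?R = states C" and tr: "trans ?R = trans C"
    by (simp_all add: remove_incomplete_def)
  define q where "q = (SOME p'. p' \<in> ?r `` {p})"
  have p: "p \<in> states C" and a: "a < n" and w: "w \<in> lists {..<n}"
    using Cons.prems by auto
  have "p \<in> ?r `` {p}"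
    using p by (simp add: omega_rel_def st omega_equiv_iff)
  then have "q \<in> ?r `` {p}"
    unfolding q_def by (rule someI)
  then have q: "q \<in> states C" and eq: "state_map n ?R p = state_map n ?R q"
    by (auto simp: omega_rel_def st omega_equiv_iff)
  have hpq: "h p x = h q x" if "x \<in> seqs n" for x
    using fun_cong[OF eq, of x] p q that by (simp add: state_map_remove_incomplete)
  have hs: "out ?R a p \<frown> h (trans C a p) x = out ?R a q \<frown> h (trans C a q) x" if "x \<in> seqs n" for x
    using h_conc[OF p, of "[a]" x] h_conc[OF q, of "[a]" x] hpq[of "[a] \<frown> x"] a that
    by (simp add: conc_in_seqs_iff)
  have p': "trans C a p \<in> states C" and q': "trans C a q \<in> states C"
    using trans_in_states[OF C] p q a by auto
  note * = conc_branching_unique[OF hs br[OF p'] br[OF q']]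
  have "state_map n ?R (trans C a p) = state_map n ?R (trans C a q)"
    using *(2) p' q' by (auto simp: state_map_remove_incomplete restrict_def fun_eq_iff)
  then have rel: "?r `` {trans C a q} = ?r `` {trans C a p}"
    by (auto simp: omega_rel_def st omega_equiv_iff p' q')
  have "out (identify_states n ?R) a (?r `` {p}) = out ?R a p"
    using *(1) by (simp add: identify_states_def q_def)
  moreover have "trans (identify_states n ?R) a (?r `` {p}) = ?r `` {trans C a p}"
    using rel by (simp add: identify_states_def q_def tr)
  ultimately show ?case
    using Cons.IH[OF p' w] by (simp add: tr)
qed simp

lemma state_map_identify_states:
  assumes p: "p \<in> states C"
  shows "state_map n (identify_states n (remove_incomplete n C)) (omega_rel n (remove_incomplete n C) `` {p})
    = restrict (h p) (seqs n)"
proof -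
  let ?P = "omega_rel n (remove_incomplete n C) `` {p}"
  have "out_inf (identify_states n (remove_incomplete n C)) x ?P = out_inf (remove_incomplete n C) x p"
    if "x \<in> seqs n" for x
    unfolding out_inf_def using out_word_identify_states[OF p map_upt_in_lists[OF that]] by simp
  then show ?thesis
    using p by (auto simp: state_map_def restrict_def fun_eq_iff out_inf_remove_incomplete)
qed

lemma
  shows state_maps_reduction: "state_maps n (reduction n C) = (\<lambda>s. restrict (h s) (seqs n)) ` states C"
    and weakly_minimal_reduction: "weakly_minimal n (reduction n C)"
proof -
  let ?R = "remove_incomplete n C"
  let ?r = "omega_rel n ?R"
  have st: "states ?R = states C"
    by (simp add: remove_incomplete_def)
  have red: "reduction n C = identify_states n ?R"
    using response_extent_eq by (auto simp: reduction_def)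
  have states: "states (reduction n C) = (\<lambda>p. ?r `` {p}) ` states C"
    by (auto simp: red identify_states_def quotient_def st)
  show "state_maps n (reduction n C) = (\<lambda>s. restrict (h s) (seqs n)) ` states C"
    using state_map_identify_states unfolding state_maps_def states image_image by (simp add: red)
  show "weakly_minimal n (reduction n C)"
    unfolding weakly_minimal_iff states
  proof (rule inj_onI, elim imageE)
    fix P Q p q
    assume P: "P = ?r `` {p}" "p \<in> states C" and Q: "Q = ?r `` {q}" "q \<in> states C"
      and eq: "state_map n (reduction n C) P = state_map n (reduction n C) Q"
    then have "state_map n ?R p = state_map n ?R q"
      using state_map_identify_states[of p] state_map_identify_states[of q]
      by (simp add: red state_map_remove_incomplete)
    then show "P = Q"
      unfolding P Q by (auto simp: omega_rel_def st omega_equiv_iff P Q)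
  qed
qed

end

section \<open>Right-injective sliding block codes\<close>

text \<open>Powers of the inverse shift, left unrestricted, unlike \<open>shift\<close>, so that
  they compose without side conditions.\<close>

definition translate :: "int \<Rightarrow> (int \<Rightarrow> nat) \<Rightarrow> (int \<Rightarrow> nat)" where
  "translate k x = (\<lambda>i. x (i + k))"

lemma translate_apply [simp]: "translate k x i = x (i + k)"
  by (simp add: translate_def)

lemma translate_in_seqs_iff [simp]: "translate k x \<in> seqs n \<longleftrightarrow> x \<in> seqs n"
  unfolding in_seqs_iff translate_apply by (metis diff_add_cancel)

lemma translate_translate [simp]: "translate k (translate l x) = translate (k + l) x"
  by (simp add: translate_def add.assoc)

lemma translate_0 [simp]: "translate 0 x = x"
  by (simp add: translate_def)

text \<open>Only the negative positions of \<open>z\<close> count. A past is represented throughout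
  by a whole two-sided sequence whose other half is irrelevant.\<close>

definition glue :: "(int \<Rightarrow> nat) \<Rightarrow> (nat \<Rightarrow> nat) \<Rightarrow> (int \<Rightarrow> nat)" where
  "glue z x = (\<lambda>i. if i < 0 then z i else x (nat i))"

definition future :: "(int \<Rightarrow> nat) \<Rightarrow> (nat \<Rightarrow> nat)" where
  "future x = (\<lambda>i. x (int i))"

lemma glue_neg [simp]: "i < 0 \<Longrightarrow> glue z x i = z i"
  and glue_nonneg [simp]: "\<not> i < 0 \<Longrightarrow> glue z x i = x (nat i)"
  by (simp_all add: glue_def)

lemma future_apply [simp]: "future x i = x (int i)"
  by (simp add: future_def)

lemma glue_future: "glue x (future x) = x"
  by (simp add: glue_def fun_eq_iff)

lemma future_glue [simp]: "future (glue z x) = x"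
  by (simp add: glue_def fun_eq_iff)

lemma glue_in_seqs: "z \<in> seqs n \<Longrightarrow> x \<in> seqs n \<Longrightarrow> glue z x \<in> seqs n"
  by (simp add: in_seqs_iff glue_def)

lemma future_in_seqs: "x \<in> seqs n \<Longrightarrow> future x \<in> seqs n"
  by (simp add: in_seqs_iff)

lemma const_in_seqs [simp]: "(\<lambda>_. c) \<in> seqs n \<longleftrightarrow> c < n"
  by (simp add: in_seqs_iff)

lemma glue_cong: "(\<And>i. i < 0 \<Longrightarrow> z i = z' i) \<Longrightarrow> glue z x = glue z' x"
  by (simp add: glue_def fun_eq_iff)

text \<open>The word \<open>w\<close> ends up at positions \<open>- length w\<close> to
  \<open>- 1\<close>, with the old past to its left; the zeros fill the half that
  \<open>glue\<close> ignores.\<close>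

definition append_past :: "(int \<Rightarrow> nat) \<Rightarrow> nat list \<Rightarrow> (int \<Rightarrow> nat)" where
  "append_past z w = translate (length w) (glue z (w \<frown> (\<lambda>_. 0)))"

lemma append_past_nth:
  assumes "i < 0"
  shows "append_past z w i = (if i + length w < 0 then z (i + length w) else w ! nat (i + length w))"
  using assms by (auto simp: append_past_def glue_def conc_def)

lemma glue_append_past: "glue (append_past z w) x = translate (length w) (glue z (w \<frown> x))"
  by (auto simp: append_past_def glue_def conc_def fun_eq_iff nat_add_distrib)

lemma append_past_append: "append_past z (u @ v) = append_past (append_past z u) v"
  by (simp add: append_past_def[of "append_past z u"] glue_append_past)
    (simp add: append_past_def add.commute)

lemma append_past_in_seqs:
  "z \<in> seqs n \<Longrightarrow> w \<in> lists {..<n} \<Longrightarrow> n \<ge> 1 \<Longrightarrow> append_past z w \<in> seqs n"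
  by (auto simp: append_past_def intro!: glue_in_seqs conc_in_seqs_iff[THEN iffD2])

definition past_word :: "nat \<Rightarrow> (int \<Rightarrow> nat) \<Rightarrow> nat list" where
  "past_word k z = map (\<lambda>i. z (int i - int k)) [0..<k]"

lemma length_past_word [simp]: "length (past_word k z) = k"
  by (simp add: past_word_def)

lemma past_word_in_lists: "z \<in> seqs n \<Longrightarrow> past_word k z \<in> lists {..<n}"
  by (auto simp: past_word_def in_seqs_iff)

lemma append_past_word:
  "- int k \<le> i \<Longrightarrow> i < 0 \<Longrightarrow> append_past z' (past_word k z) i = z i"
  using nth_upt[of 0 "nat (i + int k)" k] by (simp add: append_past_nth past_word_def)

lemma past_word_append_past:
  "length w = k \<Longrightarrow> past_word k (append_past z w) = w"
  by (rule nth_equalityI) (auto simp: past_word_def append_past_nth)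

section \<open>Delays and tail maps\<close>

text \<open>Where the image first feels the future. Tail maps are taken relative to this number and
  forget it, which is why translations disappear in the class of a code.\<close>

definition delay :: "nat \<Rightarrow> ((int \<Rightarrow> nat) \<Rightarrow> (int \<Rightarrow> nat)) \<Rightarrow> (int \<Rightarrow> nat) \<Rightarrow> int" where
  "delay n f z = (THE d. (\<forall>j<d. \<forall>x\<in>seqs n. \<forall>y\<in>seqs n. f (glue z x) j = f (glue z y) j) \<and>
     (\<exists>x\<in>seqs n. \<exists>y\<in>seqs n. f (glue z x) d \<noteq> f (glue z y) d))"

definition tail_map :: "nat \<Rightarrow> ((int \<Rightarrow> nat) \<Rightarrow> (int \<Rightarrow> nat)) \<Rightarrow> (int \<Rightarrow> nat)
    \<Rightarrow> (nat \<Rightarrow> nat) \<Rightarrow> (nat \<Rightarrow> nat)" where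
  "tail_map n f z = (\<lambda>x\<in>seqs n. \<lambda>i. f (glue z x) (delay n f z + int i))"

definition tail_maps :: "nat \<Rightarrow> ((int \<Rightarrow> nat) \<Rightarrow> (int \<Rightarrow> nat)) \<Rightarrow> ((nat \<Rightarrow> nat) \<Rightarrow> (nat \<Rightarrow> nat)) set"
  where "tail_maps n f = tail_map n f ` seqs n"

text \<open>The letters of the image that become decided when \<open>w\<close> is appended to the
  past \<open>z\<close>, from the old delay up to the new one seen from the old origin. The zeros
  stand for an arbitrary further future.\<close>

definition past_out :: "nat \<Rightarrow> ((int \<Rightarrow> nat) \<Rightarrow> (int \<Rightarrow> nat)) \<Rightarrow> (int \<Rightarrow> nat) \<Rightarrow> nat list \<Rightarrow> nat list"
  where "past_out n f z w = map (\<lambda>i. f (glue z (w \<frown> (\<lambda>_. 0))) (delay n f z + int i))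
     [0..<nat (length w + delay n f (append_past z w) - delay n f z)]"

lemma delay_eqI:
  assumes "\<And>j x y. j < d \<Longrightarrow> x \<in> seqs n \<Longrightarrow> y \<in> seqs n \<Longrightarrow> f (glue z x) j = f (glue z y) j"
    and "x \<in> seqs n" "y \<in> seqs n" "f (glue z x) d \<noteq> f (glue z y) d"
  shows "delay n f z = d"
  unfolding delay_def
proof (rule the_equality)
  show "(\<forall>j<d. \<forall>x\<in>seqs n. \<forall>y\<in>seqs n. f (glue z x) j = f (glue z y) j) \<and>
     (\<exists>x\<in>seqs n. \<exists>y\<in>seqs n. f (glue z x) d \<noteq> f (glue z y) d)"
    using assms by blast
next
  fix d'
  assume "(\<forall>j<d'. \<forall>x\<in>seqs n. \<forall>y\<in>seqs n. f (glue z x) j = f (glue z y) j) \<and>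
     (\<exists>x\<in>seqs n. \<exists>y\<in>seqs n. f (glue z x) d' \<noteq> f (glue z y) d')"
  then show "d' = d"
    using assms by (metis linorder_neqE)
qed

locale sliding =
  fixes n :: nat and m :: int and f :: "(int \<Rightarrow> nat) \<Rightarrow> (int \<Rightarrow> nat)"
  assumes n: "n \<ge> 2" and m: "m \<ge> 0"
    and closed: "x \<in> seqs n \<Longrightarrow> f x \<in> seqs n"
    and equivariant: "x \<in> seqs n \<Longrightarrow> f (translate k x) = translate k (f x)"
    and window: "x \<in> seqs n \<Longrightarrow> y \<in> seqs n \<Longrightarrow> (\<And>i. \<bar>i\<bar> \<le> m \<Longrightarrow> x i = y i) \<Longrightarrow> f x 0 = f y 0"

lemma (in sliding) window_at:
  assumes "x \<in> seqs n" "y \<in> seqs n" "\<And>i. \<bar>i - j\<bar> \<le> m \<Longrightarrow> x i = y i"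
  shows "f x j = f y j"
proof -
  have "f (translate j x) 0 = f (translate j y) 0"
    using assms by (intro window) auto
  then show ?thesis
    using assms by (simp add: equivariant)
qed

text \<open>Two futures of one past then have different images, which makes \<open>delay\<close>
  exist and tail maps injective.\<close>

locale right_injective = sliding +
  assumes right_inj: "x \<in> seqs n \<Longrightarrow> y \<in> seqs n \<Longrightarrow> (\<And>i. i < 0 \<Longrightarrow> x i = y i) \<Longrightarrow> f x = f y \<Longrightarrow> x = y"
begin

abbreviation (input) D where "D \<equiv> delay n f"
abbreviation (input) M where "M \<equiv> tail_map n f"

text \<open>Some position feels the future because two constant futures have different images, and
  none does left of \<open>- m\<close>, where the window ends before \<open>0\<close>. So there is a
  least such position, found by a search over naturals offset by \<open>m\<close>.\<close>

lemma
  assumes z: "z \<in> seqs n"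
  shows delay_const: "\<And>j x y. j < D z \<Longrightarrow> x \<in> seqs n \<Longrightarrow> y \<in> seqs n \<Longrightarrow> f (glue z x) j = f (glue z y) j"
    and delay_branching: "\<exists>x\<in>seqs n. \<exists>y\<in>seqs n. f (glue z x) (D z) \<noteq> f (glue z y) (D z)"
    and delay_ge: "- m \<le> D z"
proof -
  let ?P = "\<lambda>j. \<exists>x\<in>seqs n. \<exists>y\<in>seqs n. f (glue z x) j \<noteq> f (glue z y) j"
  have low: "- m \<le> j" if P: "?P j" for j
  proof (rule ccontr)
    assume "\<not> - m \<le> j"
    then have "f (glue z x) j = f (glue z y) j" if "x \<in> seqs n" "y \<in> seqs n" for x y
      using that z by (intro window_at glue_in_seqs) auto
    then show False
      using P by blast
  qed
  have "(\<lambda>_. 0) \<in> seqs n" "(\<lambda>_. 1) \<in> seqs n"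
    using n by auto
  moreover have "glue z (\<lambda>_. 0) \<noteq> glue z (\<lambda>_. 1)"
    by (metis future_glue zero_neq_one)
  ultimately have "f (glue z (\<lambda>_. 0)) \<noteq> f (glue z (\<lambda>_. 1))"
    using right_inj[of "glue z (\<lambda>_. 0)" "glue z (\<lambda>_. 1)"] z glue_in_seqs by (metis glue_neg)
  then obtain j where j: "?P j"
    using \<open>(\<lambda>_. 0) \<in> seqs n\<close> \<open>(\<lambda>_. 1) \<in> seqs n\<close> by blast
  then have "?P (int (nat (j + m)) - m)"
    using low[OF j] by simp
  then have ex: "\<exists>k::nat. ?P (int k - m)"
    by blast
  define k where "k = (LEAST k::nat. ?P (int k - m))"
  have k: "?P (int k - m)"
    unfolding k_def by (rule LeastI_ex[OF ex])
  have least: "f (glue z x) j = f (glue z y) j"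
    if "j < int k - m" "x \<in> seqs n" "y \<in> seqs n" for j x y
  proof (rule ccontr)
    assume "f (glue z x) j \<noteq> f (glue z y) j"
    then have P: "?P j"
      using that by blast
    with low[OF this] have "?P (int (nat (j + m)) - m)"
      by simp
    then have "k \<le> nat (j + m)"
      unfolding k_def by (rule Least_le)
    then show False
      using that low[OF P] by linarith
  qed
  obtain x y where xy: "x \<in> seqs n" "y \<in> seqs n" "f (glue z x) (int k - m) \<noteq> f (glue z y) (int k - m)"
    using k by blast
  have D: "D z = int k - m"
    by (rule delay_eqI) (use least xy in blast)+
  show "\<And>j x y. j < D z \<Longrightarrow> x \<in> seqs n \<Longrightarrow> y \<in> seqs n \<Longrightarrow> f (glue z x) j = f (glue z y) j"
    unfolding D by (rule least)
  show "?P (D z)"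
    unfolding D by (rule k)
  show "- m \<le> D z"
    unfolding D by simp
qed

lemma tail_map_branching: "z \<in> seqs n \<Longrightarrow> branching n (M z)"
  using delay_branching[of z] by (auto simp: branching_def tail_map_def)

lemma tail_map_in_seqs: "z \<in> seqs n \<Longrightarrow> x \<in> seqs n \<Longrightarrow> M z x \<in> seqs n"
  using closed[OF glue_in_seqs] by (auto simp: tail_map_def in_seqs_iff)

text \<open>Delay and tail map concern image positions from \<open>- m\<close> on, and these see
  \<open>m\<close> letters further left. So only \<open>2 * m\<close> letters of the past count,
  whence the finiteness of the state set.\<close>

lemma
  assumes z: "z \<in> seqs n" "z' \<in> seqs n" and eq: "\<And>i. - 2 * m \<le> i \<Longrightarrow> i < 0 \<Longrightarrow> z i = z' i"
  shows delay_cong: "D z = D z'" and tail_map_cong: "M z = M z'"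
proof -
  have *: "f (glue z x) j = f (glue z' x) j" if "- m \<le> j" "x \<in> seqs n" for x :: "nat \<Rightarrow> nat" and j
  proof (rule window_at)
    fix i assume "\<bar>i - j\<bar> \<le> m"
    then have "- 2 * m \<le> i"
      using that by linarith
    then show "glue z x i = glue z' x i"
      using eq[of i] by (simp add: glue_def)
  qed (use z that glue_in_seqs in auto)
  obtain x y where xy: "x \<in> seqs n" "y \<in> seqs n" "f (glue z' x) (D z') \<noteq> f (glue z' y) (D z')"
    using delay_branching[OF z(2)] by (elim bexE)
  show D: "D z = D z'"
  proof (rule delay_eqI)
    fix j :: int and x y :: "nat \<Rightarrow> nat"
    assume j: "j < D z'" and xy: "x \<in> seqs n" "y \<in> seqs n"
    show "f (glue z x) j = f (glue z y) j"
    proof (cases "- m \<le> j")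
      case True
      then show ?thesis
        using delay_const[OF z(2) j xy] xy by (simp add: *)
    next
      case False
      then show ?thesis
        using delay_const[OF z(1) _ xy] delay_ge[OF z(1)] by simp
    qed
  next
    show "f (glue z x) (D z') \<noteq> f (glue z y) (D z')"
      using xy delay_ge[OF z(2)] by (simp add: *)
  qed (use xy in auto)
  show "M z = M z'"
    using delay_ge[OF z(2)] * by (auto simp: tail_map_def D restrict_def fun_eq_iff)
qed

lemma finite_delay_tail_map: "finite ((\<lambda>z. (D z, M z)) ` seqs n)"
proof -
  let ?k = "nat (2 * m)"
  let ?g = "\<lambda>w. (D (append_past (\<lambda>_. 0) w), M (append_past (\<lambda>_. 0) w))"
  have "(D z, M z) = ?g (past_word ?k z)" if z: "z \<in> seqs n" for z
  proof -
    have in_seqs: "append_past (\<lambda>_. 0) (past_word ?k z) \<in> seqs n"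
      using n z by (intro append_past_in_seqs past_word_in_lists) auto
    have "z i = append_past (\<lambda>_. 0) (past_word ?k z) i" if "- 2 * m \<le> i" "i < 0" for i
      using that by (simp add: append_past_word)
    then show ?thesis
      using delay_cong[OF z in_seqs] tail_map_cong[OF z in_seqs] by blast
  qed
  then have sub: "(\<lambda>z. (D z, M z)) ` seqs n \<subseteq> ?g ` {w. set w \<subseteq> {..<n} \<and> length w = ?k}"
    using past_word_in_lists by (fastforce simp: lists_eq_set)
  have "finite {w. set w \<subseteq> {..<n} \<and> length w = ?k}"
    by (rule finite_lists_length_eq) simp
  then show ?thesis
    by (intro finite_subset[OF sub] finite_imageI)
qed

lemma finite_tail_maps: "finite (tail_maps n f)"
proof -
  have "tail_maps n f = snd ` (\<lambda>z. (D z, M z)) ` seqs n"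
    by (simp add: tail_maps_def image_image)
  then show ?thesis
    using finite_delay_tail_map by simp
qed

lemma delay_bounded: obtains B where "B \<ge> 0" "\<And>z. z \<in> seqs n \<Longrightarrow> \<bar>D z\<bar> \<le> B"
proof -
  have "finite ((\<lambda>z. \<bar>D z\<bar>) ` seqs n)"
    using finite_imageI[OF finite_delay_tail_map, of "\<lambda>p. \<bar>fst p\<bar>"] by (simp add: image_image)
  then obtain B where "\<And>z. z \<in> seqs n \<Longrightarrow> \<bar>D z\<bar> \<le> B"
    by (meson bdd_above.unfold bdd_above_finite imageI)
  then show thesis
    using that[of "max B 0"] by (meson max.cobounded1 max.cobounded2 order_trans)
qed

lemma glue_conc_apply:
  assumes "z \<in> seqs n" "w \<in> lists {..<n}" "x \<in> seqs n"
  shows "f (glue z (w \<frown> x)) j = f (glue (append_past z w) x) (j - length w)"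
proof -
  have "glue z (w \<frown> x) \<in> seqs n"
    using assms by (simp add: glue_in_seqs conc_in_seqs_iff)
  then show ?thesis
    by (simp add: glue_append_past equivariant)
qed

lemma append_past_closed: "z \<in> seqs n \<Longrightarrow> w \<in> lists {..<n} \<Longrightarrow> append_past z w \<in> seqs n"
  using n by (intro append_past_in_seqs) auto

text \<open>Fixing \<open>w\<close> restricts the futures, so the first dependence, counted from the
  old origin, cannot move to the left.\<close>

lemma delay_append_past:
  assumes z: "z \<in> seqs n" and w: "w \<in> lists {..<n}"
  shows "D z \<le> length w + D (append_past z w)"
proof (rule ccontr)
  assume "\<not> ?thesis"
  then have "f (glue z (w \<frown> x)) (D (append_past z w) + length w)
      = f (glue z (w \<frown> y)) (D (append_past z w) + length w)"
    if "x \<in> seqs n" "y \<in> seqs n" for x y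
    using that w by (intro delay_const[OF z]) (auto simp: conc_in_seqs_iff)
  note same = this
  obtain x y where xy: "x \<in> seqs n" "y \<in> seqs n"
    "f (glue (append_past z w) x) (D (append_past z w)) \<noteq> f (glue (append_past z w) y) (D (append_past z w))"
    using delay_branching[OF append_past_closed[OF z w]] by (elim bexE)
  then show False
    using same[OF xy(1,2)] by (simp add: glue_conc_apply[OF z w])
qed

lemma length_past_out:
  assumes "z \<in> seqs n" "w \<in> lists {..<n}"
  shows "int (length (past_out n f z w)) = length w + D (append_past z w) - D z"
  using delay_append_past[OF assms] by (simp add: past_out_def)

lemma past_out_nth:
  assumes z: "z \<in> seqs n" and w: "w \<in> lists {..<n}" and x: "x \<in> seqs n"
    and i: "i < length (past_out n f z w)"
  shows "past_out n f z w ! i = f (glue z (w \<frown> x)) (D z + int i)"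
proof -
  have 0: "(\<lambda>_. 0) \<in> seqs n"
    using n by simp
  have "int i < length w + D (append_past z w) - D z"
    using i length_past_out[OF z w] by linarith
  then have "f (glue z (w \<frown> (\<lambda>_. 0))) (D z + int i) = f (glue z (w \<frown> x)) (D z + int i)"
    unfolding glue_conc_apply[OF z w x] glue_conc_apply[OF z w 0]
    by (intro delay_const[OF append_past_closed[OF z w] _ 0 x]) simp
  then show ?thesis
    using i by (simp add: past_out_def)
qed

lemma past_out_in_lists:
  assumes z: "z \<in> seqs n" and w: "w \<in> lists {..<n}"
  shows "past_out n f z w \<in> lists {..<n}"
proof -
  have "glue z (w \<frown> (\<lambda>_. 0)) \<in> seqs n"
    using assms n by (simp add: glue_in_seqs conc_in_seqs_iff)
  from closed[OF this] show ?thesis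
    by (auto simp: past_out_def in_seqs_iff)
qed

lemma tail_map_conc:
  assumes z: "z \<in> seqs n" and w: "w \<in> lists {..<n}" and x: "x \<in> seqs n"
  shows "M z (w \<frown> x) = past_out n f z w \<frown> M (append_past z w) x"
proof
  fix i
  have wx: "w \<frown> x \<in> seqs n"
    using w x by (simp add: conc_in_seqs_iff)
  show "M z (w \<frown> x) i = (past_out n f z w \<frown> M (append_past z w) x) i"
  proof (cases "i < length (past_out n f z w)")
    case True
    then show ?thesis
      using past_out_nth[OF z w x True] wx by (simp add: tail_map_def)
  next
    case False
    then have "D z + int i - length w = D (append_past z w) + int (i - length (past_out n f z w))"
      using length_past_out[OF z w] by linarith
    note idx = this
    have "M z (w \<frown> x) i = f (glue (append_past z w) x) (D z + int i - length w)"
      using wx by (simp add: tail_map_def glue_conc_apply[OF z w x])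
    also have "\<dots> = M (append_past z w) x (i - length (past_out n f z w))"
      unfolding idx using x by (simp add: tail_map_def)
    finally show ?thesis
      using False by simp
  qed
qed

text \<open>By uniqueness of decompositions the tail map decides the letters written and the next
  tail map. This is what allows tail maps to serve as states.\<close>

lemma
  assumes z: "z \<in> seqs n" "z' \<in> seqs n" and w: "w \<in> lists {..<n}" and eq: "M z = M z'"
  shows past_out_eq: "past_out n f z w = past_out n f z' w"
    and tail_map_append_past_eq: "M (append_past z w) = M (append_past z' w)"
proof -
  have *: "past_out n f z w \<frown> M (append_past z w) x = past_out n f z' w \<frown> M (append_past z' w) x"
    if "x \<in> seqs n" for x
    using tail_map_conc[OF z(1) w that] tail_map_conc[OF z(2) w that] eq by simp
  note ** = conc_branching_unique[OF * tail_map_branching tail_map_branching,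
      OF _ append_past_closed append_past_closed, OF _ z(1) w z(2) w]
  show "past_out n f z w = past_out n f z' w"
    by (rule **(1))
  show "M (append_past z w) = M (append_past z' w)"
    using **(2) by (simp add: tail_map_def restrict_def fun_eq_iff)
qed

lemma past_out_append:
  assumes z: "z \<in> seqs n" and u: "u \<in> lists {..<n}" and v: "v \<in> lists {..<n}"
  shows "past_out n f z (u @ v) = past_out n f z u @ past_out n f (append_past z u) v"
proof -
  have br: "branching n (M (append_past z (u @ v)))"
    using u v by (simp add: tail_map_branching append_past_closed z)
  show ?thesis
  proof (rule conc_branching_unique(1)[OF _ br br])
    fix x :: "nat \<Rightarrow> nat" assume x: "x \<in> seqs n"
    have "past_out n f z (u @ v) \<frown> M (append_past z (u @ v)) x = M z (u \<frown> (v \<frown> x))"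
      using tail_map_conc[OF z _ x, of "u @ v"] u v by simp
    also have "\<dots> = past_out n f z u \<frown> M (append_past z u) (v \<frown> x)"
      using v x by (intro tail_map_conc z u) (simp add: conc_in_seqs_iff)
    also have "M (append_past z u) (v \<frown> x)
        = past_out n f (append_past z u) v \<frown> M (append_past z (u @ v)) x"
      unfolding append_past_append by (intro tail_map_conc append_past_closed z u v x)
    finally show "past_out n f z (u @ v) \<frown> M (append_past z (u @ v)) x
        = (past_out n f z u @ past_out n f (append_past z u) v) \<frown> M (append_past z (u @ v)) x"
      by simp
  qed
qed

lemma tail_map_append_past_word:
  assumes z: "z \<in> seqs n" "z' \<in> seqs n" and k: "2 * m \<le> int k"
  shows "M (append_past z' (past_word k z)) = M z" "D (append_past z' (past_word k z)) = D z"
proof -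
  have *: "append_past z' (past_word k z) \<in> seqs n"
    by (intro append_past_closed past_word_in_lists z)
  have "append_past z' (past_word k z) i = z i" if "- 2 * m \<le> i" "i < 0" for i
    using that k by (intro append_past_word) auto
  then show "M (append_past z' (past_word k z)) = M z" "D (append_past z' (past_word k z)) = D z"
    using tail_map_cong[OF * z(1)] delay_cong[OF * z(1)] by blast+
qed

end

section \<open>The transducer of a sliding block code\<close>

text \<open>A chosen past realizing a state. States are coded as naturals because
  \<open>min_transducers\<close> consists of transducers with such states.\<close>

definition past_of :: "nat \<Rightarrow> ((int \<Rightarrow> nat) \<Rightarrow> (int \<Rightarrow> nat)) \<Rightarrow> nat \<Rightarrow> (int \<Rightarrow> nat)" where
  "past_of n f s = (SOME z. z \<in> seqs n \<and> to_nat_on (tail_maps n f) (tail_map n f z) = s)"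

definition code_transducer :: "nat \<Rightarrow> ((int \<Rightarrow> nat) \<Rightarrow> (int \<Rightarrow> nat)) \<Rightarrow> nat transducer" where
  "code_transducer n f =
     \<lparr>states = to_nat_on (tail_maps n f) ` tail_maps n f,
      trans = (\<lambda>a s. to_nat_on (tail_maps n f) (tail_map n f (append_past (past_of n f s) [a]))),
      out = (\<lambda>a s. past_out n f (past_of n f s) [a])\<rparr>"

lemma (in sliding) ge1: "n \<ge> 1"
  using n by simp

context right_injective
begin

abbreviation (input) E where "E z \<equiv> to_nat_on (tail_maps n f) (M z)"
abbreviation (input) T where "T \<equiv> code_transducer n f"

lemma code_eq_iff: "z \<in> seqs n \<Longrightarrow> z' \<in> seqs n \<Longrightarrow> E z = E z' \<longleftrightarrow> M z = M z'"
  using finite_tail_maps by (simp add: tail_maps_def countable_finite)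

lemma states_code_transducer: "states T = E ` seqs n"
  by (simp add: code_transducer_def tail_maps_def image_image)

lemma
  assumes "z \<in> seqs n"
  shows past_of_in_seqs: "past_of n f (E z) \<in> seqs n" and tail_map_past_of: "M (past_of n f (E z)) = M z"
proof -
  have *: "past_of n f (E z) \<in> seqs n \<and> E (past_of n f (E z)) = E z"
    unfolding past_of_def
    using someI[where P = "\<lambda>z'. z' \<in> seqs n \<and> E z' = E z", of z] assms by blast
  then show "past_of n f (E z) \<in> seqs n"
    by blast
  then show "M (past_of n f (E z)) = M z"
    using * assms code_eq_iff by blast
qed

lemma append_past_Nil:
  assumes "z \<in> seqs n"
  shows "M (append_past z []) = M z" "D (append_past z []) = D z"
  using tail_map_cong[OF append_past_closed[OF assms, of "[]"] assms]
    delay_cong[OF append_past_closed[OF assms, of "[]"] assms]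
  by (simp_all add: append_past_nth)

lemma code_transducer_word:
  assumes "z \<in> seqs n" "w \<in> lists {..<n}"
  shows "trans_word T w (E z) = E (append_past z w) \<and> out_word T w (E z) = past_out n f z w"
  using assms
proof (induction w arbitrary: z)
  case Nil
  then show ?case
    using append_past_Nil[OF Nil(1)] by (simp add: past_out_def)
next
  case (Cons a w)
  have a: "[a] \<in> lists {..<n}" and w: "w \<in> lists {..<n}" and z: "z \<in> seqs n"
    using Cons.prems by auto
  note z' = past_of_in_seqs[OF z] tail_map_past_of[OF z]
  have tr: "trans T a (E z) = E (append_past z [a])"
    using tail_map_append_past_eq[OF z'(1) z a z'(2)] by (simp add: code_transducer_def)
  have out: "out T a (E z) = past_out n f z [a]"
    using past_out_eq[OF z'(1) z a z'(2)] by (simp add: code_transducer_def)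
  show ?case
    using Cons.IH[OF append_past_closed[OF z a] w] past_out_append[OF z a w]
      append_past_append[of z "[a]" w] by (simp add: tr out)
qed

lemma
  assumes "z \<in> seqs n" "w \<in> lists {..<n}"
  shows trans_word_code_transducer: "trans_word T w (E z) = E (append_past z w)"
    and out_word_code_transducer: "out_word T w (E z) = past_out n f z w"
  using code_transducer_word[OF assms] by auto

text \<open>Running the loop \<open>k\<close> times multiplies the surplus of output by
  \<open>k\<close>; yet the surplus is always a difference of two delays, bounded by
  \<open>2 * B\<close>. With \<open>k\<close> above that bound it must vanish.\<close>

lemma length_past_out_loop:
  assumes z: "z \<in> seqs n" and w: "w \<in> lists {..<n}" and loop: "M (append_past z w) = M z"
  shows "length (past_out n f z w) = length w"
proof -
  let ?W = "\<lambda>k. concat (replicate k w)"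
  have W: "?W k \<in> lists {..<n}" for k
    using w by (auto split: if_splits simp: set_replicate_conv_if)
  have len: "length (past_out n f z (?W k)) = k * length (past_out n f z w)" for k
  proof (induction k)
    case 0
    show ?case
      using append_past_Nil[OF z] by (simp add: past_out_def)
  next
    case (Suc k)
    have "past_out n f (append_past z w) (?W k) = past_out n f z (?W k)"
      by (rule past_out_eq[OF append_past_closed[OF z w] z W loop])
    then show ?case
      using past_out_append[OF z w W, of k] Suc.IH by simp
  qed
  obtain B where B: "B \<ge> 0" "\<And>z. z \<in> seqs n \<Longrightarrow> \<bar>D z\<bar> \<le> B"
    using delay_bounded by blast
  define k where "k = nat (2 * B) + 1"
  define \<delta> where "\<delta> = int (length (past_out n f z w)) - int (length w)"
  have "length (?W k) = k * length w"
    by (simp add: length_concat sum_list_replicate)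
  then have "int k * \<delta> = D (append_past z (?W k)) - D z"
    using length_past_out[OF z W, of k] by (simp add: len \<delta>_def right_diff_distrib)
  also have "\<bar>\<dots>\<bar> \<le> 2 * B"
    using B(2)[OF z] B(2)[OF append_past_closed[OF z W], of k] by linarith
  also have "2 * B < int k"
    using B(1) by (simp add: k_def)
  finally have "int k * \<bar>\<delta>\<bar> < int k * 1"
    by (simp add: abs_mult)
  then have "\<delta> = 0"
    using mult_less_cancel_left_pos[of "int k" "\<bar>\<delta>\<bar>" 1] by (simp add: k_def)
  then show ?thesis
    by (simp add: \<delta>_def)
qed

lemma restrict_tail_map: "restrict (M z) (seqs n) = M z"
  by (simp add: tail_map_def)

lemma out_inf_code_transducer:
  assumes z: "z \<in> seqs n" and x: "x \<in> seqs n"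
  shows "out_inf T x (E z) = M z x"
proof (rule out_inf_eqI)
  fix k
  have "map x [0..<k] \<frown> suffix k x = x"
    using prefix_suffix[of x k] by (simp add: subsequence_def)
  then have "M z x = past_out n f z (map x [0..<k]) \<frown> M (append_past z (map x [0..<k])) (suffix k x)"
    using tail_map_conc[OF z map_upt_in_lists[OF x, of 0 k] suffix_in_seqs[OF x, of k]] by simp
  then show "\<exists>y. M z x = out_word T (map x [0..<k]) (E z) \<frown> y"
    using out_word_code_transducer[OF z map_upt_in_lists[OF x]] by auto
next
  fix i
  obtain B where B: "B \<ge> 0" "\<And>z. z \<in> seqs n \<Longrightarrow> \<bar>D z\<bar> \<le> B"
    using delay_bounded by blast
  \<comment> \<open>Output and input lengths differ by at most \<open>2 * B\<close>, so this much
    input yields more than \<open>i\<close> letters.\<close>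
  let ?w = "map x [0..<i + nat (2 * B) + 1]"
  have w: "?w \<in> lists {..<n}"
    by (rule map_upt_in_lists[OF x])
  have "int (length ?w) = int i + 2 * B + 1"
    using B(1) by simp
  then have "int (length (past_out n f z ?w)) \<ge> int i + 1"
    using length_past_out[OF z w] B(2)[OF z] B(2)[OF append_past_closed[OF z w]] by linarith
  then show "\<exists>k. i < length (out_word T (map x [0..<k]) (E z))"
    using out_word_code_transducer[OF z w] by (intro exI[of _ "i + nat (2 * B) + 1"]) simp
qed

lemma state_map_code_transducer: "z \<in> seqs n \<Longrightarrow> state_map n T (E z) = M z"
  unfolding state_map_def using out_inf_code_transducer
  by (metis (no_types, lifting) restrict_ext restrict_tail_map)

lemma state_maps_code_transducer: "state_maps n T = tail_maps n f"
proof -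
  have "state_map n T ` E ` seqs n = M ` seqs n"
    by (simp add: image_image state_map_code_transducer)
  then show ?thesis
    unfolding state_maps_def states_code_transducer tail_maps_def[of n f, symmetric] .
qed

lemma is_transducer_code_transducer: "is_transducer n T"
proof -
  have "finite (states T)"
    using finite_tail_maps by (simp add: code_transducer_def)
  moreover have "states T \<noteq> {}"
  proof -
    have "(\<lambda>_::int. 0) \<in> seqs n"
      using n by simp
    then show ?thesis
      unfolding states_code_transducer by blast
  qed
  moreover have "trans T a q \<in> states T \<and> out T a q \<in> lists {..<n}" if a: "a < n" and q: "q \<in> states T" for a q
  proof -
    obtain z where z: "z \<in> seqs n" and qz: "q = E z"
      using q by (auto simp: states_code_transducer)
    have w: "[a] \<in> lists {..<n}"
      using a by simp
    have "trans T a q = E (append_past z [a])" "out T a q = past_out n f z [a]"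
      using trans_word_code_transducer[OF z w] out_word_code_transducer[OF z w] by (simp_all add: qz)
    then show ?thesis
      using append_past_closed[OF z w] past_out_in_lists[OF z w] by (auto simp: states_code_transducer)
  qed
  moreover have "out_word T w q \<noteq> []"
    if w: "w \<in> lists {..<n}" and q: "q \<in> states T" and "w \<noteq> []" "trans_word T w q = q" for w q
  proof -
    obtain z where z: "z \<in> seqs n" and qz: "q = E z"
      using q by (auto simp: states_code_transducer)
    then have "M (append_past z w) = M z"
      using that(4) append_past_closed[OF z w] by (simp add: trans_word_code_transducer z w code_eq_iff)
    from length_past_out_loop[OF z w this] show ?thesis
      using \<open>w \<noteq> []\<close> by (auto simp: qz out_word_code_transducer[OF z w])
  qed
  ultimately show ?thesis
    by (simp add: is_transducer_def)
qed

lemma code_transducer_loop: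
  assumes "a \<in> lists {..<n}" "q \<in> states T" "trans_word T a q = q"
  shows "length (out_word T a q) = length a"
proof -
  obtain z where z: "z \<in> seqs n" and qz: "q = E z"
    using assms(2) by (auto simp: states_code_transducer)
  then have "M (append_past z a) = M z"
    using assms(3) append_past_closed[OF z assms(1)]
    by (simp add: trans_word_code_transducer z assms(1) code_eq_iff)
  then show ?thesis
    using length_past_out_loop[OF z assms(1)] by (simp add: qz out_word_code_transducer[OF z assms(1)])
qed

lemma sync_level_code_transducer: "sync_level n T (nat (2 * m))"
  unfolding sync_level_def
proof (intro ballI impI)
  fix w p q assume w: "w \<in> lists {..<n}" "length w = nat (2 * m)" and "p \<in> states T" "q \<in> states T"
  then obtain z z' where z: "z \<in> seqs n" "p = E z" and z': "z' \<in> seqs n" "q = E z'"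
    by (auto simp: states_code_transducer)
  have "M (append_past z w) = M (append_past z' w)"
    using w m by (intro tail_map_cong append_past_closed z z') (auto simp: append_past_nth)
  then show "trans_word T w p = trans_word T w q"
    using z z' w by (simp add: trans_word_code_transducer)
qed

text \<open>The last \<open>2 * m\<close> letters of a past lead from every state to the state of
  that past; strong connectedness and the core property both follow.\<close>

lemma code_transducer_reach:
  assumes "z \<in> seqs n" "z' \<in> seqs n"
  shows "trans_word T (past_word (nat (2 * m)) z) (E z') = E z"
  using tail_map_append_past_word(1)[OF assms, of "nat (2 * m)"]
  by (simp add: trans_word_code_transducer assms past_word_in_lists)

lemma core_states_code_transducer: "core_states n T = states T"
proof
  show "core_states n T \<subseteq> states T"
    by (rule core_states_subset[OF is_transducer_code_transducer])
  show "states T \<subseteq> core_states n T"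
  proof
    fix q assume "q \<in> states T"
    then obtain z where z: "z \<in> seqs n" "q = E z"
      by (auto simp: states_code_transducer)
    then have "q = trans_word T (past_word (nat (2 * m)) z) q"
      using code_transducer_reach by simp
    then show "q \<in> core_states n T"
      unfolding core_states_def
      using \<open>q \<in> states T\<close> past_word_in_lists[OF z(1)] sync_level_code_transducer
      by (metis (mono_tags, lifting) CollectI length_past_word)
  qed
qed

lemma code_transducer_in_min_transducers: "T \<in> min_transducers n"
proof -
  have "weakly_minimal n T"
    unfolding weakly_minimal_iff states_code_transducer
    by (auto simp: inj_on_def state_map_code_transducer)
  moreover have "strongly_connected n T"
    unfolding strongly_connected_def states_code_transducer
    using code_transducer_reach past_word_in_lists by blast
  moreover have "\<not> incomplete_response n T q" if q: "q \<in> states T" for q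
  proof -
    obtain z where z: "z \<in> seqs n" "q = E z"
      using q by (auto simp: states_code_transducer)
    have "outputs n T [] q = {M z x | x. x \<in> seqs n}"
      unfolding outputs_def z(2) conc_empty using out_inf_code_transducer[OF z(1)] by metis
    then show ?thesis
      using branching_iff_gcp_length[OF ge1] tail_map_branching[OF z(1)]
      by (simp add: incomplete_response_def response_extent_def)
  qed
  ultimately have "minimal n T"
    by (simp add: minimal_def)
  moreover have "strongly_synchronizing n T"
    using sync_level_code_transducer by (auto simp: strongly_synchronizing_def)
  moreover have "is_core n T"
    by (simp add: is_core_def core_def core_states_code_transducer)
  ultimately show ?thesis
    using is_transducer_code_transducer by (simp add: min_transducers_def)
qed

lemma tclass_code_transducer: "tclass n T = map_class n (tail_maps n f)"
  using tclass_eq[OF min_transducers_weakly_minimal[OF code_transducer_in_min_transducers]]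
  by (simp add: state_maps_code_transducer)

lemma code_transducer_in_map_class: "T \<in> map_class n (tail_maps n f)"
  by (simp add: map_class_def code_transducer_in_min_transducers state_maps_code_transducer)

lemma map_class_in_L_tilde: "map_class n (tail_maps n f) \<in> L_tilde n"
  unfolding L_tilde_def
  using code_transducer_in_min_transducers code_transducer_loop by (auto simp flip: tclass_code_transducer)

end

section \<open>Products of transducers and composition of codes\<close>

lemma trans_word_product:
  "trans_word (product T U) w (p, q) = (trans_word T w p, trans_word U (out_word T w p) q)"
  by (induction w arbitrary: p q) (simp_all add: product_def trans_word_append)

lemma out_word_product: "out_word (product T U) w (p, q) = out_word U (out_word T w p) q"
  by (induction w arbitrary: p q) (simp_all add: product_def out_word_append)

lemma states_product [simp]: "states (product T U) = states T \<times> states U"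
  by (simp add: product_def)

lemma is_transducer_product:
  assumes T: "is_transducer n T" and U: "is_transducer n U"
  shows "is_transducer n (product T U)"
proof -
  have "trans (product T U) a s \<in> states (product T U) \<and> out (product T U) a s \<in> lists {..<n}"
    if a: "a < n" and s: "s \<in> states (product T U)" for a s
  proof -
    obtain p q where s: "s = (p, q)" "p \<in> states T" "q \<in> states U"
      using s by auto
    have o: "out T a p \<in> lists {..<n}"
      by (rule out_in_lists[OF T s(2) a])
    show ?thesis
      using trans_in_states[OF T s(2) a] trans_word_in_states[OF U o s(3)] out_word_in_lists[OF U o s(3)]
      by (simp add: product_def s(1))
  qed
  moreover have "out_word (product T U) w s \<noteq> []"
    if w: "w \<in> lists {..<n}" and s: "s \<in> states (product T U)" and "w \<noteq> []"
      and loop: "trans_word (product T U) w s = s" for w s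
  proof -
    obtain p q where s: "s = (p, q)" "p \<in> states T" "q \<in> states U"
      using s by auto
    have "out_word T w p \<noteq> []"
      using loop \<open>w \<noteq> []\<close> s by (intro out_word_loop[OF T _ w]) (auto simp: trans_word_product)
    then show ?thesis
      using out_word_loop[OF U s(3) out_word_in_lists[OF T w s(2)]] loop
      by (simp add: s(1) trans_word_product out_word_product)
  qed
  ultimately show ?thesis
    unfolding is_transducer_def
    using finite_states[OF T] finite_states[OF U] states_nonempty[OF T] states_nonempty[OF U] by simp
qed

lemma out_inf_product:
  assumes T: "is_transducer n T" and U: "is_transducer n U"
    and p: "p \<in> states T" and q: "q \<in> states U" and x: "x \<in> seqs n"
  shows "out_inf (product T U) x (p, q) = out_inf U (out_inf T x p) q"
proof (rule out_inf_eqI)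
  fix k
  let ?w = "map x [0..<k]"
  have w: "?w \<in> lists {..<n}"
    by (rule map_upt_in_lists[OF x])
  have "?w \<frown> suffix k x = x"
    using prefix_suffix[of x k] by (simp add: subsequence_def)
  then have "out_inf T x p = out_word T ?w p \<frown> out_inf T (suffix k x) (trans_word T ?w p)"
    using out_inf_conc[OF T p w suffix_in_seqs[OF x, of k]] by simp
  moreover have "out_inf T (suffix k x) (trans_word T ?w p) \<in> seqs n"
    by (intro out_inf_in_seqs[OF T] trans_word_in_states[OF T w p] suffix_in_seqs x)
  ultimately show "\<exists>y. out_inf U (out_inf T x p) q = out_word (product T U) ?w (p, q) \<frown> y"
    using out_inf_conc[OF U q out_word_in_lists[OF T w p]] by (auto simp: out_word_product)
next
  fix i
  show "\<exists>k. i < length (out_word (product T U) (map x [0..<k]) (p, q))"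
    using p q by (intro out_word_prefix_unbounded[OF is_transducer_product[OF T U] _ x]) simp
qed

text \<open>The first \<open>k\<close> letters synchronize \<open>T\<close>. From then on both runs
  of \<open>T\<close> write the same letters, and the remaining input makes them write at least
  \<open>l\<close>, enough to synchronize \<open>U\<close>.\<close>

lemma strongly_synchronizing_product:
  assumes T: "is_transducer n T" and U: "is_transducer n U"
    and "strongly_synchronizing n T" "strongly_synchronizing n U"
  shows "strongly_synchronizing n (product T U)"
proof -
  obtain k l where k: "sync_level n T k" and l: "sync_level n U l"
    using assms(3,4) by (auto simp: strongly_synchronizing_def)
  have "sync_level n (product T U) (k + l * card (states T))"
    unfolding sync_level_def
  proof (intro ballI impI)
    fix w s s'
    assume w: "w \<in> lists {..<n}" and len: "length w = k + l * card (states T)"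
      and s: "s \<in> states (product T U)" "s' \<in> states (product T U)"
    obtain p q where pq: "s = (p, q)" "p \<in> states T" "q \<in> states U"
      using s by auto
    obtain p' q' where pq': "s' = (p', q')" "p' \<in> states T" "q' \<in> states U"
      using s by auto
    let ?u = "take k w" and ?v = "drop k w"
    have uv: "?u \<in> lists {..<n}" "?v \<in> lists {..<n}"
      using w by (auto dest: in_set_dropD in_set_takeD)
    have "length ?u = k"
      using len by simp
    then have eq: "trans_word T ?u p = trans_word T ?u p'"
      using k uv(1) pq pq' unfolding sync_level_def by blast
    have p1: "trans_word T ?u p \<in> states T"
      by (rule trans_word_in_states[OF T uv(1) pq(2)])
    let ?o = "out_word T ?v (trans_word T ?u p)"
    have o: "?o \<in> lists {..<n}"
      by (rule out_word_in_lists[OF T uv(2) p1])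
    have "l \<le> length ?o"
      using len by (intro out_word_unbounded[OF T p1 uv(2)]) simp
    then have "sync_level n U (length ?o)"
      by (rule sync_level_mono[OF l _ U])
    moreover have "trans_word U (out_word T ?u p) q \<in> states U" "trans_word U (out_word T ?u p') q' \<in> states U"
      by (intro trans_word_in_states[OF U] out_word_in_lists[OF T] uv pq pq')+
    ultimately have "trans_word U ?o (trans_word U (out_word T ?u p) q)
        = trans_word U ?o (trans_word U (out_word T ?u p') q')"
      using o unfolding sync_level_def by blast
    moreover have "out_word T w p = out_word T ?u p @ ?o" "out_word T w p' = out_word T ?u p' @ ?o"
      by (metis append_take_drop_id out_word_append) (metis append_take_drop_id out_word_append eq)
    moreover have "trans_word T w p = trans_word T w p'"
      by (metis append_take_drop_id trans_word_append eq)
    ultimately show "trans_word (product T U) w s = trans_word (product T U) w s'"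
      by (simp add: pq(1) pq'(1) trans_word_product trans_word_append)
  qed
  then show ?thesis
    by (auto simp: strongly_synchronizing_def)
qed

lemma state_map_in_tail_maps:
  "state_maps n T = tail_maps n f \<Longrightarrow> p \<in> states T \<Longrightarrow> \<exists>z\<in>seqs n. state_map n T p = tail_map n f z"
  unfolding state_maps_def tail_maps_def by (metis imageE imageI)

context right_injective
begin

text \<open>The product in \<open>M_monoid\<close> ranges over all members of a class, so the
  bookkeeping done for \<open>code_transducer\<close> is needed for every \<open>S\<close> with the
  same maps. It carries over since maps determine outputs and successors.\<close>

lemma
  assumes S: "is_transducer n S" and maps: "state_maps n S = tail_maps n f"
    and p: "p \<in> states S" and z: "z \<in> seqs n" and eq: "state_map n S p = M z"
    and w: "w \<in> lists {..<n}"
  shows state_map_trans_word: "state_map n S (trans_word S w p) = M (append_past z w)"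
    and out_word_eq_past_out: "out_word S w p = past_out n f z w"
proof -
  let ?p = "trans_word S w p"
  have p': "?p \<in> states S"
    by (rule trans_word_in_states[OF S w p])
  then obtain z' where z': "z' \<in> seqs n" "state_map n S ?p = M z'"
    using state_map_in_tail_maps[OF maps] by blast
  have M: "out_inf S x ?p = M z' x" if "x \<in> seqs n" for x
    using fun_cong[OF z'(2), of x] that by (simp add: state_map_def)
  have *: "out_word S w p \<frown> M z' x = past_out n f z w \<frown> M (append_past z w) x" if x: "x \<in> seqs n" for x
  proof -
    have wx: "w \<frown> x \<in> seqs n"
      using w x by (simp add: conc_in_seqs_iff)
    have "out_word S w p \<frown> M z' x = out_inf S (w \<frown> x) p"
      using out_inf_conc[OF S p w x] M[OF x] by simp
    also have "\<dots> = M z (w \<frown> x)"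
      using fun_cong[OF eq, of "w \<frown> x"] wx by (simp add: state_map_def)
    also have "\<dots> = past_out n f z w \<frown> M (append_past z w) x"
      by (rule tail_map_conc[OF z w x])
    finally show ?thesis .
  qed
  note ** = conc_branching_unique[OF * tail_map_branching[OF z'(1)]
      tail_map_branching[OF append_past_closed[OF z w]]]
  show "out_word S w p = past_out n f z w"
    by (rule **(1))
  show "state_map n S ?p = M (append_past z w)"
    unfolding z'(2) by (metis (no_types, lifting) **(2) restrict_ext restrict_tail_map)
qed

lemma right_inj_at:
  assumes x: "x \<in> seqs n" and y: "y \<in> seqs n" and eq: "\<And>i. i < k \<Longrightarrow> x i = y i" and f: "f x = f y"
  shows "x = y"
proof -
  have "translate k x = translate k y"
    by (rule right_inj) (simp_all add: equivariant x y eq f)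
  then have "translate (- k) (translate k x) = translate (- k) (translate k y)"
    by simp
  then show ?thesis
    by simp
qed

end

section \<open>Composition of codes\<close>

locale composable_codes = f: right_injective n m f + g: right_injective n m' g
  for n m f m' g

text \<open>Radii add. For right injectivity: points that agree left of \<open>0\<close> have images
  under \<open>f\<close> that agree left of \<open>- m\<close>, so first \<open>g\<close> can be
  cancelled and then \<open>f\<close>.\<close>

sublocale composable_codes \<subseteq> gf: right_injective n "m + m'" "g \<circ> f"
proof
  show "n \<ge> 2" "m + m' \<ge> 0"
    using f.n f.m g.m by auto
next
  fix x :: "int \<Rightarrow> nat" assume "x \<in> seqs n"
  then show "(g \<circ> f) x \<in> seqs n"
    by (simp add: f.closed g.closed)
next
  fix x :: "int \<Rightarrow> nat" and k assume "x \<in> seqs n"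
  then show "(g \<circ> f) (translate k x) = translate k ((g \<circ> f) x)"
    by (simp add: f.closed f.equivariant g.equivariant)
next
  fix x y :: "int \<Rightarrow> nat" assume xy: "x \<in> seqs n" "y \<in> seqs n" and eq: "\<And>i. \<bar>i\<bar> \<le> m + m' \<Longrightarrow> x i = y i"
  show "(g \<circ> f) x 0 = (g \<circ> f) y 0"
    unfolding comp_apply
  proof (rule g.window)
    fix i assume i: "\<bar>i\<bar> \<le> m'"
    show "f x i = f y i"
      using i xy eq by (intro f.window_at) auto
  qed (use xy f.closed in auto)
next
  fix x y :: "int \<Rightarrow> nat" assume xy: "x \<in> seqs n" "y \<in> seqs n" and eq: "\<And>i. i < 0 \<Longrightarrow> x i = y i"
    and gf: "(g \<circ> f) x = (g \<circ> f) y"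
  have "f x = f y"
  proof (rule g.right_inj_at[where k = "- m"])
    fix i assume "i < - m"
    then show "f x i = f y i"
      using xy eq by (intro f.window_at) auto
  qed (use xy gf f.closed in auto)
  show "x = y"
    by (rule f.right_inj) (rule xy eq \<open>f x = f y\<close> | assumption)+
qed

context composable_codes
begin

text \<open>Up to its delay the image under \<open>f\<close> does not depend on the future, so it
  serves as a past for \<open>g\<close>; the zero future is an arbitrary choice.\<close>

definition image_past :: "(int \<Rightarrow> nat) \<Rightarrow> (int \<Rightarrow> nat)" where
  "image_past z = translate (delay n f z) (f (glue z (\<lambda>_. 0)))"

text \<open>The delays of \<open>f\<close> and \<open>g\<close> only add up to a lower bound for the
  delay of \<open>g \<circ> f\<close>, because the future offered to \<open>g\<close> is confined to
  the range of a tail map of \<open>f\<close>. The letters in between are the incomplete response of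
  the product, removed by the reduction.\<close>

definition common_prefix :: "(int \<Rightarrow> nat) \<Rightarrow> nat list" where
  "common_prefix z = map (\<lambda>i. (g \<circ> f) (glue z (\<lambda>_. 0)) (delay n f z + delay n g (image_past z) + int i))
     [0..<nat (delay n (g \<circ> f) z - (delay n f z + delay n g (image_past z)))]"

lemma zero_in_seqs: "(\<lambda>_. 0) \<in> seqs n"
  using f.n by simp

lemma image_past_in_seqs: "z \<in> seqs n \<Longrightarrow> image_past z \<in> seqs n"
  by (auto simp: image_past_def intro!: f.closed glue_in_seqs zero_in_seqs simp del: const_in_seqs)

lemma glue_image_past:
  assumes z: "z \<in> seqs n" and x: "x \<in> seqs n"
  shows "translate (delay n f z) (f (glue z x)) = glue (image_past z) (tail_map n f z x)"
proof
  fix i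
  show "translate (delay n f z) (f (glue z x)) i = glue (image_past z) (tail_map n f z x) i"
  proof (cases "i < 0")
    case True
    then have "f (glue z x) (i + delay n f z) = f (glue z (\<lambda>_. 0)) (i + delay n f z)"
      by (intro f.delay_const[OF z _ x zero_in_seqs]) simp
    then show ?thesis
      using True by (simp add: image_past_def)
  qed (use x in \<open>simp add: tail_map_def add.commute\<close>)
qed

lemma comp_apply_glue:
  assumes z: "z \<in> seqs n" and x: "x \<in> seqs n"
  shows "(g \<circ> f) (glue z x) j = g (glue (image_past z) (tail_map n f z x)) (j - delay n f z)"
proof -
  have "f (glue z x) \<in> seqs n"
    by (intro f.closed glue_in_seqs z x)
  then show ?thesis
    by (simp add: g.equivariant flip: glue_image_past[OF z x])
qed

lemma delay_comp_ge:
  assumes z: "z \<in> seqs n"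
  shows "delay n f z + delay n g (image_past z) \<le> delay n (g \<circ> f) z"
proof (rule ccontr)
  assume "\<not> ?thesis"
  then have "(g \<circ> f) (glue z x) (delay n (g \<circ> f) z) = (g \<circ> f) (glue z y) (delay n (g \<circ> f) z)"
    if "x \<in> seqs n" "y \<in> seqs n" for x y
    unfolding comp_apply_glue[OF z that(1)] comp_apply_glue[OF z that(2)] using that
    by (intro g.delay_const image_past_in_seqs f.tail_map_in_seqs z) auto
  then show False
    using gf.delay_branching[OF z] by blast
qed

lemma tail_map_comp:
  assumes z: "z \<in> seqs n" and x: "x \<in> seqs n"
  shows "tail_map n g (image_past z) (tail_map n f z x) = common_prefix z \<frown> tail_map n (g \<circ> f) z x"
proof
  fix i
  let ?d = "delay n f z + delay n g (image_past z)"
  have lhs: "tail_map n g (image_past z) (tail_map n f z x) i = (g \<circ> f) (glue z x) (?d + int i)"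
    unfolding comp_apply_glue[OF z x] using f.tail_map_in_seqs[OF z x]
    by (simp add: tail_map_def[of n g])
  have len: "int (length (common_prefix z)) = delay n (g \<circ> f) z - ?d"
    using delay_comp_ge[OF z] by (simp add: common_prefix_def)
  show "tail_map n g (image_past z) (tail_map n f z x) i = (common_prefix z \<frown> tail_map n (g \<circ> f) z x) i"
  proof (cases "i < length (common_prefix z)")
    case True
    then have "?d + int i < delay n (g \<circ> f) z"
      using len by linarith
    then have "(g \<circ> f) (glue z x) (?d + int i) = (g \<circ> f) (glue z (\<lambda>_. 0)) (?d + int i)"
      by (rule gf.delay_const[OF z _ x zero_in_seqs])
    then show ?thesis
      using True unfolding lhs by (simp add: common_prefix_def)
  next
    case False
    then have idx: "?d + int i = delay n (g \<circ> f) z + int (i - length (common_prefix z))"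
      using len by linarith
    show ?thesis
      unfolding lhs idx using False x by (simp add: tail_map_def[of n "g \<circ> f"])
  qed
qed

text \<open>The newest letters of the image past are those just written, so the input of the second
  transducer is the end of its past.\<close>

lemma image_past_append_past:
  assumes z: "z \<in> seqs n" and w: "w \<in> lists {..<n}"
    and i: "i < 0" "0 \<le> i + int (length (past_out n f z w))"
  shows "image_past (append_past z w) i = past_out n f z w ! nat (i + int (length (past_out n f z w)))"
proof -
  have "past_out n f z w ! nat (i + int (length (past_out n f z w)))
      = f (glue z (w \<frown> (\<lambda>_. 0))) (delay n f z + (i + int (length (past_out n f z w))))"
    using i by (subst f.past_out_nth[OF z w zero_in_seqs]) simp_all
  also have "\<dots> = f (glue (append_past z w) (\<lambda>_. 0)) (i + delay n f (append_past z w))"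
    using f.length_past_out[OF z w]
    by (simp add: f.glue_conc_apply[OF z w zero_in_seqs] add.commute)
  finally show ?thesis
    by (simp add: image_past_def)
qed

context
  fixes T :: "'p transducer" and U :: "'q transducer"
  assumes T: "is_transducer n T" and U: "is_transducer n U"
    and sync: "strongly_synchronizing n T" "strongly_synchronizing n U"
    and maps: "state_maps n T = tail_maps n f" "state_maps n U = tail_maps n g"
begin

text \<open>Once \<open>f\<close> has written \<open>2 * m'\<close> letters, the second component
  depends on these alone, whatever its starting state.\<close>

lemma product_states_forced:
  obtains N where "\<And>w p q z. w \<in> lists {..<n} \<Longrightarrow> N \<le> length w \<Longrightarrow> p \<in> states T \<Longrightarrow> q \<in> states U
    \<Longrightarrow> z \<in> seqs n \<Longrightarrow> state_map n T p = tail_map n f z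
    \<Longrightarrow> state_map n T (trans_word T w p) = tail_map n f (append_past z w)
      \<and> state_map n U (trans_word U (out_word T w p) q) = tail_map n g (image_past (append_past z w))"
proof -
  obtain B where B: "B \<ge> 0" "\<And>z. z \<in> seqs n \<Longrightarrow> \<bar>delay n f z\<bar> \<le> B"
    using f.delay_bounded by blast
  \<comment> \<open>\<open>2 * B\<close> makes up for the change of delay, by which the output may
    be shorter than the input.\<close>
  define N where "N = nat (2 * B + 2 * m')"
  show thesis
  proof (rule that[of N])
    fix w p q z
    assume w: "w \<in> lists {..<n}" and len: "N \<le> length w" and p: "p \<in> states T" and q: "q \<in> states U"
      and z: "z \<in> seqs n" and eq: "state_map n T p = tail_map n f z"
    note zw = f.append_past_closed[OF z w]
    let ?u = "past_out n f z w"
    have u: "?u \<in> lists {..<n}"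
      by (rule f.past_out_in_lists[OF z w])
    have "int N \<le> length w"
      using len by simp
    then have long: "2 * m' \<le> length ?u"
      using f.length_past_out[OF z w] B(1) B(2)[OF z] B(2)[OF zw] g.m by (simp add: N_def)
    obtain y where y: "y \<in> seqs n" "state_map n U q = tail_map n g y"
      using state_map_in_tail_maps[OF maps(2) q] by blast
    have "state_map n U (trans_word U ?u q) = tail_map n g (append_past y ?u)"
      by (rule g.state_map_trans_word[OF U maps(2) q y u])
    also have "\<dots> = tail_map n g (image_past (append_past z w))"
    proof (rule g.tail_map_cong)
      fix i assume "- 2 * m' \<le> i" "i < 0"
      then show "append_past y ?u i = image_past (append_past z w) i"
        using long by (simp add: append_past_nth image_past_append_past[OF z w])
    qed (intro g.append_past_closed image_past_in_seqs y u zw)+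
    finally show "state_map n T (trans_word T w p) = tail_map n f (append_past z w)
      \<and> state_map n U (trans_word U (out_word T w p) q) = tail_map n g (image_past (append_past z w))"
      using f.state_map_trans_word[OF T maps(1) p z eq w] f.out_word_eq_past_out[OF T maps(1) p z eq w]
      by simp
  qed
qed

lemma core_product_state:
  assumes "s \<in> core_states n (product T U)"
  shows "\<exists>z\<in>seqs n. state_map n T (fst s) = tail_map n f z \<and> state_map n U (snd s) = tail_map n g (image_past z)"
proof -
  obtain N where N: "\<And>w p q z. w \<in> lists {..<n} \<Longrightarrow> N \<le> length w \<Longrightarrow> p \<in> states T \<Longrightarrow> q \<in> states U
    \<Longrightarrow> z \<in> seqs n \<Longrightarrow> state_map n T p = tail_map n f z
    \<Longrightarrow> state_map n T (trans_word T w p) = tail_map n f (append_past z w)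
      \<and> state_map n U (trans_word U (out_word T w p) q) = tail_map n g (image_past (append_past z w))"
    using product_states_forced by blast
  obtain w r where w: "w \<in> lists {..<n}" "N \<le> length w" and r: "r \<in> states (product T U)"
    and s: "s = trans_word (product T U) w r"
    by (rule core_states_long_word[OF is_transducer_product[OF T U] assms f.ge1, of N]) blast
  obtain p q where pq: "r = (p, q)" "p \<in> states T" "q \<in> states U"
    using r by auto
  then obtain z where z: "z \<in> seqs n" "state_map n T p = tail_map n f z"
    using state_map_in_tail_maps[OF maps(1)] by blast
  show ?thesis
    using N[OF w pq(2,3) z] f.append_past_closed[OF z(1) w(1)] by (auto simp: s pq(1) trans_word_product)
qed

text \<open>Read the last letters of \<open>z\<close> from any state. The past \<open>z'\<close>
  reached in this way shares only recent letters with \<open>z\<close>, so it is compared with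
  \<open>z\<close> through the tail map of \<open>g \<circ> f\<close>.\<close>

lemma core_product_surj:
  assumes z: "z \<in> seqs n"
  shows "\<exists>s\<in>core_states n (product T U). \<exists>z'\<in>seqs n. state_map n T (fst s) = tail_map n f z'
    \<and> state_map n U (snd s) = tail_map n g (image_past z') \<and> tail_map n (g \<circ> f) z' = tail_map n (g \<circ> f) z"
proof -
  obtain N where N: "\<And>w p q z. w \<in> lists {..<n} \<Longrightarrow> N \<le> length w \<Longrightarrow> p \<in> states T \<Longrightarrow> q \<in> states U
    \<Longrightarrow> z \<in> seqs n \<Longrightarrow> state_map n T p = tail_map n f z
    \<Longrightarrow> state_map n T (trans_word T w p) = tail_map n f (append_past z w)
      \<and> state_map n U (trans_word U (out_word T w p) q) = tail_map n g (image_past (append_past z w))"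
    using product_states_forced by blast
  note PT = is_transducer_product[OF T U]
  obtain k where k: "sync_level n (product T U) k"
    using strongly_synchronizing_product[OF T U sync] by (auto simp: strongly_synchronizing_def)
  \<comment> \<open>Three purposes are served: forcing the components (\<open>N\<close>), landing in
    the core (\<open>k\<close>), and recovering the tail map of \<open>g \<circ> f\<close>, whose
    radius is \<open>m + m'\<close>.\<close>
  define l where "l = N + k + nat (2 * (m + m'))"
  have w: "past_word l z \<in> lists {..<n}"
    by (rule past_word_in_lists[OF z])
  obtain p q where pq: "p \<in> states T" "q \<in> states U"
    using states_nonempty[OF T] states_nonempty[OF U] by blast
  then obtain y where y: "y \<in> seqs n" "state_map n T p = tail_map n f y"
    using state_map_in_tail_maps[OF maps(1)] by blast
  let ?z = "append_past y (past_word l z)"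
  let ?s = "trans_word (product T U) (past_word l z) (p, q)"
  have "sync_level n (product T U) (length (past_word l z))"
    by (rule sync_level_mono[OF k _ PT]) (simp add: l_def)
  then have "?s \<in> core_states n (product T U)"
    unfolding core_states_def using w pq by (intro CollectI exI[of _ "past_word l z"] exI[of _ "(p, q)"]) simp
  moreover have "?z \<in> seqs n"
    by (rule f.append_past_closed[OF y(1) w])
  moreover have "tail_map n (g \<circ> f) ?z = tail_map n (g \<circ> f) z"
    by (rule gf.tail_map_append_past_word(1)[OF z y(1)]) (simp add: l_def)
  moreover have "state_map n T (fst ?s) = tail_map n f ?z \<and> state_map n U (snd ?s) = tail_map n g (image_past ?z)"
    using N[OF w _ pq y] by (simp add: l_def trans_word_product)
  ultimately show ?thesis
    by blast
qed

lemma tclass_product: "tclass n (reduction n (core n (product T U))) = map_class n (tail_maps n (g \<circ> f))"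
proof -
  let ?C = "core n (product T U)"
  let ?P = "\<lambda>s z. z \<in> seqs n \<and> state_map n T (fst s) = tail_map n f z \<and> state_map n U (snd s) = tail_map n g (image_past z)"
  \<comment> \<open>A core state may come from several pasts. \<open>c\<close> picks one; uniqueness
    of decompositions will show that the tail map of \<open>g \<circ> f\<close> does not depend on
    the pick.\<close>
  define c where "c s = (SOME z. ?P s z)" for s
  have c: "?P s (c s)" if "s \<in> core_states n (product T U)" for s
    using someI_ex[of "?P s"] core_product_state[OF that] unfolding c_def by blast
  note PT = is_transducer_product[OF T U]
  have C: "is_transducer n ?C"
    by (rule is_transducer_core[OF PT strongly_synchronizing_product[OF T U sync] f.ge1])
  have two_steps: "out_inf ?C x s = common_prefix z \<frown> tail_map n (g \<circ> f) z x"
    if s: "s \<in> states ?C" and z: "?P s z" and x: "x \<in> seqs n" for s x z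
  proof -
    have "s \<in> states (product T U)"
      using s core_states_subset[OF PT] unfolding states_core by blast
    then obtain p q where pq: "s = (p, q)" "p \<in> states T" "q \<in> states U"
      by (cases s) simp
    have zs: "z \<in> seqs n" and Tp: "state_map n T p = tail_map n f z"
      and Uq: "state_map n U q = tail_map n g (image_past z)"
      using z by (simp_all add: pq(1))
    have T_out: "out_inf T x p = tail_map n f z x"
      using fun_cong[OF Tp, of x] x by (simp add: state_map_def)
    have U_out: "out_inf U (tail_map n f z x) q = tail_map n g (image_past z) (tail_map n f z x)"
      using fun_cong[OF Uq, of "tail_map n f z x"] f.tail_map_in_seqs[OF zs x] by (simp add: state_map_def)
    show ?thesis
      unfolding pq(1) out_inf_core out_inf_product[OF T U pq(2,3) x] T_out U_out
      by (rule tail_map_comp[OF zs x])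
  qed
  have out: "out_inf ?C x s = common_prefix (c s) \<frown> tail_map n (g \<circ> f) (c s) x"
    if "s \<in> states ?C" "x \<in> seqs n" for s x
    using two_steps[OF that(1) _ that(2)] c that(1) by simp
  have br: "branching n (tail_map n (g \<circ> f) (c s))" if "s \<in> states ?C" for s
    using c that by (intro gf.tail_map_branching) simp
  have "(\<lambda>s. tail_map n (g \<circ> f) (c s)) ` states ?C = tail_maps n (g \<circ> f)"
  proof
    show "(\<lambda>s. tail_map n (g \<circ> f) (c s)) ` states ?C \<subseteq> tail_maps n (g \<circ> f)"
      using c by (auto simp: tail_maps_def)
    show "tail_maps n (g \<circ> f) \<subseteq> (\<lambda>s. tail_map n (g \<circ> f) (c s)) ` states ?C"
    proof
      fix h assume "h \<in> tail_maps n (g \<circ> f)"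
      then obtain z where z: "z \<in> seqs n" "h = tail_map n (g \<circ> f) z"
        by (auto simp: tail_maps_def)
      obtain s z' where s: "s \<in> core_states n (product T U)" and z': "?P s z'"
        and h: "tail_map n (g \<circ> f) z' = h"
        using core_product_surj[OF z(1)] z(2) by blast
      have "tail_map n (g \<circ> f) (c s) x = tail_map n (g \<circ> f) z' x" if "x \<in> seqs n" for x
      proof (rule conc_branching_unique(2)[OF _ _ _ that])
        show "common_prefix (c s) \<frown> tail_map n (g \<circ> f) (c s) y = common_prefix z' \<frown> tail_map n (g \<circ> f) z' y"
          if "y \<in> seqs n" for y
          using out[of s y] two_steps[of s z' y] s z' that by simp
      qed (use z' c[OF s] in \<open>blast intro: gf.tail_map_branching\<close>)+
      then have "tail_map n (g \<circ> f) (c s) = tail_map n (g \<circ> f) z'"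
        by (metis gf.restrict_tail_map restrict_ext)
      then show "h \<in> (\<lambda>s. tail_map n (g \<circ> f) (c s)) ` states ?C"
        using s h by auto
    qed
  qed
  moreover have "state_maps n (reduction n ?C) = (\<lambda>s. restrict (tail_map n (g \<circ> f) (c s)) (seqs n)) ` states ?C"
    by (rule state_maps_reduction[OF C out br])
  ultimately show ?thesis
    using tclass_eq[OF weakly_minimal_reduction[OF C out br]] by (simp add: gf.restrict_tail_map)
qed

end

text \<open>The product of two classes is a union over pairs of representatives. All pairs yield the
  same class, and the code transducers provide one pair.\<close>

lemma mult_map_class:
  "map_class n (tail_maps n f) \<otimes>\<^bsub>M_monoid n\<^esub> map_class n (tail_maps n g) = map_class n (tail_maps n (g \<circ> f))"
proof -
  have "tclass n (reduction n (core n (product T U))) = map_class n (tail_maps n (g \<circ> f))"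
    if "T \<in> map_class n (tail_maps n f)" "U \<in> map_class n (tail_maps n g)" for T U
    using that by (intro tclass_product) (auto simp: map_class_def min_transducers_def)
  then show ?thesis
    using f.code_transducer_in_map_class g.code_transducer_in_map_class by (auto simp: M_monoid_def)
qed

end

section \<open>The code of a transducer\<close>

definition block :: "(int \<Rightarrow> nat) \<Rightarrow> int \<Rightarrow> nat \<Rightarrow> nat list" where
  "block x i s = map (\<lambda>j. x (i + int j)) [0..<s]"

lemma length_block [simp]: "length (block x i s) = s"
  by (simp add: block_def)

lemma block_in_lists: "x \<in> seqs n \<Longrightarrow> block x i s \<in> lists {..<n}"
  by (auto simp: block_def in_seqs_iff)

lemma block_add: "block x i (s + t) = block x i s @ block x (i + int s) t"
  by (rule nth_equalityI) (auto simp: block_def nth_append)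

lemma block_translate: "block (translate k x) i s = block x (i + k) s"
  by (simp add: block_def algebra_simps)

lemma block_cong: "(\<And>j. i \<le> j \<Longrightarrow> j < i + int s \<Longrightarrow> x j = y j) \<Longrightarrow> block x i s = block y i s"
  by (simp add: block_def)

lemma past_word_eq_block: "past_word k z = block z (- int k) k"
  by (simp add: past_word_def block_def)

lemma block_conc_future: "block x i s \<frown> future (translate (i + int s) x) = future (translate i x)"
  by (auto simp: block_def conc_def fun_eq_iff algebra_simps of_nat_diff)

locale length_preserving =
  fixes n :: nat and T :: "'q transducer" and k :: nat
  assumes n: "n \<ge> 2" and T: "is_transducer n T" and sync: "sync_level n T k"
    and core: "core_states n T = states T"
    and loop: "\<And>w q. w \<in> lists {..<n} \<Longrightarrow> q \<in> states T \<Longrightarrow> trans_word T w q = q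
      \<Longrightarrow> length (out_word T w q) = length w"
    and br: "\<And>q. q \<in> states T \<Longrightarrow> branching n (state_map n T q)"
    and inj: "\<And>q. q \<in> states T \<Longrightarrow> inj_on (\<lambda>x. out_inf T x q) (seqs n)"
begin

definition q0 :: 'q where "q0 = (SOME q. q \<in> states T)"

lemma q0: "q0 \<in> states T"
  unfolding q0_def using states_nonempty[OF T] by (simp add: some_in_eq)

text \<open>A core state is forced by a word of length at least \<open>k\<close>, and the last
  \<open>k\<close> letters of that word already force it.\<close>

lemma reachable:
  assumes "q \<in> states T"
  obtains w where "w \<in> lists {..<n}" "length w = k" "\<And>p. p \<in> states T \<Longrightarrow> trans_word T w p = q"
proof -
  have "q \<in> core_states n T" "n \<ge> 1"
    using assms core n by auto
  then obtain w p where w: "w \<in> lists {..<n}" "p \<in> states T" "k \<le> length w" "q = trans_word T w p"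
    by (rule core_states_long_word[OF T, of q k]) blast
  let ?u = "take (length w - k) w" and ?v = "drop (length w - k) w"
  have uv: "?u \<in> lists {..<n}" "?v \<in> lists {..<n}" "length ?v = k"
    using w by (auto dest: in_set_dropD in_set_takeD)
  have "q = trans_word T ?v (trans_word T ?u p)"
    using w(4) by (metis append_take_drop_id trans_word_append)
  moreover have "trans_word T ?u p \<in> states T"
    by (rule trans_word_in_states[OF T uv(1) w(2)])
  ultimately have "trans_word T ?v p' = q" if "p' \<in> states T" for p'
    using sync uv that unfolding sync_level_def by metis
  then show thesis
    using that uv by blast
qed

section \<open>Surplus of output as a potential, and the placement of outputs\<close>

definition excess :: "nat list \<Rightarrow> 'q \<Rightarrow> int" where
  "excess w q = int (length (out_word T w q)) - int (length w)"

lemma excess_append: "excess (u @ v) q = excess u q + excess v (trans_word T u q)"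
  by (simp add: excess_def out_word_append)

text \<open>One word \<open>w\<close> closes both paths to loops at \<open>q\<close>. Loops have
  surplus zero, and the surplus of \<open>w\<close> from the common endpoint cancels.\<close>

lemma excess_eq:
  assumes "u \<in> lists {..<n}" "v \<in> lists {..<n}" "q \<in> states T" "trans_word T u q = trans_word T v q"
  shows "excess u q = excess v q"
proof -
  obtain w where w: "w \<in> lists {..<n}" "\<And>p. p \<in> states T \<Longrightarrow> trans_word T w p = q"
    by (rule reachable[OF assms(3)]) blast
  have 0: "excess (x @ w) q = 0" if x: "x \<in> lists {..<n}" for x
  proof -
    have "trans_word T (x @ w) q = q"
      unfolding trans_word_append by (rule w(2)[OF trans_word_in_states[OF T x assms(3)]])
    then have "length (out_word T (x @ w) q) = length (x @ w)"
      using x w(1) by (intro loop assms(3)) simp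
    then show ?thesis
      by (simp add: excess_def)
  qed
  show ?thesis
    using 0[OF assms(1)] 0[OF assms(2)] assms(4) by (simp add: excess_append)
qed

definition potential :: "'q \<Rightarrow> int" where
  "potential q = excess (SOME w. w \<in> lists {..<n} \<and> trans_word T w q0 = q) q0"

lemma potential_eq:
  assumes "w \<in> lists {..<n}" "trans_word T w q0 = q"
  shows "potential q = excess w q0"
proof -
  let ?w = "SOME w. w \<in> lists {..<n} \<and> trans_word T w q0 = q"
  have "?w \<in> lists {..<n} \<and> trans_word T ?w q0 = q"
    by (rule someI[where P = "\<lambda>w. w \<in> lists {..<n} \<and> trans_word T w q0 = q"]) (use assms in blast)
  then show ?thesis
    unfolding potential_def using assms by (intro excess_eq q0) auto
qed

lemma length_out_word:
  assumes w: "w \<in> lists {..<n}" and q: "q \<in> states T"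
  shows "int (length (out_word T w q)) = int (length w) + potential (trans_word T w q) - potential q"
proof -
  obtain u where u: "u \<in> lists {..<n}" "trans_word T u q0 = q"
    by (rule reachable[OF q]) (use q0 in blast)
  have "potential (trans_word T w q) = excess (u @ w) q0"
    using u w by (intro potential_eq) (auto simp: trans_word_append)
  also have "\<dots> = potential q + excess w q"
    using potential_eq[OF u] u(2) by (simp add: excess_append)
  finally show ?thesis
    by (simp add: excess_def)
qed

definition bound :: int where
  "bound = Max ((\<lambda>q. \<bar>potential q\<bar>) ` states T)"

lemma potential_le_bound: "q \<in> states T \<Longrightarrow> \<bar>potential q\<bar> \<le> bound"
  unfolding bound_def using finite_states[OF T] by (intro Max_ge) auto

text \<open>The state of a run that comes from far left, on arrival at \<open>i\<close>: by
  synchronization the last \<open>k\<close> letters decide it, and \<open>q0\<close> is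
  arbitrary.\<close>

definition state_at :: "(int \<Rightarrow> nat) \<Rightarrow> int \<Rightarrow> 'q" where
  "state_at x i = trans_word T (block x (i - int k) k) q0"

lemma state_at_in_states: "x \<in> seqs n \<Longrightarrow> state_at x i \<in> states T"
  unfolding state_at_def by (intro trans_word_in_states[OF T] block_in_lists q0)

lemma state_at_add:
  assumes x: "x \<in> seqs n"
  shows "state_at x (i + int s) = trans_word T (block x i s) (state_at x i)"
proof -
  have "trans_word T (block x i s) (state_at x i) = trans_word T (block x (i - int k) (k + s)) q0"
    using block_add[of x "i - int k" k s] by (simp add: state_at_def trans_word_append)
  also have "\<dots> = trans_word T (block x (i + int s - int k) k) (trans_word T (block x (i - int k) s) q0)"
    using block_add[of x "i - int k" s k] by (simp add: add.commute trans_word_append algebra_simps)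
  also have "\<dots> = state_at x (i + int s)"
    unfolding state_at_def using sync q0 trans_word_in_states[OF T block_in_lists[OF x] q0] block_in_lists[OF x]
      length_block unfolding sync_level_def by blast
  finally show ?thesis
    by simp
qed

lemma state_at_cong: "(\<And>j. i - int k \<le> j \<Longrightarrow> j < i \<Longrightarrow> x j = y j) \<Longrightarrow> state_at x i = state_at y i"
  unfolding state_at_def by (intro arg_cong2[where f = "\<lambda>w q. trans_word T w q"] block_cong) auto

lemma state_at_translate: "state_at (translate t x) i = state_at x (i + t)"
  by (simp add: state_at_def block_translate algebra_simps)

text \<open>The run entered at \<open>i\<close> has its output placed from
  \<open>i + potential (state_at x i)\<close> on. As \<open>nat\<close> truncates, the value is
  meaningful only for \<open>j\<close> from there on.\<close>

definition letter_from :: "(int \<Rightarrow> nat) \<Rightarrow> int \<Rightarrow> int \<Rightarrow> nat" where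
  "letter_from x i j
     = out_inf T (future (translate i x)) (state_at x i) (nat (j - i - potential (state_at x i)))"

text \<open>Potentials are at most \<open>bound\<close>, so a run entered at
  \<open>j - bound\<close> has not yet passed position \<open>j\<close>.\<close>

definition code :: "(int \<Rightarrow> nat) \<Rightarrow> (int \<Rightarrow> nat)" where
  "code x = (\<lambda>j. letter_from x (j - bound) j)"

lemma out_inf_state_at:
  assumes x: "x \<in> seqs n"
  shows "out_inf T (future (translate i x)) (state_at x i)
    = out_word T (block x i s) (state_at x i) \<frown> out_inf T (future (translate (i + int s) x)) (state_at x (i + int s))"
proof -
  have "future (translate (i + int s) x) \<in> seqs n"
    using x by (simp add: future_in_seqs)
  from out_inf_conc[OF T state_at_in_states[OF x, of i] block_in_lists[OF x, of i s] this]
  show ?thesis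
    by (simp add: block_conc_future state_at_add[OF x])
qed

lemma length_out_block:
  "x \<in> seqs n \<Longrightarrow> int (length (out_word T (block x i s) (state_at x i)))
    = int s + potential (state_at x (i + int s)) - potential (state_at x i)"
  by (simp add: length_out_word block_in_lists state_at_in_states state_at_add)

text \<open>The output of the later start is placed further right by exactly the number of letters
  written in between, so both starts put the same letter at \<open>j\<close>.\<close>

lemma letter_from_add:
  assumes x: "x \<in> seqs n" and "i + int s + potential (state_at x (i + int s)) \<le> j"
  shows "letter_from x i j = letter_from x (i + int s) j"
proof -
  let ?l = "length (out_word T (block x i s) (state_at x i))"
  have "\<not> nat (j - i - potential (state_at x i)) < ?l"
    using length_out_block[OF x, of i s] assms(2) by linarith
  moreover have "nat (j - i - potential (state_at x i)) - ?l
      = nat (j - (i + int s) - potential (state_at x (i + int s)))"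
    using length_out_block[OF x, of i s] assms(2) by linarith
  ultimately show ?thesis
    unfolding letter_from_def out_inf_state_at[OF x, of i s] by simp
qed

lemma code_eq_letter_from:
  assumes x: "x \<in> seqs n" and i: "i + potential (state_at x i) \<le> j"
  shows "code x j = letter_from x i j"
proof -
  let ?i = "j - bound"
  have b: "?i + potential (state_at x ?i) \<le> j"
    using potential_le_bound[OF state_at_in_states[OF x, of ?i]] by linarith
  show ?thesis
  proof (cases "i \<le> ?i")
    case True
    then show ?thesis
      using letter_from_add[OF x, of i "nat (?i - i)" j] b by (simp add: code_def)
  next
    case False
    then show ?thesis
      using letter_from_add[OF x, of ?i "nat (i - ?i)" j] i by (simp add: code_def)
  qed
qed

lemma code_future:
  assumes x: "x \<in> seqs n"
  shows "code x (potential (state_at x 0) + int i) = out_inf T (future x) (state_at x 0) i"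
  using code_eq_letter_from[OF x, of 0 "potential (state_at x 0) + int i"] by (simp add: letter_from_def)

lemma code_past:
  assumes x: "x \<in> seqs n" and y: "y \<in> seqs n" and eq: "\<And>i. i < 0 \<Longrightarrow> x i = y i"
    and j: "j < potential (state_at x 0)"
  shows "code x j = code y j"
proof -
  \<comment> \<open>A run entered at \<open>- s\<close> starts left of \<open>j\<close> by at least
    \<open>bound\<close>, and it writes the letter at \<open>j\<close> before it reaches
    \<open>0\<close>.\<close>
  define s where "s = nat (\<bar>j\<bar> + bound)"
  have "bound \<ge> 0"
    using potential_le_bound[OF q0] by linarith
  then have s: "int s = \<bar>j\<bar> + bound"
    by (simp add: s_def)
  have st: "state_at x (- int s) = state_at y (- int s)"
    using eq by (intro state_at_cong) auto
  have bl: "block x (- int s) s = block y (- int s) s"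
    using eq by (intro block_cong) auto
  let ?q = "state_at x (- int s)"
  have le: "- int s + potential ?q \<le> j"
    using s potential_le_bound[OF state_at_in_states[OF x, of "- int s"]] by linarith
  have "nat (j - (- int s) - potential ?q) < length (out_word T (block x (- int s) s) ?q)"
    using length_out_block[OF x, of "- int s" s] j le by simp
  then have "letter_from x (- int s) j = letter_from y (- int s) j"
    using out_inf_state_at[OF x, of "- int s" s] out_inf_state_at[OF y, of "- int s" s]
    by (simp add: letter_from_def st bl)
  then show ?thesis
    using code_eq_letter_from[OF x le] code_eq_letter_from[OF y, of "- int s" j] le st by simp
qed

text \<open>For the letter at \<open>0\<close> the run is entered at \<open>- bound\<close>, and
  \<open>k\<close> letters further left decide its state. The last summand is an input length that
  forces \<open>2 * bound + 1\<close> letters of output, and position \<open>0\<close> is among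
  these.\<close>

definition radius :: int where
  "radius = bound + int k + int (nat (2 * bound + 1) * card (states T))"

lemma code_right_injective: "right_injective n radius code"
proof
  have b0: "bound \<ge> 0"
    using potential_le_bound[OF q0] by linarith
  show "n \<ge> 2"
    by (rule n)
  show "radius \<ge> 0"
    using b0 by (simp add: radius_def)
  show "code x \<in> seqs n" if x: "x \<in> seqs n" for x
    using out_inf_in_seqs[OF T state_at_in_states[OF x] future_in_seqs, of "translate i x" for i] x
    by (simp add: in_seqs_iff[of "code x"] code_def letter_from_def) (simp add: in_seqs_iff)
  show "code (translate t x) = translate t (code x)" if "x \<in> seqs n" for x t
    by (simp add: code_def letter_from_def state_at_translate fun_eq_iff algebra_simps)
  show "code x 0 = code y 0"
    if x: "x \<in> seqs n" and y: "y \<in> seqs n" and eq: "\<And>i. \<bar>i\<bar> \<le> radius \<Longrightarrow> x i = y i" for x y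
  proof -
    define s where "s = nat (2 * bound + 1) * card (states T)"
    have r: "radius = bound + int k + int s"
      by (simp add: radius_def s_def)
    have st: "state_at x (- bound) = state_at y (- bound)"
      using b0 r by (intro state_at_cong eq) linarith
    have bl: "block x (- bound) s = block y (- bound) s"
      using b0 r by (intro block_cong eq) linarith
    let ?q = "state_at x (- bound)"
    have q: "?q \<in> states T"
      by (rule state_at_in_states[OF x])
    have "nat (2 * bound + 1) \<le> length (out_word T (block x (- bound) s) ?q)"
      by (rule out_word_unbounded[OF T q block_in_lists[OF x]]) (simp add: s_def)
    then have "nat (0 - (- bound) - potential ?q) < length (out_word T (block x (- bound) s) ?q)"
      using potential_le_bound[OF q] b0 by linarith
    then show ?thesis
      using out_inf_state_at[OF x, of "- bound" s] out_inf_state_at[OF y, of "- bound" s]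
      by (simp add: code_def letter_from_def st bl)
  qed
  show "x = y"
    if x: "x \<in> seqs n" and y: "y \<in> seqs n" and eq: "\<And>i. i < 0 \<Longrightarrow> x i = y i" and c: "code x = code y" for x y
  proof -
    \<comment> \<open>Equal pasts give the same state at \<open>0\<close>; its map then sends both
      futures to the same word, and it is injective.\<close>
    have st: "state_at x 0 = state_at y 0"
      by (intro state_at_cong eq)
    have "out_inf T (future x) (state_at x 0) = out_inf T (future y) (state_at x 0)"
      using code_future[OF x] code_future[OF y] by (auto simp: st c)
    then have "future x = future y"
      using inj[OF state_at_in_states[OF x]] future_in_seqs x y by (meson inj_onD)
    then show "x = y"
      using glue_cong[of x y "future x"] eq by (metis glue_future)
  qed
qed

text \<open>The output of the state at \<open>0\<close> begins at its potential and branches there,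
  so the delay is the potential.\<close>

lemma tail_map_code:
  assumes z: "z \<in> seqs n"
  shows "tail_map n code z = state_map n T (state_at z 0)"
proof -
  have st: "state_at (glue z x) 0 = state_at z 0" for x
    by (intro state_at_cong) simp
  have fut: "code (glue z x) (potential (state_at z 0) + int i) = out_inf T x (state_at z 0) i"
    if "x \<in> seqs n" for x i
    using code_future[OF glue_in_seqs[OF z that], of i] by (simp add: st)
  obtain x y where xy: "x \<in> seqs n" "y \<in> seqs n"
    "out_inf T x (state_at z 0) 0 \<noteq> out_inf T y (state_at z 0) 0"
    using br[OF state_at_in_states[OF z, of 0]] by (auto simp: branching_def state_map_def)
  have "delay n code z = potential (state_at z 0)"
  proof (rule delay_eqI)
    show "code (glue z x) j = code (glue z y) j"
      if "j < potential (state_at z 0)" "x \<in> seqs n" "y \<in> seqs n" for j x y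
      using that z by (intro code_past glue_in_seqs) (simp_all add: st)
    show "x \<in> seqs n" "y \<in> seqs n"
      by fact+
    show "code (glue z x) (potential (state_at z 0)) \<noteq> code (glue z y) (potential (state_at z 0))"
      using fut[OF xy(1), of 0] fut[OF xy(2), of 0] xy(3) by simp
  qed
  then show ?thesis
    by (auto simp: tail_map_def state_map_def restrict_def fun_eq_iff fut)
qed

lemma tail_maps_code: "tail_maps n code = state_maps n T"
proof
  show "tail_maps n code \<subseteq> state_maps n T"
    using tail_map_code state_at_in_states by (auto simp: tail_maps_def state_maps_def)
  show "state_maps n T \<subseteq> tail_maps n code"
  proof
    fix h assume "h \<in> state_maps n T"
    then obtain q where q: "q \<in> states T" "h = state_map n T q"
      by (auto simp: state_maps_def)
    obtain w where w: "w \<in> lists {..<n}" "length w = k" "\<And>p. p \<in> states T \<Longrightarrow> trans_word T w p = q"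
      by (rule reachable[OF q(1)]) blast
    let ?z = "append_past (\<lambda>_. 0) w"
    have z: "?z \<in> seqs n"
      using n w by (intro append_past_in_seqs) auto
    have "state_at ?z 0 = q"
      using past_word_append_past[OF w(2)] w(3)[OF q0] by (simp add: state_at_def past_word_eq_block)
    then have "h = tail_map n code ?z"
      using tail_map_code[OF z] q(2) by simp
    then show "h \<in> tail_maps n code"
      unfolding tail_maps_def using z by blast
  qed
qed

end

section \<open>Length-preserving transducers and the identity\<close>

text \<open>Cut the values at the first position where two of them differ.\<close>

lemma nonconstant_decomposition:
  assumes x: "x \<in> seqs n" and y: "y \<in> seqs n" and "F x \<noteq> F y"
  obtains v G where "branching n G" "\<And>x. x \<in> seqs n \<Longrightarrow> F x = v \<frown> G x"
proof -
  let ?P = "\<lambda>k. \<exists>x\<in>seqs n. \<exists>y\<in>seqs n. F x k \<noteq> F y k"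
  define k where "k = (LEAST k. ?P k)"
  have "\<exists>k. ?P k"
    using assms by blast
  then have k: "?P k"
    unfolding k_def by (rule LeastI_ex)
  have least: "F a i = F b i" if "i < k" "a \<in> seqs n" "b \<in> seqs n" for a b i
    using not_less_Least[of i ?P] that unfolding k_def by blast
  have "branching n (\<lambda>a. suffix k (F a))"
    using k by (simp add: branching_def)
  moreover have "F a = map (F x) [0..<k] \<frown> suffix k (F a)" if a: "a \<in> seqs n" for a
  proof
    fix i
    show "F a i = (map (F x) [0..<k] \<frown> suffix k (F a)) i"
      using least[OF _ a x, of i] by (simp add: conc_def)
  qed
  ultimately show thesis
    by (rule that)
qed

lemma out_inf_is_Z:
  assumes Z: "states T = {s}" "\<forall>a<n. trans T a s = s \<and> out T a s = u" and "x \<in> seqs n" "y \<in> seqs n"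
  shows "out_inf T x s = out_inf T y s"
proof -
  have "out_word T w s = concat (replicate (length w) u)" if "w \<in> lists {..<n}" for w
    using that Z(2) by (induction w) auto
  then have "out_word T (map x [0..<k]) s = out_word T (map y [0..<k]) s" for k
    using map_upt_in_lists[of x n 0 k] map_upt_in_lists[of y n 0 k] assms by simp
  then show ?thesis
    by (simp add: out_inf_def)
qed

text \<open>The alternative \<open>is_Z\<close> in \<open>minimal\<close> has a constant map, which
  injectivity excludes; what remains is complete response.\<close>

lemma min_transducer_branching:
  assumes n: "n \<ge> 2" and T: "T \<in> min_transducers n" and q: "q \<in> states T"
    and inj: "inj_on (\<lambda>x. out_inf T x q) (seqs n)"
  shows "branching n (state_map n T q)"
proof -
  have "\<not> is_Z n T u" for u
  proof
    assume "is_Z n T u"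
    then obtain s where s: "states T = {s}" "\<forall>a<n. trans T a s = s \<and> out T a s = u"
      by (auto simp: is_Z_def)
    have 01: "(\<lambda>_. 0) \<in> seqs n" "(\<lambda>_. 1) \<in> seqs n"
      using n by simp_all
    have "out_inf T (\<lambda>_. 0) q = out_inf T (\<lambda>_. 1) q"
      using out_inf_is_Z[OF s 01] q s(1) by simp
    then show False
      using inj_onD[OF inj _ 01] by (simp add: fun_eq_iff)
  qed
  then have "\<not> incomplete_response n T q"
    using T q by (auto simp: min_transducers_def minimal_def)
  then have "gcp_length {out_inf T x q | x. x \<in> seqs n} = 0"
    by (simp add: incomplete_response_def response_extent_def outputs_def)
  moreover have "n \<ge> 1"
    using n by simp
  ultimately have "branching n (\<lambda>x. out_inf T x q)"
    by (simp add: branching_iff_gcp_length)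
  then show ?thesis
    by (simp add: branching_def state_map_def)
qed

lemma length_preservingI:
  assumes n: "n \<ge> 2" and T: "T \<in> min_transducers n"
    and inj: "\<And>q. q \<in> states T \<Longrightarrow> inj_on (\<lambda>x. out_inf T x q) (seqs n)"
    and loop: "\<And>w q. w \<in> lists {..<n} \<Longrightarrow> q \<in> states T \<Longrightarrow> trans_word T w q = q
      \<Longrightarrow> length (out_word T w q) = length w"
  obtains k where "length_preserving n T k"
proof -
  obtain k where k: "sync_level n T k"
    using T by (auto simp: min_transducers_def strongly_synchronizing_def)
  have "core_states n T = states T"
    using T states_core[of n T] by (simp add: min_transducers_def is_core_def)
  then have "length_preserving n T k"
    using n T k inj loop min_transducer_branching[OF n T]
    by (intro length_preserving.intro) (auto simp: min_transducers_def)
  then show thesis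
    by (rule that)
qed

lemma map_class_state_maps: "T \<in> min_transducers n \<Longrightarrow> T \<in> map_class n (state_maps n T)"
  by (simp add: map_class_def)

lemma map_class_inj: "T \<in> map_class n H \<Longrightarrow> map_class n H = map_class n H' \<Longrightarrow> H = H'"
  by (auto simp: map_class_def)

lemma out_inf_id_transducer: "out_inf id_transducer x () = x"
proof (rule out_inf_eqI)
  have *: "out_word id_transducer w () = w" for w
    by (induction w) (simp_all add: id_transducer_def)
  show "\<exists>y. x = out_word id_transducer (map x [0..<m]) () \<frown> y" for m
    using prefix_suffix[of x m] by (auto simp: * subsequence_def)
  show "\<exists>m. i < length (out_word id_transducer (map x [0..<m]) ())" for i
    by (auto simp: *)
qed

lemma tclass_id: "tclass n id_transducer = map_class n {\<lambda>x\<in>seqs n. x}"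
proof -
  have "states id_transducer = {()}"
    by (simp add: id_transducer_def)
  then have "weakly_minimal n id_transducer" "state_maps n id_transducer = {\<lambda>x\<in>seqs n. x}"
    by (simp_all add: weakly_minimal_def state_maps_def state_map_def out_inf_id_transducer)
  then show ?thesis
    by (simp add: tclass_eq)
qed

lemma right_injective_translate:
  assumes n: "n \<ge> 2" shows "right_injective n \<bar>c\<bar> (translate c)"
proof
  fix x y :: "int \<Rightarrow> nat" assume "translate c x = translate c y"
  then have "translate (- c) (translate c x) = translate (- c) (translate c y)"
    by simp
  then show "x = y"
    by simp
qed (use n in \<open>auto simp: add.commute\<close>)

lemma tail_maps_translate:
  assumes n: "n \<ge> 2" shows "tail_maps n (translate c) = {\<lambda>x\<in>seqs n. x}"
proof -
  have 01: "(\<lambda>_. 0) \<in> seqs n" "(\<lambda>_. 1) \<in> seqs n"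
    using n by simp_all
  have "delay n (translate c) z = - c" for z
    by (rule delay_eqI[of _ n "translate c" z, OF _ 01]) simp_all
  then have "tail_map n (translate c) z = (\<lambda>x\<in>seqs n. x)" for z
    by (simp add: tail_map_def)
  moreover have "(\<lambda>_::int. 0) \<in> seqs n"
    using n by simp
  then have "seqs n \<noteq> ({} :: (int \<Rightarrow> nat) set)"
    by blast
  ultimately show ?thesis
    by (simp add: tail_maps_def image_constant_conv)
qed

lemma map_class_id_nonempty: "n \<ge> 2 \<Longrightarrow> map_class n {\<lambda>x\<in>seqs n. x} \<noteq> {}"
  using right_injective.code_transducer_in_map_class[OF right_injective_translate, of n 0]
  by (auto simp: tail_maps_translate)

text \<open>With identity tail maps, appending \<open>w\<close> writes \<open>length w\<close>
  letters, so the delay does not change. Since recent letters decide it and they can be appended to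
  the zero past, all pasts share one delay \<open>c\<close>, and the image is the point itself moved
  by \<open>c\<close>.\<close>

lemma (in right_injective) translate_if_tail_maps_id:
  assumes "tail_maps n f = {\<lambda>x\<in>seqs n. x}"
  obtains c where "\<And>x. x \<in> seqs n \<Longrightarrow> f x = translate c x"
proof -
  have M: "tail_map n f z = (\<lambda>x\<in>seqs n. x)" if "z \<in> seqs n" for z
    using assms that by (auto simp: tail_maps_def)
  have D: "delay n f (append_past z w) = delay n f z" if z: "z \<in> seqs n" and w: "w \<in> lists {..<n}" for z w
  proof -
    have "w \<frown> x = past_out n f z w \<frown> x" if x: "x \<in> seqs n" for x
      using tail_map_conc[OF z w x] M[OF z] M[OF append_past_closed[OF z w]] w x
      by (simp add: conc_in_seqs_iff)
    from conc_injective_length[OF n this] show ?thesis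
      using length_past_out[OF z w] by simp
  qed
  define c where "c = delay n f (\<lambda>_. 0)"
  have 0: "(\<lambda>_. 0) \<in> seqs n"
    using n by simp
  have c: "delay n f z = c" if z: "z \<in> seqs n" for z
    using tail_map_append_past_word(2)[OF z 0, of "nat (2 * m)"] D[OF 0 past_word_in_lists[OF z]]
    by (simp add: c_def)
  have "f x = translate (- c) x" if x: "x \<in> seqs n" for x
  proof
    fix j
    let ?y = "translate (j - c) x"
    have y: "?y \<in> seqs n"
      using x by simp
    have "f ?y c = tail_map n f ?y (future ?y) 0"
      using c[OF y] future_in_seqs[OF y] by (simp add: tail_map_def glue_future)
    also have "\<dots> = ?y 0"
      using M[OF y] future_in_seqs[OF y] by simp
    finally show "f x j = translate (- c) x j"
      using equivariant[OF x, of "j - c"] by simp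
  qed
  then show thesis
    by (rule that)
qed

text \<open>
  A loop \<open>b\<close> of \<open>U\<close> is, after passing to a power, part of a loop of the product with \<open>T\<close>; there the
  two transducers cancel up to a fixed prefix, so \<open>T\<close> must undo the change of length made by \<open>U\<close>.
\<close>
lemma loop_length_inverse:
  assumes n: "n \<ge> 2" and U: "is_transducer n U" and T: "is_transducer n T"
    and sync: "strongly_synchronizing n U" "strongly_synchronizing n T"
    and loop: "\<And>w q. w \<in> lists {..<n} \<Longrightarrow> q \<in> states T \<Longrightarrow> trans_word T w q = q
      \<Longrightarrow> length (out_word T w q) = length w"
    and inverse: "\<And>s. s \<in> core_states n (product U T)
      \<Longrightarrow> \<exists>v. \<forall>x\<in>seqs n. out_inf (product U T) x s = v \<frown> x"
    and b: "b \<in> lists {..<n}" and q: "q \<in> states U" and bq: "trans_word U b q = q"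
  shows "length (out_word U b q) = length b"
proof (cases "b = []")
  case False
  define c where "c = out_word U b q"
  have c: "c \<in> lists {..<n}"
    unfolding c_def by (rule out_word_in_lists[OF U b q])
  let ?b = "\<lambda>j. concat (replicate j b)" and ?c = "\<lambda>j. concat (replicate j c)"
  have bl: "?b j \<in> lists {..<n}" and cl: "?c j \<in> lists {..<n}" for j
    using b c by (auto split: if_splits simp: set_replicate_conv_if)
  have Ub: "trans_word U (?b j) q = q" for j
    by (induction j) (simp_all add: trans_word_append bq)
  have oU: "out_word U (?b j) q = ?c j" for j
    by (induction j) (simp_all add: out_word_append bq c_def)
  obtain p0 where p0: "p0 \<in> states T"
    using states_nonempty[OF T] by blast
  let ?p = "\<lambda>j. trans_word T (?c j) p0"
  have p: "?p j \<in> states T" for j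
    by (rule trans_word_in_states[OF T cl p0])
  have P: "is_transducer n (product U T)"
    by (rule is_transducer_product[OF U T])
  obtain l where l: "sync_level n (product U T) l"
    using strongly_synchronizing_product[OF U T sync] by (auto simp: strongly_synchronizing_def)
  \<comment> \<open>\<open>U\<close> returns to \<open>q\<close> after each \<open>b\<close>, while
    \<open>T\<close> need not return. At least \<open>l\<close> repetitions ensure that the pair
    lies in the core; among such pairs two coincide and bound a loop of the product.\<close>
  have "(\<lambda>j. ?p (l + j)) ` UNIV \<subseteq> states T"
    using p by blast
  then have "finite ((\<lambda>j. ?p (l + j)) ` UNIV)"
    using finite_states[OF T] by (rule finite_subset)
  then have "\<not> inj (\<lambda>j. ?p (l + j))"
    using finite_imageD infinite_UNIV_nat by blast
  then obtain i j where ij: "i < j" "?p (l + i) = ?p (l + j)"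
    unfolding inj_def by (metis linorder_neqE_nat)
  define r where "r = j - i"
  let ?q = "?p (l + i)"
  have r: "r > 0" "l + j = (l + i) + r"
    using ij by (simp_all add: r_def)
  have "trans_word T (?c r) ?q = ?p ((l + i) + r)"
    by (simp add: replicate_add trans_word_append)
  then have loop_c: "trans_word T (?c r) ?q = ?q"
    using ij(2) r(2) by simp
  have prod: "trans_word (product U T) (?b (l + i)) (q, p0) = (q, ?q)"
    by (simp add: trans_word_product Ub oU)
  have "l \<le> l * length b"
    using False by (cases b) auto
  then have "l \<le> l * length b + i * length b"
    by (rule trans_le_add1)
  then have "l \<le> length (?b (l + i))"
    by (simp only: length_concat sum_list_replicate map_replicate add_mult_distrib of_nat_id)
  then have "sync_level n (product U T) (length (?b (l + i)))"
    by (rule sync_level_mono[OF l _ P])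
  then have core: "(q, ?q) \<in> core_states n (product U T)"
    unfolding core_states_def using bl[of "l + i"] q p0 prod
    by (intro CollectI exI[of _ "?b (l + i)"] exI[of _ "(q, p0)"]) simp
  obtain v where v: "\<And>x. x \<in> seqs n \<Longrightarrow> out_inf (product U T) x (q, ?q) = v \<frown> x"
    using inverse[OF core] by blast
  let ?e = "out_word T (?c r) ?q"
  have e: "length ?e = length (?c r)"
    by (rule loop[OF cl p loop_c])
  have st: "(q, ?q) \<in> states (product U T)"
    using q p by simp
  have "(v @ ?b r) \<frown> x = (?e @ v) \<frown> x" if x: "x \<in> seqs n" for x
  proof -
    have "(v @ ?b r) \<frown> x = out_inf (product U T) (?b r \<frown> x) (q, ?q)"
      using v[of "?b r \<frown> x"] bl[of r] x by (simp add: conc_in_seqs_iff)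
    also have "\<dots> = out_word (product U T) (?b r) (q, ?q)
        \<frown> out_inf (product U T) x (trans_word (product U T) (?b r) (q, ?q))"
      by (rule out_inf_conc[OF P st bl x])
    also have "\<dots> = ?e \<frown> (v \<frown> x)"
      by (simp add: out_word_product trans_word_product oU Ub loop_c v[OF x])
    finally show ?thesis
      by simp
  qed
  from conc_injective_length[OF n this] have "length (?b r) = length (?c r)"
    using e by simp
  then show ?thesis
    using r(1) by (simp add: length_concat sum_list_replicate c_def)
qed simp

text \<open>Composing injective state maps gives nonconstant outputs, so the nondegenerate reduction
  applies. That its class is the identity class says that every branching rest is the
  identity.\<close>

lemma product_identity:
  assumes n: "n \<ge> 2" and T: "T \<in> min_transducers n" and U: "U \<in> min_transducers n"
    and inj: "\<And>q. q \<in> states T \<Longrightarrow> inj_on (\<lambda>x. out_inf T x q) (seqs n)"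
      "\<And>q. q \<in> states U \<Longrightarrow> inj_on (\<lambda>x. out_inf U x q) (seqs n)"
    and V: "V \<in> tclass n (reduction n (core n (product T U)))" "V \<in> tclass n id_transducer"
    and s: "s \<in> core_states n (product T U)"
  shows "\<exists>v. \<forall>x\<in>seqs n. out_inf (product T U) x s = v \<frown> x"
proof -
  let ?C = "core n (product T U)"
  have T': "is_transducer n T" "strongly_synchronizing n T" and U': "is_transducer n U" "strongly_synchronizing n U"
    using T U by (simp_all add: min_transducers_def)
  note P = is_transducer_product[OF T'(1) U'(1)]
  have C: "is_transducer n ?C"
    using n by (intro is_transducer_core[OF P] strongly_synchronizing_product T' U') simp
  have 01: "(\<lambda>_. 0) \<in> seqs n" "(\<lambda>_. 1) \<in> seqs n"
    using n by simp_all
  have "\<exists>v G. branching n G \<and> (\<forall>x\<in>seqs n. out_inf ?C x r = v \<frown> G x)" if r: "r \<in> states ?C" for r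
  proof -
    have "r \<in> states (product T U)"
      using r core_states_subset[OF P] unfolding states_core by blast
    then obtain p q where pq: "r = (p, q)" "p \<in> states T" "q \<in> states U"
      by (cases r) simp
    have "out_inf T (\<lambda>_. 0) p \<noteq> out_inf T (\<lambda>_. 1) p"
      using inj_onD[OF inj(1)[OF pq(2)] _ 01] by (auto simp: fun_eq_iff)
    then have "out_inf ?C (\<lambda>_. 0) r \<noteq> out_inf ?C (\<lambda>_. 1) r"
      unfolding out_inf_core pq(1) out_inf_product[OF T'(1) U'(1) pq(2,3) 01(1)]
        out_inf_product[OF T'(1) U'(1) pq(2,3) 01(2)]
      using inj_onD[OF inj(2)[OF pq(3)] _ out_inf_in_seqs[OF T'(1) pq(2) 01(1)]
          out_inf_in_seqs[OF T'(1) pq(2) 01(2)]] by blast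
    from nonconstant_decomposition[OF 01, of "\<lambda>x. out_inf ?C x r", OF this] show ?thesis
      by metis
  qed
  then obtain v h where br: "\<And>r. r \<in> states ?C \<Longrightarrow> branching n (h r)"
    and out: "\<And>r x. r \<in> states ?C \<Longrightarrow> x \<in> seqs n \<Longrightarrow> out_inf ?C x r = v r \<frown> h r x"
    by metis
  have "tclass n (reduction n ?C) = map_class n ((\<lambda>r. restrict (h r) (seqs n)) ` states ?C)"
    using tclass_eq[OF weakly_minimal_reduction[OF C out br]] state_maps_reduction[OF C out br] by simp
  then have "(\<lambda>r. restrict (h r) (seqs n)) ` states ?C = {\<lambda>x\<in>seqs n. x}"
    using V by (simp add: tclass_id map_class_def)
  then have "restrict (h s) (seqs n) = (\<lambda>x\<in>seqs n. x)"
    using s by auto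
  then have "h s x = x" if "x \<in> seqs n" for x
    using that by (metis restrict_apply')
  then show ?thesis
    using out[of s] s by auto
qed

section \<open>Topology: sliding block codes and automorphisms of the shift\<close>

lemma compact_space_seq_topology: "compact_space (seq_topology n)"
  by (simp add: seq_topology_def compact_space_product_topology compact_space_discrete_topology)

lemma Hausdorff_space_seq_topology: "Hausdorff_space (seq_topology n)"
  by (simp add: seq_topology_def Hausdorff_space_product_topology Hausdorff_space_discrete_topology)

lemma openin_finite_window:
  fixes S :: "('i \<Rightarrow> nat) set"
  assumes S: "S \<subseteq> seqs n" and J: "finite J"
    and win: "\<And>x y. x \<in> S \<Longrightarrow> y \<in> seqs n \<Longrightarrow> (\<And>i. i \<in> J \<Longrightarrow> x i = y i) \<Longrightarrow> y \<in> S"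
  shows "openin (seq_topology n) S"
  unfolding seq_topology_def openin_product_topology_alt
proof
  fix x assume x: "x \<in> S"
  let ?U = "\<lambda>i. if i \<in> J then {x i} else {..<n}"
  have "{i \<in> UNIV. ?U i \<noteq> topspace (discrete_topology {..<n})} \<subseteq> J"
    by auto
  then have "finite {i \<in> UNIV. ?U i \<noteq> topspace (discrete_topology {..<n})}"
    using J by (rule finite_subset)
  moreover have x_lt: "x i < n" for i
    using x S by (auto simp: in_seqs_iff)
  then have "\<forall>i\<in>UNIV. openin (discrete_topology {..<n}) (?U i)" "x \<in> Pi\<^sub>E UNIV ?U"
    by auto
  moreover have "Pi\<^sub>E UNIV ?U \<subseteq> S"
  proof
    fix y assume "y \<in> Pi\<^sub>E UNIV ?U"
    then have y: "y i \<in> ?U i" for i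
      by (auto simp: PiE_def Pi_def)
    show "y \<in> S"
    proof (rule win[OF x])
      show "y \<in> seqs n"
        unfolding in_seqs_iff using y x_lt by (metis lessThan_iff singletonD)
      show "x i = y i" if "i \<in> J" for i
        using y[of i] that by simp
    qed
  qed
  ultimately show "\<exists>U. finite {i \<in> UNIV. U i \<noteq> topspace (discrete_topology {..<n})}
      \<and> (\<forall>i\<in>UNIV. openin (discrete_topology {..<n}) (U i)) \<and> x \<in> Pi\<^sub>E UNIV U \<and> Pi\<^sub>E UNIV U \<subseteq> S"
    by - (intro exI[of _ ?U] conjI)
qed

lemma closedin_finite_window:
  fixes S :: "('i \<Rightarrow> nat) set"
  assumes S: "S \<subseteq> seqs n" and J: "finite J"
    and win: "\<And>x y. x \<in> S \<Longrightarrow> y \<in> seqs n \<Longrightarrow> (\<And>i. i \<in> J \<Longrightarrow> x i = y i) \<Longrightarrow> y \<in> S"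
  shows "closedin (seq_topology n) S"
  unfolding closedin_def topspace_seq_topology
proof
  show "openin (seq_topology n) (seqs n - S)"
  proof (rule openin_finite_window[OF _ J])
    fix x y assume "x \<in> seqs n - S" "y \<in> seqs n" "\<And>i. i \<in> J \<Longrightarrow> x i = y i"
    then show "y \<in> seqs n - S"
      using win[of y x] by auto
  qed auto
qed (rule S)

lemma openin_seq_topology_window:
  fixes S :: "('i \<Rightarrow> nat) set"
  assumes "openin (seq_topology n) S" and x: "x \<in> S"
  obtains J where "finite J" "\<And>y. y \<in> seqs n \<Longrightarrow> (\<And>i. i \<in> J \<Longrightarrow> x i = y i) \<Longrightarrow> y \<in> S"
proof -
  obtain U where fin: "finite {i \<in> UNIV. U i \<noteq> topspace (discrete_topology {..<n})}"
    and xU: "x \<in> Pi\<^sub>E UNIV U" and US: "Pi\<^sub>E UNIV U \<subseteq> S"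
    using assms(1)[unfolded seq_topology_def openin_product_topology_alt, rule_format, OF x] by blast
  show thesis
  proof (rule that[OF fin])
    fix y assume y: "y \<in> seqs n"
      and eq: "\<And>i. i \<in> {i \<in> UNIV. U i \<noteq> topspace (discrete_topology {..<n})} \<Longrightarrow> x i = y i"
    have "y i \<in> U i" for i
    proof (cases "U i = {..<n}")
      case True
      then show ?thesis
        using y by (simp add: in_seqs_iff)
    next
      case False
      then have "x i = y i"
        using eq[of i] by simp
      then show ?thesis
        using xU by (metis PiE_mem UNIV_I)
    qed
    then have "y \<in> Pi\<^sub>E UNIV U"
      by (auto simp: PiE_iff)
    then show "y \<in> S"
      using US by blast
  qed
qed

lemma finite_int_bounded:
  fixes J :: "int set"
  assumes "finite J"
  obtains m where "m \<ge> 0" "\<And>i. i \<in> J \<Longrightarrow> \<bar>i\<bar> \<le> m"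
proof (rule that[of "Max (insert 0 (abs ` J))"])
  show "Max (insert 0 (abs ` J)) \<ge> 0"
    using assms by (intro Max_ge) auto
  show "\<bar>i\<bar> \<le> Max (insert 0 (abs ` J))" if "i \<in> J" for i
    using assms that by (intro Max_ge) auto
qed

text \<open>Near each \<open>x\<close> the letter \<open>f x 0\<close> is decided by the positions
  within \<open>\<mu> x\<close> of \<open>0\<close>. Finitely many of these cylinders cover the
  compact space, and a bound for their radii serves everywhere.\<close>

theorem Curtis_Hedlund_Lyndon:
  fixes f :: "(int \<Rightarrow> nat) \<Rightarrow> (int \<Rightarrow> nat)"
  assumes f: "continuous_map (seq_topology n) (seq_topology n) f"
  obtains m where "m \<ge> 0"
    "\<And>x y. x \<in> seqs n \<Longrightarrow> y \<in> seqs n \<Longrightarrow> (\<And>i. \<bar>i\<bar> \<le> m \<Longrightarrow> x i = y i) \<Longrightarrow> f x 0 = f y 0"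
proof -
  have f0: "continuous_map (seq_topology n) (discrete_topology {..<n}) (\<lambda>x. f x 0)"
    using f unfolding seq_topology_def[of n] continuous_map_componentwise_UNIV by blast
  have "\<exists>m. \<forall>y\<in>seqs n. (\<forall>i. \<bar>i\<bar> \<le> m \<longrightarrow> x i = y i) \<longrightarrow> f x 0 = f y 0" if x: "x \<in> seqs n" for x
  proof -
    let ?S = "{y \<in> topspace (seq_topology n). f y 0 \<in> {f x 0}}"
    have "f x \<in> seqs n"
      using f x by (metis continuous_map_image_subset_topspace image_subset_iff topspace_seq_topology)
    then have "openin (discrete_topology {..<n}) {f x 0}"
      by (simp add: in_seqs_iff)
    then have op: "openin (seq_topology n) ?S"
      by (rule openin_continuous_map_preimage[OF f0])
    have "x \<in> ?S"
      using x by (simp add: topspace_seq_topology)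
    then obtain J where J: "finite J" "\<And>y. y \<in> seqs n \<Longrightarrow> (\<And>i. i \<in> J \<Longrightarrow> x i = y i) \<Longrightarrow> y \<in> ?S"
      by (rule openin_seq_topology_window[OF op]) blast
    obtain m where m: "\<And>i. i \<in> J \<Longrightarrow> \<bar>i\<bar> \<le> m"
      using finite_int_bounded[OF J(1)] by metis
    show ?thesis
    proof (intro exI[of _ m] ballI impI)
      fix y assume "y \<in> seqs n" and "\<forall>i. \<bar>i\<bar> \<le> m \<longrightarrow> x i = y i"
      then have "y \<in> ?S"
        using m by (intro J(2)) auto
      then show "f x 0 = f y 0"
        by simp
    qed
  qed
  then obtain \<mu> where \<mu>: "\<And>x y. x \<in> seqs n \<Longrightarrow> y \<in> seqs n \<Longrightarrow> (\<forall>i. \<bar>i\<bar> \<le> \<mu> x \<longrightarrow> x i = y i) \<Longrightarrow> f x 0 = f y 0"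
    by metis
  define C where "C x = {y \<in> seqs n. \<forall>i. \<bar>i\<bar> \<le> \<mu> x \<longrightarrow> x i = y i}" for x
  have "openin (seq_topology n) (C x)" for x
    by (rule openin_finite_window[where J = "{- \<mu> x..\<mu> x}"]) (auto simp: C_def abs_le_iff)
  moreover have "topspace (seq_topology n) \<subseteq> \<Union> (C ` seqs n)"
    by (auto simp: topspace_seq_topology C_def)
  ultimately obtain \<F> where \<F>: "finite \<F>" "\<F> \<subseteq> C ` seqs n" "topspace (seq_topology n) \<subseteq> \<Union> \<F>"
    using compact_space_seq_topology[of n, unfolded compact_space_alt, rule_format, of "C ` seqs n"] by blast
  then obtain F where F: "finite F" "F \<subseteq> seqs n" "\<F> = C ` F"
    by (meson finite_subset_image)
  obtain m where m: "m \<ge> 0" "\<And>i. i \<in> \<mu> ` F \<Longrightarrow> \<bar>i\<bar> \<le> m"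
    using finite_int_bounded[of "\<mu> ` F"] F(1) by blast
  show thesis
  proof (rule that[OF m(1)])
    fix x y :: "int \<Rightarrow> nat"
    assume x: "x \<in> seqs n" and y: "y \<in> seqs n" and eq: "\<And>i. \<bar>i\<bar> \<le> m \<Longrightarrow> x i = y i"
    then obtain a where a: "a \<in> F" "x \<in> C a"
      using \<F>(3) F(3) by (auto simp: topspace_seq_topology)
    have "\<mu> a \<le> m"
      using m(2)[of "\<mu> a"] a(1) by auto
    then have "y \<in> C a"
      using a(2) y eq by (force simp: C_def)
    then show "f x 0 = f y 0"
      using \<mu>[of a x] \<mu>[of a y] a F(2) x y by (auto simp: C_def)
  qed
qed

lemma (in sliding) continuous: "continuous_map (seq_topology n) (seq_topology n) f"
proof -
  have "continuous_map (seq_topology n) (discrete_topology {..<n}) (\<lambda>x. f x k)" for k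
    unfolding continuous_map_def topspace_seq_topology topspace_discrete_topology
  proof (intro conjI allI impI)
    show "(\<lambda>x. f x k) \<in> seqs n \<rightarrow> {..<n}"
      using closed by (auto simp: in_seqs_iff)
    fix U assume "openin (discrete_topology {..<n}) U"
    show "openin (seq_topology n) {x \<in> seqs n. f x k \<in> U}"
    proof (rule openin_finite_window[where J = "{k - m..k + m}"])
      fix x y assume x: "x \<in> {x \<in> seqs n. f x k \<in> U}" and y: "y \<in> seqs n"
        and eq: "\<And>i. i \<in> {k - m..k + m} \<Longrightarrow> x i = y i"
      have "f x k = f y k"
        using x y by (intro window_at eq) auto
      then show "y \<in> {x \<in> seqs n. f x k \<in> U}"
        using x y by simp
    qed auto
  qed
  then show ?thesis
    unfolding seq_topology_def[of n] continuous_map_componentwise_UNIV by blast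
qed

lemma shift_eq_translate: "x \<in> seqs n \<Longrightarrow> shift n x = translate (- 1) x"
  by (simp add: shift_def translate_def)

lemma translate_commute:
  assumes closed: "\<And>x. x \<in> seqs n \<Longrightarrow> f x \<in> seqs n"
    and comm: "\<And>x. x \<in> seqs n \<Longrightarrow> f (translate (- 1) x) = translate (- 1) (f x)" and x: "x \<in> seqs n"
  shows "f (translate k x) = translate k (f x)"
  using x
proof (induction k arbitrary: x rule: int_induct[where k = 0])
  case (step1 i)
  have "translate (- 1) (f (translate (i + 1) x)) = f (translate (- 1) (translate (i + 1) x))"
    using step1.prems by (intro comm[symmetric]) simp
  also have "\<dots> = f (translate i x)"
    by simp
  also have "\<dots> = translate i (f x)"
    by (rule step1(2)[OF step1.prems])
  finally have "translate 1 (translate (- 1) (f (translate (i + 1) x))) = translate 1 (translate i (f x))"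
    by simp
  then have "f (translate (i + 1) x) = translate (i + 1) (f x)"
    by (simp add: add.commute)
  then show ?case .
next
  case (step2 i)
  have "f (translate (- 1) (translate i x)) = translate (- 1) (f (translate i x))"
    using step2.prems by (intro comm) simp
  also have "f (translate i x) = translate i (f x)"
    by (rule step2(2)[OF step2.prems])
  finally have "f (translate (- 1 + i) x) = translate (- 1 + i) (f x)"
    unfolding translate_translate .
  moreover have "- 1 + i = i - 1"
    by simp
  ultimately show ?case
    by (simp only:)
qed simp

section \<open>Automorphisms as invertible codes\<close>

lemma carrier_shift_aut:
  "f \<in> carrier (shift_aut n) \<longleftrightarrow> f \<in> Bij (seqs n) \<and> homeomorphic_map (seq_topology n) (seq_topology n) f
     \<and> (\<forall>x\<in>seqs n. f (shift n x) = shift n (f x))"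
  by (simp add: shift_aut_def)

lemma shift_aut_right_injective:
  assumes n: "n \<ge> 2" and f: "f \<in> carrier (shift_aut n)"
  obtains m where "right_injective n m f"
proof -
  have cont: "continuous_map (seq_topology n) (seq_topology n) f"
    using f homeomorphic_imp_continuous_map by (auto simp: carrier_shift_aut)
  have bij: "bij_betw f (seqs n) (seqs n)"
    using f by (simp add: carrier_shift_aut Bij_def)
  then have closed: "f x \<in> seqs n" if "x \<in> seqs n" for x
    using that by (simp add: bij_betw_apply)
  have comm: "f (translate (- 1) x) = translate (- 1) (f x)" if "x \<in> seqs n" for x
    using f closed[OF that] that by (simp add: carrier_shift_aut shift_eq_translate)
  obtain m where m: "m \<ge> 0"
    "\<And>x y. x \<in> seqs n \<Longrightarrow> y \<in> seqs n \<Longrightarrow> (\<And>i. \<bar>i\<bar> \<le> m \<Longrightarrow> x i = y i) \<Longrightarrow> f x 0 = f y 0"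
    using Curtis_Hedlund_Lyndon[OF cont] by blast
  have "right_injective n m f"
  proof
    show "f (translate k x) = translate k (f x)" if "x \<in> seqs n" for x k
      by (rule translate_commute[where f = f, OF closed comm that])
    show "f x 0 = f y 0" if "x \<in> seqs n" "y \<in> seqs n" "\<And>i. \<bar>i\<bar> \<le> m \<Longrightarrow> x i = y i" for x y
      using that by (rule m(2))
    show "x = y" if "x \<in> seqs n" "y \<in> seqs n" "f x = f y" for x y
      using bij that by (simp add: bij_betw_def inj_on_def)
  qed (use n m(1) closed in auto)
  then show thesis
    by (rule that)
qed

text \<open>A continuous bijection of a compact Hausdorff space is a homeomorphism. The restriction
  is there because elements of \<open>BijGroup\<close> are extensional.\<close>

lemma (in sliding) restrict_in_shift_aut:
  assumes bij: "bij_betw f (seqs n) (seqs n)"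
  shows "restrict f (seqs n) \<in> carrier (shift_aut n)"
proof -
  have "homeomorphic_map (seq_topology n) (seq_topology n) f"
    using bij by (intro continuous_imp_homeomorphic_map continuous compact_space_seq_topology
        Hausdorff_space_seq_topology) (auto simp: topspace_seq_topology bij_betw_def)
  then have "homeomorphic_map (seq_topology n) (seq_topology n) (restrict f (seqs n))"
    by (rule homeomorphic_map_eq) (simp add: topspace_seq_topology)
  moreover have "restrict f (seqs n) \<in> Bij (seqs n)"
    using bij by (auto simp: Bij_def bij_betw_restrict_eq)
  ultimately show ?thesis
    using closed equivariant[of _ "- 1"] by (simp add: carrier_shift_aut shift_eq_translate)
qed

lemma subgroup_shift_aut: "subgroup (carrier (shift_aut n)) (BijGroup (seqs n))"
proof
  show "carrier (shift_aut n) \<subseteq> carrier (BijGroup (seqs n))"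
    by (auto simp: carrier_shift_aut BijGroup_def)
next
  fix f g assume f: "f \<in> carrier (shift_aut n)" and g: "g \<in> carrier (shift_aut n)"
  have eq: "f \<otimes>\<^bsub>BijGroup (seqs n)\<^esub> g = compose (seqs n) f g"
    using f g by (simp add: BijGroup_def carrier_shift_aut)
  have "homeomorphic_map (seq_topology n) (seq_topology n) (f \<circ> g)"
    using f g by (auto simp: carrier_shift_aut intro: homeomorphic_map_compose)
  then have "homeomorphic_map (seq_topology n) (seq_topology n) (compose (seqs n) f g)"
    by (rule homeomorphic_map_eq) (simp add: topspace_seq_topology compose_def)
  moreover have "compose (seqs n) f g \<in> Bij (seqs n)"
    using f g by (auto simp: carrier_shift_aut intro: compose_Bij)
  moreover have "compose (seqs n) f g (shift n x) = shift n (compose (seqs n) f g x)" if x: "x \<in> seqs n" for x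
  proof -
    have "shift n x \<in> seqs n" "g x \<in> seqs n"
      using x g Bij_imp_funcset[of g "seqs n"] by (auto simp: shift_eq_translate carrier_shift_aut)
    then show ?thesis
      using f g x by (simp add: compose_def carrier_shift_aut)
  qed
  ultimately show "f \<otimes>\<^bsub>BijGroup (seqs n)\<^esub> g \<in> carrier (shift_aut n)"
    by (simp add: eq carrier_shift_aut)
next
  have "homeomorphic_map (seq_topology n) (seq_topology n) (\<lambda>x\<in>seqs n. x)"
    by (rule homeomorphic_map_eq[of _ _ id]) (simp_all add: topspace_seq_topology)
  then show "\<one>\<^bsub>BijGroup (seqs n)\<^esub> \<in> carrier (shift_aut n)"
    by (simp add: BijGroup_def carrier_shift_aut id_Bij shift_eq_translate)
next
  fix f assume f: "f \<in> carrier (shift_aut n)"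
  let ?g = "\<lambda>x\<in>seqs n. inv_into (seqs n) f x"
  have B: "f \<in> Bij (seqs n)"
    using f by (simp add: carrier_shift_aut)
  then have inj: "inj_on f (seqs n)" and im: "f ` seqs n = seqs n"
    by (auto simp: Bij_def bij_betw_def)
  obtain g where g: "homeomorphic_maps (seq_topology n) (seq_topology n) f g"
    using f by (auto simp: carrier_shift_aut homeomorphic_map_maps)
  then have "homeomorphic_map (seq_topology n) (seq_topology n) g"
    by (metis homeomorphic_map_maps homeomorphic_maps_sym)
  moreover have "g x = ?g x" if x: "x \<in> seqs n" for x
  proof -
    have "continuous_map (seq_topology n) (seq_topology n) g" and fg: "f (g x) = x"
      using g x by (simp_all add: homeomorphic_maps_def topspace_seq_topology)
    then have "g x \<in> seqs n"
      using x by (metis continuous_map_image_subset_topspace image_subset_iff topspace_seq_topology)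
    then show ?thesis
      using inv_into_f_f[OF inj, of "g x"] x fg by simp
  qed
  ultimately have "homeomorphic_map (seq_topology n) (seq_topology n) ?g"
    by (rule homeomorphic_map_eq) (simp add: topspace_seq_topology)
  moreover have "?g \<in> Bij (seqs n)"
    by (rule restrict_inv_into_Bij[OF B])
  moreover have "?g (shift n x) = shift n (?g x)" if x: "x \<in> seqs n" for x
  proof -
    define y where "y = inv_into (seqs n) f x"
    have y: "y \<in> seqs n" "f y = x"
      using x im unfolding y_def by (metis inv_into_into, metis f_inv_into_f)
    then have "shift n x = f (shift n y)" "shift n y \<in> seqs n" "shift n x \<in> seqs n"
      using f x by (auto simp: carrier_shift_aut shift_eq_translate)
    then show ?thesis
      using inv_into_f_f[OF inj, of "shift n y"] x by (simp flip: y_def)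
  qed
  ultimately show "inv\<^bsub>BijGroup (seqs n)\<^esub> f \<in> carrier (shift_aut n)"
    by (simp add: inv_BijGroup[OF B] carrier_shift_aut)
qed

lemma group_shift_aut: "group (shift_aut n)"
  using subgroup.subgroup_is_group[OF subgroup_shift_aut group_BijGroup, of n]
  by (simp add: shift_aut_def)

lemma mult_shift_aut:
  "f \<in> carrier (shift_aut n) \<Longrightarrow> g \<in> carrier (shift_aut n) \<Longrightarrow> f \<otimes>\<^bsub>shift_aut n\<^esub> g = compose (seqs n) f g"
  by (simp add: shift_aut_def BijGroup_def)

lemma one_shift_aut: "\<one>\<^bsub>shift_aut n\<^esub> = (\<lambda>x\<in>seqs n. x)"
  by (simp add: shift_aut_def BijGroup_def)

text \<open>Membership in the image depends on finitely many letters. If \<open>y'\<close> agrees on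
  \<open>J\<close> with a word of the image, glue it to the image past and pull back by
  \<open>g\<close>: the point obtained has past \<open>z\<close>, and its future is mapped to
  \<open>y'\<close>.\<close>

lemma (in composable_codes) tail_map_clopen:
  assumes gf: "\<And>x. x \<in> seqs n \<Longrightarrow> g (f x) = x" and fg: "\<And>x. x \<in> seqs n \<Longrightarrow> f (g x) = x"
    and z: "z \<in> seqs n"
  shows "openin (seq_topology n) (tail_map n f z ` seqs n)" "closedin (seq_topology n) (tail_map n f z ` seqs n)"
proof -
  let ?d = "delay n f z" and ?S = "tail_map n f z ` seqs n"
  \<comment> \<open>To compute its letters left of \<open>- delay n f z\<close>, \<open>g\<close>
    looks only at positions below \<open>m' - delay n f z\<close>.\<close>
  define J :: "nat set" where "J = {..<nat (m' - delay n f z)}"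
  have S: "?S \<subseteq> seqs n"
    using f.tail_map_in_seqs[OF z] by blast
  have "y' \<in> ?S" if y: "y \<in> ?S" and y': "y' \<in> seqs n" and eq: "\<And>i. i \<in> J \<Longrightarrow> y i = y' i" for y y'
  proof -
    obtain x where x: "x \<in> seqs n" "y = tail_map n f z x"
      using y by blast
    let ?Y = "glue (image_past z) y" and ?Y' = "glue (image_past z) y'"
    have Y: "?Y \<in> seqs n" "?Y' \<in> seqs n"
      using y S y' by (auto intro!: glue_in_seqs image_past_in_seqs z)
    have "?Y = f (translate ?d (glue z x))"
      using glue_image_past[OF z x(1)] glue_in_seqs[OF z x(1)] by (simp add: x(2) f.equivariant)
    then have gY: "g ?Y = translate ?d (glue z x)"
      using gf glue_in_seqs[OF z x(1)] by simp
    let ?X = "translate (- ?d) (g ?Y')"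
    have X: "?X \<in> seqs n"
      using g.closed[OF Y(2)] by simp
    have past: "?X i = z i" if "i < 0" for i
    proof -
      have "g ?Y' (i - ?d) = g ?Y (i - ?d)"
      proof (rule g.window_at[OF Y(2,1)])
        fix j assume "\<bar>j - (i - ?d)\<bar> \<le> m'"
        then have "j < m' - ?d"
          using that by linarith
        then show "?Y' j = ?Y j"
          using eq[of "nat j"] by (simp add: glue_def J_def)
      qed
      then show ?thesis
        using that by (simp add: gY)
    qed
    have X_eq: "?X = glue z (future ?X)"
      using glue_cong[of z ?X "future ?X"] past by (simp add: glue_future)
    have "glue (image_past z) (tail_map n f z (future ?X)) = translate ?d (f ?X)"
      using glue_image_past[OF z future_in_seqs[OF X]] by (simp flip: X_eq)
    also have "\<dots> = ?Y'"
      using fg[OF Y(2)] g.closed[OF Y(2)] by (simp add: f.equivariant)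
    finally have "tail_map n f z (future ?X) = y'"
      by (metis future_glue)
    then show ?thesis
      using imageI[OF future_in_seqs[OF X], of "tail_map n f z"] by simp
  qed
  then show "openin (seq_topology n) ?S" "closedin (seq_topology n) ?S"
    using openin_finite_window[OF S, of J] closedin_finite_window[OF S, of J] by (auto simp: J_def)
qed

lemma (in right_injective) tail_map_inj: "z \<in> seqs n \<Longrightarrow> inj_on (tail_map n f z) (seqs n)"
proof (rule inj_onI)
  fix x y assume z: "z \<in> seqs n" and xy: "x \<in> seqs n" "y \<in> seqs n" and eq: "tail_map n f z x = tail_map n f z y"
  have "f (glue z x) j = f (glue z y) j" for j
  proof (cases "j < delay n f z")
    case False
    then show ?thesis
      using fun_cong[OF eq, of "nat (j - delay n f z)"] xy by (simp add: tail_map_def)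
  qed (simp add: delay_const[OF z _ xy])
  then have fe: "f (glue z x) = f (glue z y)"
    by (rule ext)
  have "glue z x = glue z y"
    by (rule right_inj) (simp_all add: z xy glue_in_seqs fe)
  then show "x = y"
    by (metis future_glue)
qed

lemma (in composable_codes) map_class_in_O_tilde:
  assumes gf: "\<And>x. x \<in> seqs n \<Longrightarrow> g (f x) = x" and fg: "\<And>x. x \<in> seqs n \<Longrightarrow> f (g x) = x"
  shows "map_class n (tail_maps n f) \<in> O_tilde n"
proof -
  let ?T = "code_transducer n f"
  have "inj_on (\<lambda>w. out_inf ?T w q) (seqs n) \<and> openin (seq_topology n) ((\<lambda>w. out_inf ?T w q) ` seqs n)
      \<and> closedin (seq_topology n) ((\<lambda>w. out_inf ?T w q) ` seqs n)" if q: "q \<in> states ?T" for q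
  proof -
    obtain z where z: "z \<in> seqs n" "q = to_nat_on (tail_maps n f) (tail_map n f z)"
      using q by (auto simp: f.states_code_transducer)
    have eq: "out_inf ?T w q = tail_map n f z w" if "w \<in> seqs n" for w
      using f.out_inf_code_transducer[OF z(1) that] z(2) by simp
    then have "(\<lambda>w. out_inf ?T w q) ` seqs n = tail_map n f z ` seqs n"
      by (rule image_cong[OF refl])
    moreover have "inj_on (\<lambda>w. out_inf ?T w q) (seqs n)"
      using f.tail_map_inj[OF z(1)] inj_on_cong[of "seqs n" "\<lambda>w. out_inf ?T w q" "tail_map n f z"] eq by blast
    ultimately show ?thesis
      using tail_map_clopen[OF gf fg z(1)] by simp
  qed
  then show ?thesis
    unfolding O_tilde_def f.tclass_code_transducer[symmetric]
    using f.code_transducer_in_min_transducers by blast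
qed

section \<open>The centre of the automorphism group\<close>

text \<open>
  The marker \<open>0\<^sup>p 1 w\<^sub>1 1 w\<^sub>2 1 \<dots> w\<^sub>r 1 \<star> 1\<close>, where the words \<open>w\<^sub>i\<close> of length \<open>p - 1\<close> are those in \<open>ws\<close>
  and the wildcard \<open>\<star>\<close> stands for a letter \<open>0\<close> or \<open>1\<close>. Two occurrences never overlap, since \<open>p\<close>
  consecutive zeros occur only at the beginning; hence changing the wildcards is an involution.
\<close>
locale marker =
  fixes n p :: nat and ws :: "nat list list"
  assumes n: "n \<ge> 2" and p: "p \<ge> 2"
    and ws: "\<And>w. w \<in> set ws \<Longrightarrow> w \<in> lists {..<n} \<and> length w = p - 1"
begin

text \<open>Offset of the wildcard: one period of zeros, a period for each word together with the
  separator before it, and a last separator. It is \<open>1\<close> modulo \<open>p\<close>.\<close>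

definition len :: nat where "len = p * (length ws + 1) + 1"

definition letter :: "nat \<Rightarrow> nat" where
  "letter j = (if j < p then 0 else if p dvd j then 1 else ws ! (j div p - 1) ! (j mod p - 1))"

definition occurs :: "(int \<Rightarrow> nat) \<Rightarrow> int \<Rightarrow> bool" where
  "occurs x i \<longleftrightarrow> (\<forall>j<len. x (i - int len + int j) = letter j) \<and> x i < 2 \<and> x (i + 1) = 1"

text \<open>\<open>occurs\<close> guarantees \<open>x i < 2\<close>, so the subtraction exchanges
  \<open>0\<close> and \<open>1\<close>.\<close>

definition flip :: "(int \<Rightarrow> nat) \<Rightarrow> (int \<Rightarrow> nat)" where
  "flip x = (\<lambda>i. if occurs x i then 1 - x i else x i)"

lemma p_less_len: "p < len"
  by (simp add: len_def less_Suc_eq_le)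

lemma occursD: "occurs x i \<Longrightarrow> - int len \<le> k - i \<Longrightarrow> k < i \<Longrightarrow> x k = letter (nat (k - i + int len))"
  unfolding occurs_def by (elim conjE allE[of _ "nat (k - i + int len)"]) simp

lemma letter_less: "j < len \<Longrightarrow> letter j < n"
proof (cases "j < p \<or> p dvd j")
  case True
  then show ?thesis
    using n by (auto simp: letter_def)
next
  case False
  assume j: "j < len"
  have "j \<noteq> p * (length ws + 1)"
    using False by auto
  then have "j < p * (length ws + 1)"
    using j by (simp add: len_def)
  then have "j div p < length ws + 1"
    using p by (simp add: less_mult_imp_div_less mult.commute)
  moreover have "j div p \<noteq> 0"
    using False p by (simp add: div_eq_0_iff)
  ultimately have "j div p - 1 < length ws"
    by auto
  then have w: "ws ! (j div p - 1) \<in> lists {..<n}" "length (ws ! (j div p - 1)) = p - 1"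
    using ws[OF nth_mem] by auto
  have "j mod p - 1 < p - 1"
    using p False by (simp add: dvd_eq_mod_eq_0 less_diff_conv)
  then have "ws ! (j div p - 1) ! (j mod p - 1) \<in> {..<n}"
    using w nth_mem by (metis in_listsD)
  then show ?thesis
    using False by (simp add: letter_def)
qed

text \<open>If \<open>k\<close> were close to \<open>i\<close>, the \<open>p\<close> zeros opening
  the marker at \<open>k\<close> would cover a letter \<open>1\<close> of the marker at
  \<open>i\<close>: either its last letter or one of the separators, which recur with period
  \<open>p\<close>.\<close>

lemma no_overlap:
  assumes i: "occurs x i" and k: "occurs x k" and "i < k"
  shows "k - i > int len + 1"
proof (rule ccontr)
  assume "\<not> ?thesis"
  then have t: "k - i \<le> int len + 1"
    by simp
  have len: "int p < int len"
    using p_less_len by simp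
  have zero: "x l = 0" if "k - int len \<le> l" "l < k - int len + int p" for l
    using occursD[OF k, of l] that len by (simp add: letter_def)
  show False
  proof (cases "k - int len + int p > i + 1")
    case True
    then have "x (i + 1) = 0"
      using t by (intro zero) auto
    then show False
      using i by (simp add: occurs_def)
  next
    case False
    define s where "s = nat (k - i)"
    have s: "int s = k - i"
      using \<open>i < k\<close> by (simp add: s_def)
    \<comment> \<open>The first multiple of \<open>p\<close> from \<open>s\<close> on, hence a
      separator of the marker at \<open>i\<close>; it is not the wildcard because \<open>len\<close>
      is \<open>1\<close> modulo \<open>p\<close>.\<close>
    define q where "q = p * ((s + p - 1) div p)"
    have "q + (s + p - 1) mod p = s + p - 1"
      by (simp add: q_def)
    moreover have "(s + p - 1) mod p < p"
      using p by simp
    ultimately have q: "s \<le> q" "q < s + p"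
      using p by linarith+
    have "p dvd len \<longleftrightarrow> p dvd 1"
      unfolding len_def by (rule dvd_add_right_iff) simp
    then have "\<not> p dvd len"
      using p by simp
    moreover have "p dvd q"
      by (simp add: q_def)
    ultimately have "q \<noteq> len"
      by auto
    moreover have "q \<le> len"
      using False q(2) s by linarith
    ultimately have "q < len"
      by simp
    have "q \<noteq> 0"
      using q(1) s \<open>i < k\<close> by auto
    then have "letter q = 1"
      using \<open>p dvd q\<close> by (auto simp: letter_def dest: dvd_imp_le)
    then have "x (i - int len + int q) = 1"
      using i \<open>q < len\<close> by (simp add: occurs_def)
    moreover have "x (i - int len + int q) = 0"
      using q s by (intro zero) linarith+
    ultimately show False
      by simp
  qed
qed

lemma no_overlap': "occurs x i \<Longrightarrow> occurs x k \<Longrightarrow> \<bar>k - i\<bar> \<le> int len + 1 \<Longrightarrow> k = i"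
  using no_overlap[of x i k] no_overlap[of x k i] by linarith

lemma occurs_cong:
  assumes "\<And>k. - int len \<le> k - i \<Longrightarrow> k - i \<le> 1 \<Longrightarrow> k \<noteq> i \<Longrightarrow> x k = y k" and "x i < 2 \<longleftrightarrow> y i < 2"
  shows "occurs x i \<longleftrightarrow> occurs y i"
proof -
  have "x (i - int len + int j) = y (i - int len + int j)" if "j < len" for j
    using that by (intro assms(1)) auto
  moreover have "x (i + 1) = y (i + 1)"
    by (intro assms(1)) auto
  ultimately show ?thesis
    using assms(2) by (simp add: occurs_def)
qed

text \<open>A wildcard never lies inside another marker, so changing wildcards destroys no marker;
  nor does it create one, by the same reasoning started from \<open>flip x\<close>.\<close>

lemma occurs_flip: "occurs (flip x) i \<longleftrightarrow> occurs x i"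
proof -
  have imp: "occurs (flip x) i" if i: "occurs x i" for i
  proof -
    have "occurs x i \<longleftrightarrow> occurs (flip x) i"
    proof (rule occurs_cong)
      fix k assume k: "- int len \<le> k - i" "k - i \<le> 1" "k \<noteq> i"
      then have "\<bar>k - i\<bar> \<le> int len + 1"
        by linarith
      then have "\<not> occurs x k"
        using no_overlap'[OF i, of k] k(3) by blast
      then show "x k = flip x k"
        by (simp add: flip_def)
    qed (use i in \<open>auto simp: flip_def occurs_def\<close>)
    then show ?thesis
      using i by blast
  qed
  show ?thesis
  proof
    assume i: "occurs (flip x) i"
    show "occurs x i"
    proof (cases "occurs x i")
      case False
      have "occurs (flip x) i \<longleftrightarrow> occurs x i"
      proof (rule occurs_cong)
        fix k assume k: "- int len \<le> k - i" "k - i \<le> 1" "k \<noteq> i"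
        then have "\<bar>k - i\<bar> \<le> int len + 1"
          by linarith
        then have "\<not> occurs (flip x) k"
          using no_overlap'[OF i, of k] k(3) by blast
        then have "\<not> occurs x k"
          using imp by blast
        then show "flip x k = x k"
          by (simp add: flip_def)
      qed (use False in \<open>simp add: flip_def\<close>)
      then show ?thesis
        using i by blast
    qed
  qed (rule imp)
qed

lemma flip_flip: "flip (flip x) = x"
proof
  fix i
  show "flip (flip x) i = x i"
    by (cases "occurs x i") (auto simp: flip_def[of "flip x"] occurs_flip, auto simp: flip_def occurs_def)
qed

lemma flip_in_seqs: "x \<in> seqs n \<Longrightarrow> flip x \<in> seqs n"
  using n by (auto simp: in_seqs_iff flip_def intro: less_imp_diff_less)

lemma occurs_translate: "occurs (translate k x) i \<longleftrightarrow> occurs x (i + k)"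
  by (simp add: occurs_def algebra_simps)

lemma sliding_flip: "sliding n (int len + 1) flip"
proof
  show "flip (translate k x) = translate k (flip x)" for k x
    by (simp add: flip_def occurs_translate fun_eq_iff)
  show "flip x 0 = flip y 0" if "\<And>i. \<bar>i\<bar> \<le> int len + 1 \<Longrightarrow> x i = y i" for x y
  proof -
    have "x 0 = y 0"
      by (rule that) simp
    moreover have "occurs x 0 \<longleftrightarrow> occurs y 0"
      using \<open>x 0 = y 0\<close> by (intro occurs_cong that) auto
    ultimately show ?thesis
      by (simp add: flip_def)
  qed
qed (use n flip_in_seqs in auto)

lemma flip_in_shift_aut: "restrict flip (seqs n) \<in> carrier (shift_aut n)"
proof (rule sliding.restrict_in_shift_aut[OF sliding_flip])
  show "bij_betw flip (seqs n) (seqs n)"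
    by (rule bij_betw_byWitness[where f' = flip]) (auto simp: flip_flip flip_in_seqs)
qed

text \<open>An isolated marker with its wildcard at \<open>0\<close>. It is surrounded by ones
  because a marker begins with \<open>0\<close>, so no second occurrence can arise.\<close>

definition marked :: "nat \<Rightarrow> int \<Rightarrow> nat" where
  "marked v = (\<lambda>i. if - int len \<le> i \<and> i < 0 then letter (nat (i + int len)) else if i = 0 then v else 1)"

lemma marked_in_seqs: "v < 2 \<Longrightarrow> marked v \<in> seqs n"
  using n letter_less by (auto simp: in_seqs_iff marked_def)

lemma occurs_marked: "v < 2 \<Longrightarrow> occurs (marked v) i \<longleftrightarrow> i = 0"
proof
  assume v: "v < 2"
  have 0: "occurs (marked v) 0"
    using v by (simp add: occurs_def marked_def)
  show "i = 0" if i: "occurs (marked v) i"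
  proof (rule ccontr)
    assume "i \<noteq> 0"
    then have "\<bar>i\<bar> > int len + 1"
      using no_overlap'[OF 0 i] by linarith
    then have "marked v (i - int len) = 1"
      by (auto simp: marked_def)
    moreover have "marked v (i - int len) = letter 0"
      using occursD[OF i, of "i - int len"] p_less_len by simp
    ultimately show False
      using p by (simp add: letter_def)
  qed
  show "occurs (marked v) i" if "i = 0"
    using 0 that by simp
qed

lemma flip_marked: "flip (marked 0) = marked 1"
  by (auto simp: flip_def occurs_marked fun_eq_iff) (simp_all add: marked_def)

text \<open>Word \<open>q\<close> fills period \<open>q + 1\<close> behind its separator, which
  accounts for the inner \<open>+ 1\<close>.\<close>

lemma marked_word:
  assumes "q < length ws" "t < p - 1"
  shows "marked v (int (p * (q + 1) + 1 + t) - int len) = ws ! q ! t"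
    and "letter (p * (q + 1) + 1 + t) = ws ! q ! t"
    and "p * (q + 1) + 1 + t < len"
proof -
  have t: "1 + t < p"
    using assms(2) by simp
  have "p * (q + 1) + p \<le> p * (length ws + 1)"
    using assms(1) by (metis Suc_eq_plus1 Suc_leI add_le_mono1 mult_Suc_right add.commute mult_le_mono2)
  then show len: "p * (q + 1) + 1 + t < len"
    using t by (simp add: len_def)
  have d: "(p * (q + 1) + 1 + t) div p = q + 1" and m: "(p * (q + 1) + 1 + t) mod p = 1 + t"
    using t div_mult_self4[of p "q + 1" "1 + t"] mod_mult_self4[of p "q + 1" "1 + t"]
    by (simp_all add: add.assoc)
  have "\<not> p * (q + 1) + 1 + t < p"
    by simp
  then show letter: "letter (p * (q + 1) + 1 + t) = ws ! q ! t"
    unfolding letter_def dvd_eq_mod_eq_0 d m by simp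
  have "marked v (int j - int len) = letter j" if "j < len" for j
    using that by (simp add: marked_def)
  from this[OF len] show "marked v (int (p * (q + 1) + 1 + t) - int len) = ws ! q ! t"
    unfolding letter .
qed

end

text \<open>The two isolated markers differ only in the wildcard, and \<open>flip\<close> exchanges
  their images under \<open>f\<close>; so the image contains a marker, displaced by some
  \<open>c\<close> within \<open>m\<close> of \<open>0\<close>. Every window of \<open>f\<close>
  appears inside the marker, and the displaced copy in the image shows what \<open>f\<close> writes
  there.\<close>

theorem Ryan:
  assumes z: "right_injective n m f" and f: "f \<in> center (shift_aut n)"
  obtains c where "\<And>x. x \<in> seqs n \<Longrightarrow> f x = translate c x"
proof -
  interpret right_injective n m f
    by (rule z)
  define L where "L = nat (2 * m + 1)"
  have L: "int L = 2 * m + 1"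
    using m by (simp add: L_def)
  have fin: "finite {w. set w \<subseteq> {..<n} \<and> length w = L}"
    by (rule finite_lists_length_eq) simp
  obtain ws where set_ws: "set ws = {w. set w \<subseteq> {..<n} \<and> length w = L}"
    using finite_list[OF fin] by (elim exE)
  \<comment> \<open>A period of \<open>Suc L\<close> has room for a separator and a word of length
    \<open>L\<close>, the full window of \<open>f\<close>.\<close>
  interpret marker n "Suc L" ws
    using n m set_ws by unfold_locales (auto simp: L_def)
  have "f \<otimes>\<^bsub>shift_aut n\<^esub> restrict flip (seqs n) = restrict flip (seqs n) \<otimes>\<^bsub>shift_aut n\<^esub> f"
    using f flip_in_shift_aut by (simp add: center_def)
  then have "compose (seqs n) f (restrict flip (seqs n)) = compose (seqs n) (restrict flip (seqs n)) f"
    using f flip_in_shift_aut by (simp add: mult_shift_aut center_def)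
  then have comm: "f (flip x) = flip (f x)" if "x \<in> seqs n" for x
    using closed[OF that] that by (auto simp: compose_def dest: fun_cong[of _ _ x])
  have X: "marked 0 \<in> seqs n" "marked 1 \<in> seqs n"
    by (rule marked_in_seqs, simp)+
  have f1: "f (marked 1) = flip (f (marked 0))"
    using comm[OF X(1)] unfolding flip_marked .
  have "marked 0 \<noteq> marked 1"
    by (auto simp: marked_def fun_eq_iff intro!: exI[of _ 0])
  moreover have "marked 0 i = marked 1 i" if "i < 0" for i
    using that by (simp add: marked_def)
  ultimately have "f (marked 0) \<noteq> f (marked 1)"
    using right_inj[OF X] by blast
  then obtain c where c: "f (marked 0) c \<noteq> f (marked 1) c"
    by auto
  then have occ: "occurs (f (marked 0)) c"
    unfolding f1 by (auto simp: flip_def split: if_splits)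
  have c_le: "\<bar>c\<bar> \<le> m"
  proof (rule ccontr)
    assume "\<not> \<bar>c\<bar> \<le> m"
    then have "f (marked 0) c = f (marked 1) c"
      using X by (intro window_at) (auto simp: marked_def)
    then show False
      using c by simp
  qed
  have local: "f y 0 = y (- c)" if y: "y \<in> seqs n" for y
  proof -
    have "block y (- m) L \<in> set ws"
      using block_in_lists[OF y, of "- m" L] by (auto simp: set_ws)
    then obtain q where q: "q < length ws" "ws ! q = block y (- m) L"
      by (auto simp: in_set_conv_nth)
    \<comment> \<open>The middle of the word \<open>ws ! q\<close> in \<open>marked 0\<close>, where
      \<open>f\<close> sees the same window as in \<open>y\<close> around \<open>0\<close>.\<close>
    define j where "j = int (Suc L * (q + 1) + 1) + m - int len"
    have word: "marked 0 (j + i) = y i" "letter (nat (j + i + int len)) = y i"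
      "j + i < 0" "- int len \<le> j + i"
      if "\<bar>i\<bar> \<le> m" for i
    proof -
      define t where "t = nat (m + i)"
      have t: "int t = m + i"
        using that by (simp add: t_def)
      have "t < Suc L - 1"
        using t L that by linarith
      note mw = marked_word[OF q(1) this]
      have eq: "int (Suc L * (q + 1) + 1 + t) - int len = j + i"
        using t by (simp add: j_def)
      have "block y (- m) L ! t = y i"
        using \<open>t < Suc L - 1\<close> t by (simp add: block_def)
      then show "marked 0 (j + i) = y i"
        using mw(1)[of 0] unfolding eq q(2) by simp
      have "nat (j + i + int len) = Suc L * (q + 1) + 1 + t"
        using eq by linarith
      then show "letter (nat (j + i + int len)) = y i"
        using mw(2) \<open>block y (- m) L ! t = y i\<close> by (simp add: q(2))
      show "j + i < 0"
        using mw(3) eq by linarith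
      show "- int len \<le> j + i"
        unfolding eq[symmetric] by simp
    qed
    have "f y 0 = f (translate j (marked 0)) 0"
      using y X(1) word(1) by (intro window) (auto simp: add.commute)
    also have "\<dots> = f (marked 0) j"
      using X(1) by (simp add: equivariant)
    \<comment> \<open>The marker in the image has its wildcard at \<open>c\<close>, so position
      \<open>j\<close> carries the letter that \<open>marked 0\<close> has at \<open>j - c\<close>;
      as \<open>c\<close> is within \<open>m\<close> of \<open>0\<close>, this is still in the same
      word.\<close>
    also have "\<dots> = letter (nat (j - c + int len))"
      using occursD[OF occ, of j] word(3,4)[of "- c"] c_le by simp
    also have "\<dots> = y (- c)"
      using word(2)[of "- c"] c_le by simp
    finally show ?thesis .
  qed
  have "f x = translate (- c) x" if x: "x \<in> seqs n" for x
  proof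
    fix k
    show "f x k = translate (- c) x k"
      using local[of "translate k x"] x by (simp add: equivariant add.commute)
  qed
  then show thesis
    by (rule that)
qed

section \<open>The extension\<close>

definition translation :: "nat \<Rightarrow> int \<Rightarrow> (int \<Rightarrow> nat) \<Rightarrow> (int \<Rightarrow> nat)" where
  "translation n c = restrict (translate c) (seqs n)"

lemma translation_in_shift_aut:
  assumes "n \<ge> 2" shows "translation n c \<in> carrier (shift_aut n)"
  unfolding translation_def
proof (rule sliding.restrict_in_shift_aut)
  show "sliding n \<bar>c\<bar> (translate c)"
    by (rule right_injective.axioms(1)[OF right_injective_translate[OF assms]])
  show "bij_betw (translate c) (seqs n) (seqs n)"
    by (rule bij_betw_byWitness[where f' = "translate (- c)"]) auto
qed

lemma shift_eq_translation: "shift n = translation n (- 1)"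
  unfolding shift_def translation_def by (rule restrict_ext) (simp add: fun_eq_iff)

lemma translation_add:
  assumes "n \<ge> 2"
  shows "translation n c \<otimes>\<^bsub>shift_aut n\<^esub> translation n d = translation n (c + d)"
  unfolding mult_shift_aut[OF translation_in_shift_aut[OF assms] translation_in_shift_aut[OF assms]]
  by (auto simp: compose_def translation_def restrict_def fun_eq_iff)

lemma translation_hom: "n \<ge> 2 \<Longrightarrow> (\<lambda>k. translation n (- k)) \<in> hom integer_group (shift_aut n)"
  by (simp add: hom_def translation_in_shift_aut translation_add)

lemma shift_pow:
  assumes "n \<ge> 2" shows "shift n [^]\<^bsub>shift_aut n\<^esub> (k::int) = translation n (- k)"
  using hom_int_pow[OF translation_hom[OF assms], of 1 k] group_shift_aut
  by (simp add: shift_eq_translation)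

lemma carrier_shift_powers:
  assumes "n \<ge> 2" shows "carrier (subgroup_generated (shift_aut n) {shift n}) = range (translation n)"
proof -
  interpret group "shift_aut n"
    by (rule group_shift_aut)
  have "shift n \<in> carrier (shift_aut n)"
    using translation_in_shift_aut[OF assms] by (simp add: shift_eq_translation)
  then have "carrier (subgroup_generated (shift_aut n) {shift n}) = range (\<lambda>k. translation n (- k))"
    by (simp add: carrier_subgroup_generated_by_singleton shift_pow[OF assms])
  also have "\<dots> = range (translation n)"
    using range_composition[of "translation n" "uminus :: int \<Rightarrow> int"] by (simp add: surj_uminus)
  finally show ?thesis .
qed

lemma inj_translation:
  assumes "n \<ge> 2" shows "inj (translation n)"
proof (rule injI)
  fix c d assume eq: "translation n c = translation n d"
  let ?x = "\<lambda>i. if i = c then 1 else 0 :: nat"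
  have "?x \<in> seqs n"
    using assms by (simp add: in_seqs_iff)
  then have "?x c = ?x d"
    using fun_cong[OF fun_cong[OF eq, of ?x], of 0] by (simp add: translation_def)
  then show "c = d"
    by (simp split: if_splits)
qed

lemma shift_powers_iso:
  assumes "n \<ge> 2" shows "subgroup_generated (shift_aut n) {shift n} \<cong> integer_group"
proof -
  have "(\<lambda>k. translation n (- k)) ` UNIV = range (translation n)"
    using range_composition[of "translation n" "uminus :: int \<Rightarrow> int"] by (simp add: surj_uminus)
  moreover have "inj (\<lambda>k. translation n (- k))"
    using inj_compose[OF inj_translation[OF assms], of uminus] by (simp add: comp_def)
  ultimately have "(\<lambda>k. translation n (- k)) \<in> iso integer_group (subgroup_generated (shift_aut n) {shift n})"
    by (auto simp: iso_iff hom_def carrier_shift_powers[OF assms] translation_add[OF assms])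
  then have "integer_group \<cong> subgroup_generated (shift_aut n) {shift n}"
    by (auto simp: is_iso_def)
  then show ?thesis
    by (rule group.iso_sym[OF group_integer_group])
qed

lemma center_shift_aut:
  assumes n: "n \<ge> 2" shows "center (shift_aut n) = range (translation n)"
proof
  show "center (shift_aut n) \<subseteq> range (translation n)"
  proof
    fix f assume f: "f \<in> center (shift_aut n)"
    then have fc: "f \<in> carrier (shift_aut n)"
      by (simp add: center_def)
    obtain m where m: "right_injective n m f"
      by (rule shift_aut_right_injective[OF n fc])
    obtain c where c: "\<And>x. x \<in> seqs n \<Longrightarrow> f x = translate c x"
      using Ryan[OF m f] by blast
    have "f \<in> extensional (seqs n)"
      using fc by (simp add: carrier_shift_aut Bij_def)
    then have "f = translation n c"
      unfolding translation_def by (rule extensionalityI) (use c in auto)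
    then show "f \<in> range (translation n)"
      by blast
  qed
  show "range (translation n) \<subseteq> center (shift_aut n)"
  proof
    fix t assume "t \<in> range (translation n)"
    then obtain c where t: "t = translation n c"
      by blast
    have "translation n c \<otimes>\<^bsub>shift_aut n\<^esub> g = g \<otimes>\<^bsub>shift_aut n\<^esub> translation n c"
      if g: "g \<in> carrier (shift_aut n)" for g
    proof -
      obtain m where "right_injective n m g"
        by (rule shift_aut_right_injective[OF n g])
      then interpret g: right_injective n m g .
      show ?thesis
        unfolding mult_shift_aut[OF g translation_in_shift_aut[OF n]] mult_shift_aut[OF translation_in_shift_aut[OF n] g]
        by (auto simp: compose_def translation_def restrict_def g.equivariant g.closed)
    qed
    then show "t \<in> center (shift_aut n)"
      using translation_in_shift_aut[OF n] by (simp add: center_def t)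
  qed
qed

lemma tail_maps_cong:
  assumes "\<And>x. x \<in> seqs n \<Longrightarrow> f x = g x"
  shows "tail_maps n f = tail_maps n g"
proof -
  have "tail_map n f z = tail_map n g z" if z: "z \<in> seqs n" for z
  proof -
    have eq: "f (glue z x) = g (glue z x)" if "x \<in> seqs n" for x
      by (intro assms glue_in_seqs z that)
    then have "delay n f z = delay n g z"
      by (simp add: delay_def cong: ball_cong bex_cong)
    then show ?thesis
      using eq by (auto simp: tail_map_def restrict_def fun_eq_iff)
  qed
  then show ?thesis
    by (simp add: tail_maps_def)
qed

section \<open>The class of an automorphism\<close>

definition code_class :: "nat \<Rightarrow> ((int \<Rightarrow> nat) \<Rightarrow> (int \<Rightarrow> nat)) \<Rightarrow> nat transducer set" where
  "code_class n f = map_class n (tail_maps n f)"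

lemma code_class_one: "n \<ge> 2 \<Longrightarrow> code_class n (\<lambda>x\<in>seqs n. x) = \<one>\<^bsub>M_monoid n\<^esub>"
  using tail_maps_cong[of n "\<lambda>x\<in>seqs n. x" "translate 0"]
  by (simp add: code_class_def tail_maps_translate M_monoid_def tclass_id)

lemma code_class_mult:
  assumes n: "n \<ge> 2" and f: "f \<in> carrier (shift_aut n)" and g: "g \<in> carrier (shift_aut n)"
  shows "code_class n f \<otimes>\<^bsub>M_monoid n\<^esub> code_class n g = code_class n (g \<otimes>\<^bsub>shift_aut n\<^esub> f)"
proof -
  obtain m m' where m: "right_injective n m f" and m': "right_injective n m' g"
    using shift_aut_right_injective[OF n f] shift_aut_right_injective[OF n g] by metis
  interpret composable_codes n m f m' g
    by (intro composable_codes.intro m m')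
  have "tail_maps n (g \<circ> f) = tail_maps n (g \<otimes>\<^bsub>shift_aut n\<^esub> f)"
    by (rule tail_maps_cong) (simp add: mult_shift_aut[OF g f] compose_def)
  then show ?thesis
    using mult_map_class by (simp add: code_class_def)
qed

lemma code_class_in_carrier:
  assumes n: "n \<ge> 2" and f: "f \<in> carrier (shift_aut n)"
  shows "code_class n f \<in> O_tilde n" "code_class n f \<in> L_tilde n"
proof -
  interpret group "shift_aut n"
    by (rule group_shift_aut)
  let ?g = "inv\<^bsub>shift_aut n\<^esub> f"
  have g: "?g \<in> carrier (shift_aut n)"
    using f by simp
  obtain m m' where m: "right_injective n m f" and m': "right_injective n m' ?g"
    using shift_aut_right_injective[OF n f] shift_aut_right_injective[OF n g] by metis
  interpret composable_codes n m f m' ?g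
    by (intro composable_codes.intro m m')
  have "compose (seqs n) ?g f = (\<lambda>x\<in>seqs n. x)" "compose (seqs n) f ?g = (\<lambda>x\<in>seqs n. x)"
    using l_inv[OF f] r_inv[OF f] by (simp_all add: mult_shift_aut f g one_shift_aut)
  then have "?g (f x) = x" "f (?g x) = x" if "x \<in> seqs n" for x
    using that by (metis compose_eq restrict_apply')+
  then show "code_class n f \<in> O_tilde n"
    unfolding code_class_def by (rule map_class_in_O_tilde)
  show "code_class n f \<in> L_tilde n"
    unfolding code_class_def by (rule f.map_class_in_L_tilde)
qed

lemma L_group_simps:
  "carrier (L_group n) = Units ((M_monoid n)\<lparr>carrier := O_tilde n\<rparr>) \<inter> L_tilde n"
  "mult (L_group n) = mult (M_monoid n)" "\<one>\<^bsub>L_group n\<^esub> = \<one>\<^bsub>M_monoid n\<^esub>"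
  by (simp_all add: L_group_def)

lemma code_class_in_L_group:
  assumes n: "n \<ge> 2" and f: "f \<in> carrier (shift_aut n)"
  shows "code_class n f \<in> carrier (L_group n)"
proof -
  interpret group "shift_aut n"
    by (rule group_shift_aut)
  let ?g = "inv\<^bsub>shift_aut n\<^esub> f"
  have g: "?g \<in> carrier (shift_aut n)"
    using f by simp
  have "code_class n f \<otimes>\<^bsub>M_monoid n\<^esub> code_class n ?g = \<one>\<^bsub>M_monoid n\<^esub>"
    "code_class n ?g \<otimes>\<^bsub>M_monoid n\<^esub> code_class n f = \<one>\<^bsub>M_monoid n\<^esub>"
    unfolding code_class_mult[OF n f g] code_class_mult[OF n g f] l_inv[OF f] r_inv[OF f]
    by (simp_all add: one_shift_aut code_class_one[OF n])
  then show ?thesis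
    using code_class_in_carrier[OF n f] code_class_in_carrier[OF n g] unfolding L_group_simps
    by (auto simp: Units_def)
qed

lemma inj_on_out_inf_iff:
  "inj_on (\<lambda>x. out_inf T x q) (seqs n) \<longleftrightarrow> inj_on (state_map n T q) (seqs n)"
  by (rule inj_on_cong) (simp add: state_map_def)

text \<open>\<open>O_tilde\<close> speaks of one representative; injectivity depends on the maps
  alone and so passes to all members of the class.\<close>

lemma inj_on_out_inf_transfer:
  assumes "state_maps n T = state_maps n U" and "\<And>q. q \<in> states T \<Longrightarrow> inj_on (\<lambda>x. out_inf T x q) (seqs n)"
    and q: "q \<in> states U"
  shows "inj_on (\<lambda>x. out_inf U x q) (seqs n)"
proof -
  have "state_map n U q \<in> state_maps n T"
    unfolding assms(1) using q by (simp add: state_maps_def)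
  then obtain p where "p \<in> states T" "state_map n U q = state_map n T p"
    by (auto simp: state_maps_def)
  then show ?thesis
    using assms(2) by (simp add: inj_on_out_inf_iff)
qed

text \<open>A loop of \<open>S\<close> returns to the same tail map and writes what the code writes,
  so it inherits the length from \<open>length_past_out_loop\<close>.\<close>

lemma (in right_injective) map_class_loop:
  assumes S: "S \<in> map_class n (tail_maps n f)" and w: "w \<in> lists {..<n}" and q: "q \<in> states S"
    and loop: "trans_word S w q = q"
  shows "length (out_word S w q) = length w"
proof -
  have S': "is_transducer n S" "state_maps n S = tail_maps n f"
    using S by (simp_all add: map_class_def min_transducers_def)
  obtain z where z: "z \<in> seqs n" "state_map n S q = tail_map n f z"
    using state_map_in_tail_maps[OF S'(2) q] by blast
  have "tail_map n f (append_past z w) = tail_map n f z"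
    using state_map_trans_word[OF S' q z w] z(2) loop by simp
  then show ?thesis
    using length_past_out_loop[OF z(1) w] out_word_eq_past_out[OF S' q z w] by simp
qed

text \<open>As the product is a union over representatives, a member of the nonempty identity class
  exhibits a concrete pair whose product reduces to the identity.\<close>

lemma product_identity_from_mult:
  assumes n: "n \<ge> 2" and one: "A \<otimes>\<^bsub>M_monoid n\<^esub> B = \<one>\<^bsub>M_monoid n\<^esub>"
  obtains T U V where "T \<in> A" "U \<in> B" "V \<in> tclass n (reduction n (core n (product T U)))"
    "V \<in> tclass n id_transducer"
proof -
  obtain V where V: "V \<in> map_class n {\<lambda>x\<in>seqs n. x}"
    using map_class_id_nonempty[OF n] by blast
  then have "V \<in> A \<otimes>\<^bsub>M_monoid n\<^esub> B"
    unfolding one by (simp add: M_monoid_def tclass_id)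
  then show thesis
    using that V by (auto simp: M_monoid_def tclass_id)
qed

text \<open>The inverse class \<open>B\<close> is only known to lie in \<open>O_tilde\<close>. Once
  its loops are shown to preserve length, \<open>A\<close> and \<open>B\<close> both come from
  codes; the two composites have identity tail maps, hence are translations, and this makes the code
  of \<open>A\<close> bijective.\<close>

lemma code_class_surj:
  assumes n: "n \<ge> 2" and A: "A \<in> carrier (L_group n)"
  shows "\<exists>f\<in>carrier (shift_aut n). A = code_class n f"
proof -
  have "A \<in> O_tilde n" "A \<in> L_tilde n"
    using A by (auto simp: L_group_simps Units_def)
  obtain B where B: "B \<in> O_tilde n" "A \<otimes>\<^bsub>M_monoid n\<^esub> B = \<one>\<^bsub>M_monoid n\<^esub>" "B \<otimes>\<^bsub>M_monoid n\<^esub> A = \<one>\<^bsub>M_monoid n\<^esub>"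
    using A by (auto simp: L_group_simps Units_def)
  obtain T1 where T1: "T1 \<in> min_transducers n" "A = tclass n T1"
    and T1_inj: "\<And>q. q \<in> states T1 \<Longrightarrow> inj_on (\<lambda>x. out_inf T1 x q) (seqs n)"
    using \<open>A \<in> O_tilde n\<close> unfolding O_tilde_def by blast
  \<comment> \<open>The conditions of \<open>O_tilde\<close> and \<open>L_tilde\<close> come with
    separate representatives; injectivity will be carried over from \<open>T1\<close> to
    \<open>T2\<close>.\<close>
  obtain T2 where T2: "T2 \<in> min_transducers n" "A = tclass n T2"
    and T2_loop: "\<And>w q. w \<in> lists {..<n} \<Longrightarrow> q \<in> states T2 \<Longrightarrow> trans_word T2 w q = q
      \<Longrightarrow> length (out_word T2 w q) = length w"
    using \<open>A \<in> L_tilde n\<close> unfolding L_tilde_def by blast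
  obtain U1 where U1: "U1 \<in> min_transducers n" "B = tclass n U1"
    and U1_inj: "\<And>q. q \<in> states U1 \<Longrightarrow> inj_on (\<lambda>x. out_inf U1 x q) (seqs n)"
    using \<open>B \<in> O_tilde n\<close> unfolding O_tilde_def by blast
  have A1: "A = map_class n (state_maps n T1)" and A2: "A = map_class n (state_maps n T2)"
    and B1: "B = map_class n (state_maps n U1)"
    using T1 T2 U1 tclass_eq min_transducers_weakly_minimal by metis+
  have "T2 \<in> map_class n (state_maps n T1)"
    using map_class_state_maps[OF T2(1)] A1 A2 by simp
  then have T12: "state_maps n T1 = state_maps n T2"
    by (simp add: map_class_def)
  obtain k where "length_preserving n T2 k"
    by (rule length_preservingI[OF n T2(1) inj_on_out_inf_transfer[OF T12 T1_inj] T2_loop])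
  then interpret T2: length_preserving n T2 k .
  let ?f = T2.code
  interpret f: right_injective n T2.radius ?f
    by (rule T2.code_right_injective)
  have Af: "A = map_class n (tail_maps n ?f)"
    using A2 T2.tail_maps_code by simp
  obtain U T V where UT: "U \<in> B" "T \<in> A" and V: "V \<in> tclass n (reduction n (core n (product U T)))"
    "V \<in> tclass n id_transducer"
    by (rule product_identity_from_mult[OF n B(3)])
  have U: "U \<in> min_transducers n" "state_maps n U1 = state_maps n U"
    using UT(1) by (simp_all add: B1 map_class_def)
  have T: "T \<in> min_transducers n" "state_maps n T1 = state_maps n T"
    using UT(2) by (simp_all add: A1 map_class_def)
  note U_inj = inj_on_out_inf_transfer[OF U(2) U1_inj]
  note inverse = product_identity[OF n U(1) T(1) U_inj inj_on_out_inf_transfer[OF T(2) T1_inj] V]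
  have T_loop: "length (out_word T w q) = length w"
    if "w \<in> lists {..<n}" "q \<in> states T" "trans_word T w q = q" for w q
    using UT(2) that unfolding Af by (rule f.map_class_loop)
  have U_loop: "length (out_word U w q) = length w"
    if "w \<in> lists {..<n}" "q \<in> states U" "trans_word U w q = q" for w q
    using U(1) T(1) by (intro loop_length_inverse[OF n _ _ _ _ T_loop inverse that])
      (simp_all add: min_transducers_def)
  obtain l where "length_preserving n U l"
    by (rule length_preservingI[OF n U(1) U_inj U_loop])
  then interpret U: length_preserving n U l .
  let ?g = U.code
  interpret g: right_injective n U.radius ?g
    by (rule U.code_right_injective)
  have Bg: "B = map_class n (tail_maps n ?g)"
    using B1 U(2) U.tail_maps_code by simp
  interpret fg: composable_codes n T2.radius ?f U.radius ?g
    by unfold_locales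
  interpret gf: composable_codes n U.radius ?g T2.radius ?f
    by unfold_locales
  have one: "\<one>\<^bsub>M_monoid n\<^esub> = map_class n {\<lambda>x\<in>seqs n. x}"
    by (simp add: M_monoid_def tclass_id)
  obtain W where W: "W \<in> map_class n {\<lambda>x\<in>seqs n. x}"
    using map_class_id_nonempty[OF n] by blast
  have "map_class n {\<lambda>x\<in>seqs n. x} = map_class n (tail_maps n (?g \<circ> ?f))"
    "map_class n {\<lambda>x\<in>seqs n. x} = map_class n (tail_maps n (?f \<circ> ?g))"
    using B(2,3) fg.mult_map_class gf.mult_map_class by (simp_all add: Af Bg one)
  note ids = this[THEN map_class_inj[OF W], symmetric]
  obtain c where c: "\<And>x. x \<in> seqs n \<Longrightarrow> (?g \<circ> ?f) x = translate c x"
    by (rule fg.gf.translate_if_tail_maps_id[OF ids(1)]) blast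
  obtain d where d: "\<And>x. x \<in> seqs n \<Longrightarrow> (?f \<circ> ?g) x = translate d x"
    by (rule gf.gf.translate_if_tail_maps_id[OF ids(2)]) blast
  have "inj_on ?f (seqs n)"
  proof (rule inj_onI)
    fix x y assume xy: "x \<in> seqs n" "y \<in> seqs n" and eq: "?f x = ?f y"
    then have "translate c x = translate c y"
      using c[OF xy(1)] c[OF xy(2)] by simp
    then have "translate (- c) (translate c x) = translate (- c) (translate c y)"
      by simp
    then show "x = y"
      by simp
  qed
  moreover have "?f ` seqs n = seqs n"
  proof
    show "?f ` seqs n \<subseteq> seqs n"
      using f.closed by blast
    show "seqs n \<subseteq> ?f ` seqs n"
    proof
      fix y :: "int \<Rightarrow> nat" assume y: "y \<in> seqs n"
      have "?f (?g (translate (- d) y)) = y"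
        using d[of "translate (- d) y"] y by simp
      moreover have "?g (translate (- d) y) \<in> seqs n"
        using y by (intro g.closed) simp
      ultimately show "y \<in> ?f ` seqs n"
        by (metis imageI)
    qed
  qed
  ultimately have "restrict ?f (seqs n) \<in> carrier (shift_aut n)"
    by (intro f.restrict_in_shift_aut) (simp add: bij_betw_def)
  moreover have "A = code_class n (restrict ?f (seqs n))"
    using tail_maps_cong[of n "restrict ?f (seqs n)" ?f] by (simp add: code_class_def Af)
  ultimately show ?thesis
    by blast
qed

lemma code_class_eq_one_iff:
  assumes n: "n \<ge> 2" and f: "f \<in> carrier (shift_aut n)"
  shows "code_class n f = \<one>\<^bsub>M_monoid n\<^esub> \<longleftrightarrow> f \<in> range (translation n)"
proof
  assume "code_class n f = \<one>\<^bsub>M_monoid n\<^esub>"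
  then have eq: "map_class n {\<lambda>x\<in>seqs n. x} = map_class n (tail_maps n f)"
    by (simp add: code_class_def M_monoid_def tclass_id)
  obtain W where "W \<in> map_class n {\<lambda>x\<in>seqs n. x}"
    using map_class_id_nonempty[OF n] by blast
  then have tm: "tail_maps n f = {\<lambda>x\<in>seqs n. x}"
    using map_class_inj[OF _ eq] by simp
  obtain m where m: "right_injective n m f"
    by (rule shift_aut_right_injective[OF n f])
  obtain c where c: "\<And>x. x \<in> seqs n \<Longrightarrow> f x = translate c x"
    using right_injective.translate_if_tail_maps_id[OF m tm] by blast
  have "f \<in> extensional (seqs n)"
    using f by (simp add: carrier_shift_aut Bij_def)
  then have "f = translation n c"
    unfolding translation_def by (rule extensionalityI) (use c in auto)
  then show "f \<in> range (translation n)"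
    by blast
next
  assume "f \<in> range (translation n)"
  then obtain c where "f = translation n c"
    by blast
  then have "tail_maps n f = tail_maps n (translate c)"
    by (intro tail_maps_cong) (simp add: translation_def)
  then show "code_class n f = \<one>\<^bsub>M_monoid n\<^esub>"
    by (simp add: code_class_def tail_maps_translate[OF n] M_monoid_def tclass_id)
qed

theorem theorem1p1:
  fixes n :: nat
  assumes "n \<ge> 2"
  shows "group (shift_aut n) \<and> group (L_group n) \<and>
    shift n \<in> carrier (shift_aut n) \<and>
    subgroup_generated (shift_aut n) {shift n} \<cong> integer_group \<and>
    carrier (subgroup_generated (shift_aut n) {shift n}) = center (shift_aut n) \<and>
    id \<in> mon (subgroup_generated (shift_aut n) {shift n}) (shift_aut n) \<and>
    (\<exists>\<phi> \<in> epi (shift_aut n) (L_group n).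
       id ` carrier (subgroup_generated (shift_aut n) {shift n})
         = kernel (shift_aut n) (L_group n) \<phi>)"
proof -
  interpret group "shift_aut n"
    by (rule group_shift_aut)
  note n = assms
  note range = carrier_shift_powers[OF n]
  \<comment> \<open>The product of transducers applies the left factor first, so \<^term>\<open>code_class n\<close> reverses products.\<close>
  define \<phi> where "\<phi> f = code_class n (inv\<^bsub>shift_aut n\<^esub> f)" for f
  have hom: "\<phi> \<in> hom (shift_aut n) (L_group n)"
  proof (rule homI)
    fix f g assume fg: "f \<in> carrier (shift_aut n)" "g \<in> carrier (shift_aut n)"
    then show "\<phi> (f \<otimes>\<^bsub>shift_aut n\<^esub> g) = \<phi> f \<otimes>\<^bsub>L_group n\<^esub> \<phi> g"
      by (simp add: \<phi>_def L_group_simps code_class_mult[OF n] inv_mult_group)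
  qed (simp add: \<phi>_def code_class_in_L_group[OF n])
  have surj: "\<phi> ` carrier (shift_aut n) = carrier (L_group n)"
  proof
    show "\<phi> ` carrier (shift_aut n) \<subseteq> carrier (L_group n)"
      using hom by (auto simp: hom_def)
    show "carrier (L_group n) \<subseteq> \<phi> ` carrier (shift_aut n)"
    proof
      fix A assume "A \<in> carrier (L_group n)"
      then obtain f where f: "f \<in> carrier (shift_aut n)" "A = code_class n f"
        using code_class_surj[OF n] by blast
      then have "A = \<phi> (inv\<^bsub>shift_aut n\<^esub> f)"
        by (simp add: \<phi>_def)
      then show "A \<in> \<phi> ` carrier (shift_aut n)"
        using f(1) by blast
    qed
  qed
  have one: "\<phi> \<one>\<^bsub>shift_aut n\<^esub> = \<one>\<^bsub>L_group n\<^esub>"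
    by (simp add: \<phi>_def L_group_simps) (simp add: one_shift_aut code_class_one[OF n])
  have "(L_group n)\<lparr>carrier := carrier (L_group n), one := \<one>\<^bsub>L_group n\<^esub>\<rparr> = L_group n"
    by simp
  \<comment> \<open>The image of a group under a homomorphism: associativity and inverses come from
    \<open>shift_aut n\<close>.\<close>
  then have L: "group (L_group n)"
    using hom_imp_img_group[OF hom] by (simp add: surj one)
  have shift: "shift n \<in> carrier (shift_aut n)"
    unfolding shift_eq_translation by (rule translation_in_shift_aut[OF n])
  have range_sub: "range (translation n) \<subseteq> carrier (shift_aut n)"
    using translation_in_shift_aut[OF n] by blast
  have mon: "id \<in> mon (subgroup_generated (shift_aut n) {shift n}) (shift_aut n)"
    using range_sub by (auto simp: mon_def hom_def range)
  have "f \<in> kernel (shift_aut n) (L_group n) \<phi> \<longleftrightarrow> f \<in> range (translation n)" for f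
  proof -
    interpret sub: subgroup "range (translation n)" "shift_aut n"
      using subgroup_subgroup_generated[of "{shift n}"] by (simp add: range)
    have "f \<in> kernel (shift_aut n) (L_group n) \<phi>
        \<longleftrightarrow> f \<in> carrier (shift_aut n) \<and> inv\<^bsub>shift_aut n\<^esub> f \<in> range (translation n)"
      using code_class_eq_one_iff[OF n] by (auto simp: kernel_def \<phi>_def L_group_simps)
    also have "\<dots> \<longleftrightarrow> f \<in> range (translation n)"
    proof
      assume "f \<in> carrier (shift_aut n) \<and> inv\<^bsub>shift_aut n\<^esub> f \<in> range (translation n)"
      then show "f \<in> range (translation n)"
        using sub.m_inv_closed[of "inv\<^bsub>shift_aut n\<^esub> f"] by simp
    next
      assume "f \<in> range (translation n)"
      then show "f \<in> carrier (shift_aut n) \<and> inv\<^bsub>shift_aut n\<^esub> f \<in> range (translation n)"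
        using sub.m_inv_closed[of f] range_sub by blast
    qed
    finally show ?thesis .
  qed
  then have kernel: "id ` carrier (subgroup_generated (shift_aut n) {shift n})
      = kernel (shift_aut n) (L_group n) \<phi>"
    by (auto simp: range)
  have "\<phi> \<in> epi (shift_aut n) (L_group n)"
    using hom surj by (simp add: epi_def)
  then show ?thesis
    using group_shift_aut L shift shift_powers_iso[OF n] mon kernel
    by (auto simp: range center_shift_aut[OF n])
qed

end
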